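(* Let $K$ be a field, let $P$ be a finite poset and let $L=\mathcal{J}(P)$ be the distributive lattice of poset ideals of $P$. Then the following conditions are equivalent: (i) $P$ is the (ordinal) sum of antichains; (ii) $L_a$ is vertex decomposable for each $a\in L$; (iii) $L_a$ is shellable for each $a\in L$; (iv) $L_a$ is Cohen--Macaulay (over $K$) for each $a\in L$.
   Context: All posets are finite. A poset ideal of $P$ is a subset $\alpha\subset P$ such that $x\in\alpha$, $y\le x$ imply $y\in \alpha$. $\mathcal{J}(P)$ is the set of all poset ideals of $P$ (including $\emptyset$ and $P$), ordered by inclusion. For $a\in L$, $L_a:=\{x\in L: x\not\ge a\}$ with the induced order. An antichain is a poset in which any two distinct elements are incomparable. $P$ is the sum of antichains if $P$ is an ordinal sum of antichains, i.e. $P$ is a disjoint union $A_0\sqcup A_1\sqcup\cdots\sqcup A_r$ of antichains such that $x<y$ whenever $x\in A_i$, $y\in A_j$, $i<j$. The order complex $\Delta(Q)$ of a poset $Q$ is the simplicial complex on $Q$ whose faces are the chains of $Q$. A poset $Q$ is called vertex decomposable, shellable or Cohen--Macaulay if $\Delta(Q)$ is so. For the empty poset, $\Delta(\emptyset)=\{\emptyset\}$, which is regarded as a simplex. A simplicial complex is pure if all its facets (maximal faces) have the same cardinality. The link of a face $F$ is $\mathrm{link}_\Delta F=\{F'\in\Delta: F\cap F'=\emptyset, F\cup F'\in\Delta\}$. A pure simplicial complex $\Delta$ is vertex decomposable if either $\Delta$ is a simplex or there is a vertex $x$ of $\Delta$ such that (1) $\Delta-x:=\{\sigma\in\Delta: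 x\notin\sigma\}$ and $\mathrm{link}_\Delta\{x\}$ are vertex decomposable, and (2) no face of $\mathrm{link}_\Delta\{x\}$ is a facet of $\Delta-x$. A pure simplicial complex $\Delta$ of dimension $d-1$ is shellable if its facets can be ordered $F_1,\dots,F_s$ so that $(\bigcup_{j=1}^{i-1}\langle F_j\rangle)\cap\langle F_i\rangle$ is pure of dimension $d-2$ for each $1<i\le s$, where $\langle F\rangle=\{\sigma: \sigma\subset F\}$. $\Delta$ is Cohen--Macaulay (over $K$) if its Stanley--Reisner ring $K[\Delta]$ is Cohen--Macaulay. *)

theory Defs
  imports
    "HOL-Library.Poly_Mapping"
    "HOL-Library.Extended_Nat"
    "HOL-Library.Disjoint_Sets"
    "HOL-Algebra.Ring_Divisibility"
begin

section \<open>Posets\<close>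

text \<open>A finite poset is a finite subset of a type of class \<^class>\<open>order\<close>, with the induced order.
  For the lattice of poset ideals the ambient order is inclusion on the type of sets.\<close>

definition poset_ideals :: "'a::order set \<Rightarrow> 'a set set" where
  "poset_ideals P = {\<alpha>. \<alpha> \<subseteq> P \<and> (\<forall>x\<in>\<alpha>. \<forall>y\<in>P. y \<le> x \<longrightarrow> y \<in> \<alpha>)}"

definition not_above :: "'a::order set \<Rightarrow> 'a \<Rightarrow> 'a set" where
  "not_above L a = {x \<in> L. \<not> a \<le> x}"

definition antichain :: "'a::order set \<Rightarrow> bool" where
  "antichain A \<longleftrightarrow> (\<forall>x\<in>A. \<forall>y\<in>A. x \<noteq> y \<longrightarrow> \<not> x \<le> y \<and> \<not> y \<le> x)"

definition sum_of_antichains :: "'a::order set \<Rightarrow> bool" where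
  "sum_of_antichains P \<longleftrightarrow>
     (\<exists>(r::nat) A. P = (\<Union>i\<le>r. A i) \<and> disjoint_family_on A {..r} \<and> (\<forall>i\<le>r. antichain (A i)) \<and>
        (\<forall>i j. i < j \<and> j \<le> r \<longrightarrow> (\<forall>x\<in>A i. \<forall>y\<in>A j. x < y)))"

section \<open>Simplicial complexes\<close>

text \<open>A complex is its set of faces; its vertex set is the union of the faces.\<close>

definition simplicial_complex :: "'v set set \<Rightarrow> bool" where
  "simplicial_complex \<Delta> \<longleftrightarrow>
     finite (\<Union>\<Delta>) \<and> {} \<in> \<Delta> \<and> (\<forall>F\<in>\<Delta>. \<forall>G. G \<subseteq> F \<longrightarrow> G \<in> \<Delta>)"

definition order_complex :: "'a::order set \<Rightarrow> 'a set set" where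
  "order_complex Q = {C. C \<subseteq> Q \<and> (\<forall>x\<in>C. \<forall>y\<in>C. x \<le> y \<or> y \<le> x)}"

definition facets :: "'v set set \<Rightarrow> 'v set set" where
  "facets \<Delta> = {F \<in> \<Delta>. \<forall>G\<in>\<Delta>. F \<subseteq> G \<longrightarrow> G = F}"

definition pure_complex :: "'v set set \<Rightarrow> bool" where
  "pure_complex \<Delta> \<longleftrightarrow> (\<forall>F\<in>facets \<Delta>. \<forall>G\<in>facets \<Delta>. card F = card G)"

text \<open>In particular the complex whose only face is the empty set has dimension \<open>-1\<close>.\<close>

definition complex_dim :: "'v set set \<Rightarrow> int" where
  "complex_dim \<Delta> = int (Max (card ` \<Delta>)) - 1"

definition link :: "'v set set \<Rightarrow> 'v set \<Rightarrow> 'v set set" where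
  "link \<Delta> F = {F' \<in> \<Delta>. F \<inter> F' = {} \<and> F \<union> F' \<in> \<Delta>}"

definition deletion :: "'v set set \<Rightarrow> 'v \<Rightarrow> 'v set set" where
  "deletion \<Delta> x = {\<sigma> \<in> \<Delta>. x \<notin> \<sigma>}"

inductive vertex_decomposable :: "'v set set \<Rightarrow> bool" where
  simplex: "finite V \<Longrightarrow> vertex_decomposable (Pow V)"
| shedding:
    "\<lbrakk>simplicial_complex \<Delta>; pure_complex \<Delta>; {x} \<in> \<Delta>;
      vertex_decomposable (deletion \<Delta> x); vertex_decomposable (link \<Delta> {x});
      link \<Delta> {x} \<inter> facets (deletion \<Delta> x) = {}\<rbrakk>
     \<Longrightarrow> vertex_decomposable \<Delta>"

definition shellable :: "'v set set \<Rightarrow> bool" where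
  "shellable \<Delta> \<longleftrightarrow> simplicial_complex \<Delta> \<and> pure_complex \<Delta> \<and>
     (\<exists>Fs. distinct Fs \<and> set Fs = facets \<Delta> \<and>
        (\<forall>i. 0 < i \<and> i < length Fs \<longrightarrow>
           (let \<Gamma> = (\<Union>j<i. Pow (Fs ! j)) \<inter> Pow (Fs ! i)
            in pure_complex \<Gamma> \<and> complex_dim \<Gamma> = complex_dim \<Delta> - 1)))"

section \<open>Cohen--Macaulay rings\<close>

definition regular_sequence :: "('a, 'm) ring_scheme \<Rightarrow> 'a list \<Rightarrow> bool" where
  "regular_sequence R xs \<longleftrightarrow> set xs \<subseteq> carrier R \<and> genideal R (set xs) \<noteq> carrier R \<and>
     (\<forall>i<length xs. \<forall>y\<in>carrier R.
        xs ! i \<otimes>\<^bsub>R\<^esub> y \<in> genideal R (set (take i xs)) \<longrightarrow> y \<in> genideal R (set (take i xs)))"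

definition ideal_depth :: "('a, 'm) ring_scheme \<Rightarrow> 'a set \<Rightarrow> enat" where
  "ideal_depth R I = Sup {enat (length xs) | xs. regular_sequence R xs \<and> set xs \<subseteq> I}"

definition prime_height :: "('a, 'm) ring_scheme \<Rightarrow> 'a set \<Rightarrow> enat" where
  "prime_height R p = Sup {enat n | n. \<exists>q. (\<forall>i\<le>n. primeideal (q i) R) \<and>
     (\<forall>i<n. q i \<subset> q (Suc i)) \<and> q n = p}"

text \<open>The definition in Eisenbud, \<^emph>\<open>Commutative Algebra\<close>, Section 18.2: depth equals
  codimension at every maximal ideal.  For a maximal ideal \<open>\<mm>\<close> these two numbers are the depth and
  the dimension of the localization at \<open>\<mm>\<close>.\<close>

definition cohen_macaulay_ring :: "('a, 'm) ring_scheme \<Rightarrow> bool" where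
  "cohen_macaulay_ring R \<longleftrightarrow> cring R \<and> noetherian_ring R \<and>
     (\<forall>\<mm>. maximalideal \<mm> R \<longrightarrow> ideal_depth R \<mm> = prime_height R \<mm>)"

section \<open>Stanley--Reisner rings\<close>

text \<open>A monomial is a finitely supported exponent function \<open>'v \<Rightarrow>\<^sub>0 nat\<close>.  The polynomial ring in
  the variables indexed by \<open>V\<close> consists of the polynomials all of whose monomials are supported
  in \<open>V\<close>.\<close>

definition polynomial_ring :: "'v set \<Rightarrow> (('v \<Rightarrow>\<^sub>0 nat) \<Rightarrow>\<^sub>0 'k::field) ring" where
  "polynomial_ring V =
     \<lparr>carrier = {p. \<forall>m\<in>Poly_Mapping.keys p. Poly_Mapping.keys m \<subseteq> V},
      mult = (*), one = 1, zero = 0, add = (+)\<rparr>"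

definition variable :: "'v \<Rightarrow> (('v \<Rightarrow>\<^sub>0 nat) \<Rightarrow>\<^sub>0 'k::field)" where
  "variable v = Poly_Mapping.single (Poly_Mapping.single v 1) 1"

definition stanley_reisner_ideal :: "'v set set \<Rightarrow> (('v \<Rightarrow>\<^sub>0 nat) \<Rightarrow>\<^sub>0 'k::field) set" where
  "stanley_reisner_ideal \<Delta> =
     genideal (polynomial_ring (\<Union>\<Delta>)) {\<Prod>v\<in>F. variable v | F. F \<subseteq> \<Union>\<Delta> \<and> F \<notin> \<Delta>}"

definition stanley_reisner_ring ::
    "'k::field itself \<Rightarrow> 'v set set \<Rightarrow> (('v \<Rightarrow>\<^sub>0 nat) \<Rightarrow>\<^sub>0 'k) set ring" where
  "stanley_reisner_ring K \<Delta> = polynomial_ring (\<Union>\<Delta>) Quot stanley_reisner_ideal \<Delta>"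

text \<open>The field \<open>K\<close> is given as a type, by an argument of type \<open>'k itself\<close>.\<close>

definition cohen_macaulay :: "'k::field itself \<Rightarrow> 'v set set \<Rightarrow> bool" where
  "cohen_macaulay K \<Delta> \<longleftrightarrow> simplicial_complex \<Delta> \<and> cohen_macaulay_ring (stanley_reisner_ring K \<Delta>)"

end

theory Submission
  imports Defs "HOL-Computational_Algebra.Polynomial"
begin

text \<open>Purity of all \<open>L\<^sub>a\<close> already forces (i): for incomparable \<open>p\<close>, \<open>q\<close> let \<open>a\<close> be the ideal generated
  by them and let \<open>U p\<close> be the set of elements above \<open>p\<close>.  Then \<open>L\<^sub>a\<close> is the union of the intervals below
  \<open>P - U p\<close> and \<open>P - U q\<close>, so purity gives \<open>card (U p) = card (U q)\<close>, and if all incomparable pairs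
  have this property the levels of \<open>p \<mapsto> card (U p)\<close> exhibit \<open>P\<close> as a sum of antichains.  A Cohen--Macaulay complex is pure because the
  depth at the origin is at most the dimension of every associated prime, in particular of the
  prime of every facet.

  Conversely, for a sum of antichains \<open>L\<^sub>a\<close> is built from \<open>L\<^sub>b\<close>, where \<open>b\<close> is \<open>a\<close> without one of its
  maximal elements, by adding an interval from the top down; the links met on the way are joins of
  smaller complexes of the same kind, up to duality.  This gives vertex decomposability, hence a
  shelling.  The cardinality of ideals colours the vertices of each facet bijectively, and the sums
  \<open>\<theta>\<^sub>i\<close> of the variables of colour \<open>i\<close> restrict to a single variable on each facet.  By the Nullstellensatz
  every maximal ideal contains polynomials \<open>g\<^sub>i(\<theta>\<^sub>i) \<noteq> 0\<close>, and by induction along the shelling these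
  form a regular sequence whose length is the dimension.\<close>

section \<open>Ideals of a subring\<close>

text \<open>The Cohen--Macaulay condition concerns all maximal ideals, and \<open>K\<close> is an
  arbitrary field, possibly finite and not algebraically closed. A maximal ideal need not be a point
  that a translation moves to the origin, nor contain the forms \<theta> i or translates of them;
  polynomials in the \<theta> i replace these. At each maximal ideal depth and height are then
  squeezed between a regular sequence of length \<open>d\<close> and the bound \<open>d\<close> on
  chains of primes. That bound comes from counting monomials, so neither localizations nor integral
  extensions are constructed.

  From each of (ii), (iii), (iv) the way back to (i) extracts a single inequality: no face is larger
  than a facet.

  The induction behind vertex decomposability has to treat all sums of antichains and their duals
  together: the link of an ideal is the join of the part below it, a complex of the same kind, and
  the part above it, which is of this kind only for the reversed order. Rank functions in place of
  the order of \<open>P\<close> make the reversal a change of sign.\<close>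

locale relative_ring =
  fixes S :: "'r::comm_ring_1 set"
  assumes one_in [simp, intro]: "1 \<in> S"
    and diff_in [intro]: "\<lbrakk>a \<in> S; b \<in> S\<rbrakk> \<Longrightarrow> a - b \<in> S"
    and mult_in [intro]: "\<lbrakk>a \<in> S; b \<in> S\<rbrakk> \<Longrightarrow> a * b \<in> S"
begin

lemma zero_in [simp, intro]: "0 \<in> S"
  using diff_in[OF one_in one_in] by simp

lemma uminus_in [intro]: "a \<in> S \<Longrightarrow> - a \<in> S"
  using diff_in[OF zero_in, of a] by simp

lemma add_in [intro]: "\<lbrakk>a \<in> S; b \<in> S\<rbrakk> \<Longrightarrow> a + b \<in> S"
  using diff_in[of a "- b"] uminus_in by simp

lemma power_in [intro]: "a \<in> S \<Longrightarrow> a ^ n \<in> S"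
  by (induction n) auto

lemma sum_in: "(\<And>i. i \<in> A \<Longrightarrow> f i \<in> S) \<Longrightarrow> sum f A \<in> S"
  by (induction A rule: infinite_finite_induct) auto

lemma prod_in: "(\<And>i. i \<in> A \<Longrightarrow> f i \<in> S) \<Longrightarrow> prod f A \<in> S"
  by (induction A rule: infinite_finite_induct) auto

text \<open>Ideals are relative to a subset \<open>S\<close> of a ring type: the polynomials over
  \<open>'k\<close> with variables from \<open>'v\<close> form one type, in which the polynomial
  ring on a finite \<open>V\<close> is in general a proper subset.\<close>

definition idl :: "'r set \<Rightarrow> bool" where
  "idl I \<longleftrightarrow> I \<subseteq> S \<and> 0 \<in> I \<and> (\<forall>a\<in>I. \<forall>b\<in>I. a + b \<in> I) \<and> (\<forall>s\<in>S. \<forall>a\<in>I. s * a \<in> I)"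

definition prime_idl :: "'r set \<Rightarrow> bool" where
  "prime_idl I \<longleftrightarrow> idl I \<and> 1 \<notin> I \<and> (\<forall>a\<in>S. \<forall>b\<in>S. a * b \<in> I \<longrightarrow> a \<in> I \<or> b \<in> I)"

definition maximal_idl :: "'r set \<Rightarrow> bool" where
  "maximal_idl I \<longleftrightarrow> idl I \<and> 1 \<notin> I \<and> (\<forall>J. idl J \<longrightarrow> I \<subseteq> J \<longrightarrow> 1 \<notin> J \<longrightarrow> J = I)"

definition ext :: "'r set \<Rightarrow> 'r \<Rightarrow> 'r set" where
  "ext I y = {i + s * y | i s. i \<in> I \<and> s \<in> S}"

definition colon :: "'r set \<Rightarrow> 'r \<Rightarrow> 'r set" where
  "colon I z = {s \<in> S. s * z \<in> I}"

definition gen :: "'r set \<Rightarrow> 'r set" where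
  "gen X = \<Inter>{I. idl I \<and> X \<subseteq> I}"

definition noeth :: bool where
  "noeth \<longleftrightarrow> (\<forall>I. idl I \<longrightarrow> (\<exists>X. finite X \<and> X \<subseteq> I \<and> I = gen X))"

text \<open>Properness of the final ideal is left out. It is automatic for sequences inside a proper
  ideal containing \<open>I\<close>, and without it an induction can start from the unit
  ideal.\<close>

fun weakly_regular :: "'r set \<Rightarrow> 'r list \<Rightarrow> bool" where
  "weakly_regular I [] \<longleftrightarrow> True"
| "weakly_regular I (y # ys) \<longleftrightarrow> (\<forall>f\<in>S. y * f \<in> I \<longrightarrow> f \<in> I) \<and> weakly_regular (ext I y) ys"

lemma idlD:
  assumes "idl I"
  shows "I \<subseteq> S" "0 \<in> I" "\<lbrakk>a \<in> I; b \<in> I\<rbrakk> \<Longrightarrow> a + b \<in> I" "\<lbrakk>s \<in> S; a \<in> I\<rbrakk> \<Longrightarrow> s * a \<in> I"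
    "\<lbrakk>s \<in> S; a \<in> I\<rbrakk> \<Longrightarrow> a * s \<in> I" "a \<in> I \<Longrightarrow> - a \<in> I" "\<lbrakk>a \<in> I; b \<in> I\<rbrakk> \<Longrightarrow> a - b \<in> I"
    "a \<in> I \<Longrightarrow> a \<in> S"
proof -
  have m: "\<And>s a. s \<in> S \<Longrightarrow> a \<in> I \<Longrightarrow> s * a \<in> I" and p: "\<And>a b. a \<in> I \<Longrightarrow> b \<in> I \<Longrightarrow> a + b \<in> I"
    using assms by (auto simp: idl_def)
  have u: "- a \<in> I" if "a \<in> I" for a
    using m[of "- 1" a] that uminus_in[OF one_in] by simp
  show "I \<subseteq> S" "0 \<in> I" "a \<in> I \<Longrightarrow> a \<in> S" using assms by (auto simp: idl_def)
  show "\<lbrakk>a \<in> I; b \<in> I\<rbrakk> \<Longrightarrow> a + b \<in> I" "\<lbrakk>s \<in> S; a \<in> I\<rbrakk> \<Longrightarrow> s * a \<in> I" "\<lbrakk>s \<in> S; a \<in> I\<rbrakk> \<Longrightarrow> a * s \<in> I"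
    "a \<in> I \<Longrightarrow> - a \<in> I"
    using m[of s a] p u by (auto simp: mult.commute)
  show "\<lbrakk>a \<in> I; b \<in> I\<rbrakk> \<Longrightarrow> a - b \<in> I" using p[of a "- b"] u by simp
qed

lemma idl_sum: "idl I \<Longrightarrow> (\<And>i. i \<in> A \<Longrightarrow> f i \<in> I) \<Longrightarrow> sum f A \<in> I"
  by (induction A rule: infinite_finite_induct) (auto simp: idlD)

lemma idl_diff_cong:
  assumes "idl I" "a - b \<in> I" shows "a \<in> I \<longleftrightarrow> b \<in> I"
proof
  assume "a \<in> I" then show "b \<in> I" using idlD(7)[OF assms(1) _ assms(2), of a] by simp
next
  assume "b \<in> I" then show "a \<in> I" using idlD(3)[OF assms(1) assms(2), of b] by simp
qed

lemma idl_power_cong: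
  assumes I: "idl I" and "a \<in> S" "b \<in> S" "a - b \<in> I"
  shows "a ^ n - b ^ n \<in> I"
proof (induction n)
  case (Suc n)
  have "a ^ Suc n - b ^ Suc n = a * (a ^ n - b ^ n) + b ^ n * (a - b)" by (simp add: algebra_simps)
  also have "\<dots> \<in> I" using Suc assms by (intro idlD(3)[OF I] idlD(4)[OF I]) auto
  finally show ?case .
qed (use idlD(2)[OF I] in auto)

lemma prime_idl_power: "prime_idl I \<Longrightarrow> a \<in> S \<Longrightarrow> a ^ n \<in> I \<Longrightarrow> a \<in> I"
  by (induction n) (auto simp: prime_idl_def)

lemma ext_idl:
  assumes "idl I" "y \<in> S"
  shows "idl (ext I y)"
  unfolding idl_def
proof (intro conjI ballI)
  show "ext I y \<subseteq> S" using assms idlD(1)[OF assms(1)] by (auto simp: ext_def)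
  show "0 \<in> ext I y"
    using idlD(2)[OF assms(1)] unfolding ext_def by (auto intro!: exI[of _ 0])
  show "a + b \<in> ext I y" if ab: "a \<in> ext I y" "b \<in> ext I y" for a b
  proof -
    obtain i s j t where "a = i + s * y" "b = j + t * y" "i \<in> I" "j \<in> I" "s \<in> S" "t \<in> S"
      using ab unfolding ext_def by blast
    then have "a + b = (i + j) + (s + t) * y" "i + j \<in> I" "s + t \<in> S"
      using idlD[OF assms(1)] by (auto simp: algebra_simps)
    then show ?thesis unfolding ext_def by blast
  qed
  show "s * a \<in> ext I y" if sa: "s \<in> S" "a \<in> ext I y" for s a
  proof -
    obtain i t where "a = i + t * y" "i \<in> I" "t \<in> S"
      using sa unfolding ext_def by blast
    then have "s * a = s * i + (s * t) * y" "s * i \<in> I" "s * t \<in> S"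
      using idlD(4)[OF assms(1)] sa by (auto simp: distrib_left mult.assoc)
    then show ?thesis unfolding ext_def by blast
  qed
qed

lemma ext_superset: "I \<subseteq> ext I y"
  by (force simp: ext_def)

lemma ext_mem: "idl I \<Longrightarrow> y \<in> ext I y"
  unfolding ext_def using idlD(2)[of I] by (intro CollectI exI[of _ "0::'r"] exI[of _ "1::'r"]) auto

lemma extI: "\<lbrakk>i \<in> I; s \<in> S; a = i + s * y\<rbrakk> \<Longrightarrow> a \<in> ext I y"
  unfolding ext_def by blast

lemma extE: "a \<in> ext I y \<Longrightarrow> (\<And>i s. \<lbrakk>i \<in> I; s \<in> S; a = i + s * y\<rbrakk> \<Longrightarrow> Q) \<Longrightarrow> Q"
  unfolding ext_def by blast

lemma ext_least: "\<lbrakk>idl J; I \<subseteq> J; y \<in> J\<rbrakk> \<Longrightarrow> ext I y \<subseteq> J"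
  by (auto simp: ext_def idlD subset_iff)

lemma ext_swap: "ext (ext I x) y = ext (ext I y) x"
proof -
  have "ext (ext I x) y \<subseteq> ext (ext I y) x" for x y
  proof
    fix a assume "a \<in> ext (ext I x) y"
    then obtain i s t where "i \<in> I" "s \<in> S" "t \<in> S" "a = i + s * x + t * y" by (metis extE)
    then show "a \<in> ext (ext I y) x"
      by (intro extI[of "i + t * y" _ s] extI[of i _ t]) auto
  qed
  then show ?thesis by blast
qed

lemma colon_idl: "idl I \<Longrightarrow> z \<in> S \<Longrightarrow> idl (colon I z)"
  unfolding idl_def colon_def by (auto simp: algebra_simps subset_iff)

lemma gen_idl: "X \<subseteq> S \<Longrightarrow> idl (gen X)"
proof -
  assume X: "X \<subseteq> S"
  have "idl S" by (auto simp: idl_def)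
  then have "gen X \<subseteq> S" using X by (auto simp: gen_def)
  then show ?thesis by (auto simp: idl_def gen_def)
qed

lemma gen_superset: "X \<subseteq> gen X" by (auto simp: gen_def)

lemma gen_least: "idl I \<Longrightarrow> X \<subseteq> I \<Longrightarrow> gen X \<subseteq> I" by (auto simp: gen_def)

lemma exts_idl: "idl I \<Longrightarrow> set ys \<subseteq> S \<Longrightarrow> idl (foldl ext I ys)"
  by (induction ys arbitrary: I) (auto intro: ext_idl)

lemma exts_superset: "I \<subseteq> foldl ext I ys"
  by (induction ys arbitrary: I) (auto dest: subsetD[OF ext_superset])

lemma exts_mem: "idl I \<Longrightarrow> set ys \<subseteq> S \<Longrightarrow> set ys \<subseteq> foldl ext I ys"
proof (induction ys arbitrary: I)
  case (Cons y ys)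
  then show ?case using ext_mem[of I y] exts_superset[of "ext I y" ys] ext_idl by auto
qed simp

lemma exts_least: "\<lbrakk>idl J; I \<subseteq> J; set ys \<subseteq> J\<rbrakk> \<Longrightarrow> foldl ext I ys \<subseteq> J"
proof (induction ys arbitrary: I)
  case (Cons y ys)
  then show ?case using ext_least[of J I y] by auto
qed simp

lemma weakly_regular_snoc:
  "weakly_regular I (ys @ [y]) \<longleftrightarrow>
     weakly_regular I ys \<and> (\<forall>f\<in>S. y * f \<in> foldl ext I ys \<longrightarrow> f \<in> foldl ext I ys)"
  by (induction ys arbitrary: I) auto

lemma weakly_regular_nth:
  "weakly_regular I ys \<longleftrightarrow>
     (\<forall>i<length ys. \<forall>f\<in>S. ys ! i * f \<in> foldl ext I (take i ys) \<longrightarrow> f \<in> foldl ext I (take i ys))"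
proof (induction ys rule: rev_induct)
  case (snoc y ys)
  then show ?case unfolding weakly_regular_snoc by (auto simp: less_Suc_eq nth_append)
qed simp

section \<open>Prime ideals and depth\<close>

lemma Union_chain_idl:
  assumes "C \<noteq> {}" "\<And>J. J \<in> F \<Longrightarrow> idl J" "subset.chain F C"
  shows "idl (\<Union>C)"
  unfolding idl_def
proof (intro conjI ballI)
  have CF: "\<And>J. J \<in> C \<Longrightarrow> idl J" and lin: "\<And>J K. J \<in> C \<Longrightarrow> K \<in> C \<Longrightarrow> J \<subseteq> K \<or> K \<subseteq> J"
    using assms(2,3) unfolding subset.chain_def by blast+
  show "\<Union>C \<subseteq> S" using CF idlD(1) by blast
  show "0 \<in> \<Union>C" using CF idlD(2) assms(1) by blast
  show "a + b \<in> \<Union>C" if ab: "a \<in> \<Union>C" "b \<in> \<Union>C" for a b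
  proof -
    obtain J K where "J \<in> C" "K \<in> C" "a \<in> J" "b \<in> K" using ab by blast
    then obtain L where "L \<in> C" "a \<in> L" "b \<in> L" using lin[of J K] by blast
    then show ?thesis using CF idlD(3) by blast
  qed
  show "s * a \<in> \<Union>C" if "s \<in> S" "a \<in> \<Union>C" for s a using that CF idlD(4) by blast
qed

text \<open>An ideal \<open>q\<close> maximal among those that contain \<open>I\<close> and miss
  \<open>M\<close> is prime: if \<open>a\<close> and \<open>b\<close> lie outside \<open>q\<close>,
  then \<open>q + S a\<close> and \<open>q + S b\<close> both meet \<open>M\<close>, and with
  \<open>a * b\<close> in \<open>q\<close> the product of the two elements of \<open>M\<close> would
  be in \<open>q\<close>.\<close>

lemma prime_avoiding:
  assumes I: "idl I" and M: "M \<subseteq> S" "1 \<in> M" "\<And>a b. a \<in> M \<Longrightarrow> b \<in> M \<Longrightarrow> a * b \<in> M"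
    and disj: "I \<inter> M = {}"
  obtains q where "prime_idl q" "I \<subseteq> q" "q \<inter> M = {}"
proof -
  define F where "F = {J. idl J \<and> I \<subseteq> J \<and> J \<inter> M = {}}"
  have ne: "F \<noteq> {}" using I disj by (auto simp: F_def)
  have "\<Union>C \<in> F" if C: "C \<noteq> {}" "subset.chain F C" for C
  proof -
    have CF: "\<And>J. J \<in> C \<Longrightarrow> idl J \<and> I \<subseteq> J \<and> J \<inter> M = {}"
      using C(2) unfolding subset.chain_def F_def by blast
    moreover have "idl (\<Union>C)" using Union_chain_idl[OF C(1) _ C(2)] by (auto simp: F_def)
    ultimately show ?thesis using C(1) by (auto simp: F_def)
  qed
  then obtain q where q: "q \<in> F" and qm: "\<And>J. J \<in> F \<Longrightarrow> q \<subseteq> J \<Longrightarrow> J = q"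
    using subset_Zorn_nonempty[OF ne] by blast
  have qi: "idl q" and Iq: "I \<subseteq> q" and qM: "q \<inter> M = {}" using q by (auto simp: F_def)
  have meet: "\<exists>i\<in>q. \<exists>s\<in>S. i + s * a \<in> M" if "a \<in> S" "a \<notin> q" for a
  proof (rule ccontr)
    assume "\<not> ?thesis"
    then have "ext q a \<in> F"
      using ext_idl[OF qi that(1)] ext_superset[of q a] Iq by (auto simp: F_def ext_def)
    then show False using qm[OF _ ext_superset] ext_mem[OF qi, of a] that by blast
  qed
  have "prime_idl q" unfolding prime_idl_def
  proof (intro conjI ballI impI)
    show "idl q" by fact
    show "1 \<notin> q" using qM M by auto
    fix a b assume ab: "a \<in> S" "b \<in> S" "a * b \<in> q"
    show "a \<in> q \<or> b \<in> q"
    proof (rule ccontr)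
      assume "\<not> ?thesis"
      then obtain i s j t where *: "i \<in> q" "s \<in> S" "i + s * a \<in> M" "j \<in> q" "t \<in> S" "j + t * b \<in> M"
        using meet ab by metis
      have "(i + s * a) * (j + t * b) = (j + t * b) * i + (s * a) * j + (s * t) * (a * b)"
        by (simp add: algebra_simps)
      also have "\<dots> \<in> q"
      proof -
        have "(j + t * b) * i \<in> q" "(s * a) * j \<in> q" "(s * t) * (a * b) \<in> q"
          using * ab M(1) by (auto intro!: idlD(4)[OF qi])
        then show ?thesis by (intro idlD(3)[OF qi])
      qed
      finally show False using M(3)[OF *(3,6)] qM by auto
    qed
  qed
  then show ?thesis using that Iq qM by blast
qed

lemma maximal_imp_prime:
  assumes "maximal_idl m" shows "prime_idl m"
proof -
  have m: "idl m" "1 \<notin> m" using assms by (auto simp: maximal_idl_def)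
  then obtain q where q: "prime_idl q" "m \<subseteq> q" "q \<inter> {1} = {}"
    using prime_avoiding[of m "{1}"] by auto
  then have "q = m" using assms by (auto simp: maximal_idl_def prime_idl_def)
  then show ?thesis using q by simp
qed

text \<open>A nonzerodivisor lies in no minimal prime: the multiplicative set generated by it and the
  complement of \<open>p\<close> misses the ideal.\<close>

lemma smaller_prime:
  assumes I: "idl I" and p: "prime_idl p" "I \<subseteq> p" and y: "y \<in> p"
    and reg: "\<And>f. f \<in> S \<Longrightarrow> y * f \<in> I \<Longrightarrow> f \<in> I"
  obtains q where "prime_idl q" "I \<subseteq> q" "q \<subset> p"
proof -
  define M where "M = {s * y ^ k | s k. s \<in> S - p}"
  have yS: "y \<in> S" using y p by (auto simp: prime_idl_def idl_def)
  have pw: "f \<in> I" if "f \<in> S" "f * y ^ k \<in> I" for f k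
    using that(2)
  proof (induction k)
    case (Suc k)
    then show ?case using reg[of "f * y ^ k"] that(1) yS by (auto simp: algebra_simps)
  qed simp
  have 1: "1 \<in> M" unfolding M_def using p by (auto simp: prime_idl_def intro!: exI[of _ "1::'r"] exI[of _ "0::nat"])
  have 2: "a * b \<in> M" if ab: "a \<in> M" "b \<in> M" for a b
  proof -
    obtain s k t l where "a = s * y ^ k" "b = t * y ^ l" "s \<in> S - p" "t \<in> S - p"
      using ab unfolding M_def by blast
    then have "a * b = (s * t) * y ^ (k + l)" "s * t \<in> S - p"
      using p by (auto simp: prime_idl_def algebra_simps power_add)
    then show ?thesis unfolding M_def by blast
  qed
  have 3: "M \<subseteq> S" unfolding M_def using yS by auto
  have 4: "I \<inter> M = {}" unfolding M_def using pw p(2) by auto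
  obtain q where q: "prime_idl q" "I \<subseteq> q" "q \<inter> M = {}"
    using prime_avoiding[OF I 3 1 2 4] by blast
  have "S - p \<subseteq> M" unfolding M_def by (force intro: exI[of _ "0::nat"])
  moreover have "y \<in> M"
    unfolding M_def using p by (auto simp: prime_idl_def intro!: exI[of _ "1::'r"] exI[of _ "1::nat"])
  moreover have "q \<subseteq> S" using q by (auto simp: prime_idl_def idl_def)
  ultimately have "q \<subset> p" using q(3) y by blast
  then show ?thesis using that q by blast
qed

text \<open>\<open>n\<close> counts strict inclusions, not primes, as in the definition of
  height.\<close>

definition prime_chain :: "'r set \<Rightarrow> nat \<Rightarrow> (nat \<Rightarrow> 'r set) \<Rightarrow> bool" where
  "prime_chain I n q \<longleftrightarrow> I \<subseteq> q 0 \<and> (\<forall>i\<le>n. prime_idl (q i)) \<and> (\<forall>i<n. q i \<subset> q (Suc i))"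

text \<open>Depth is at most height. The last element of the sequence is regular modulo the ideal of
  the others, so \<open>smaller_prime\<close> yields a strictly smaller prime that still contains
  those.\<close>

lemma regular_imp_prime_chain:
  assumes "idl I" "prime_idl p" "I \<subseteq> p" "set ys \<subseteq> p" "weakly_regular I ys"
  shows "\<exists>q. prime_chain I (length ys) q \<and> q (length ys) = p"
  using assms(2-5)
proof (induction ys arbitrary: p rule: rev_induct)
  case Nil
  then show ?case by (intro exI[of _ "\<lambda>_. p"]) (auto simp: prime_chain_def)
next
  case (snoc y ys)
  let ?J = "foldl ext I ys"
  have yp: "set ys \<subseteq> p" "y \<in> p" using snoc by auto
  then have yS: "set ys \<subseteq> S" using snoc.prems(1) by (auto simp: prime_idl_def idl_def)
  have J: "idl ?J" using exts_idl[OF assms(1) yS] .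
  have Jp: "?J \<subseteq> p" using exts_least[OF _ snoc.prems(2) yp(1)] snoc.prems(1) by (auto simp: prime_idl_def)
  have w: "weakly_regular I ys" "\<And>f. f \<in> S \<Longrightarrow> y * f \<in> ?J \<Longrightarrow> f \<in> ?J"
    using snoc.prems(4) by (auto simp: weakly_regular_snoc)
  obtain p' where p': "prime_idl p'" "?J \<subseteq> p'" "p' \<subset> p"
    using smaller_prime[OF J snoc.prems(1) Jp yp(2) w(2)] by blast
  have "I \<subseteq> p'" "set ys \<subseteq> p'" using p' exts_superset[of I ys] exts_mem[OF assms(1) yS] by auto
  from snoc.IH[OF p'(1) this w(1)] obtain q
    where q: "prime_chain I (length ys) q" "q (length ys) = p'" by blast
  let ?q = "q(Suc (length ys) := p)"
  have "prime_chain I (Suc (length ys)) ?q"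
    using q p' snoc.prems(1) unfolding prime_chain_def
    by (auto simp: less_Suc_eq le_Suc_eq simp del: psubsetD)
  moreover have "?q (length (ys @ [y])) = p" by simp
  ultimately show ?case by (metis length_append_singleton)
qed

text \<open>As the first element \<open>y\<close> of the sequence is regular modulo \<open>ext I m\<close>, taking the colon by \<open>m\<close>
  commutes with adding \<open>y\<close>, so the hypotheses pass to \<open>ext I y\<close>.\<close>

lemma weakly_regular_extension:
  assumes "idl I" "m \<in> S" "set ys \<subseteq> S"
    "weakly_regular (ext I m) ys" "weakly_regular (colon I m) ys"
  shows "weakly_regular I ys"
  using assms
proof (induction ys arbitrary: I)
  case (Cons y ys)
  have yS: "y \<in> S" using Cons.prems by simp
  have I: "idl I" and mS: "m \<in> S" by fact+
  have r1: "\<And>f. f \<in> S \<Longrightarrow> y * f \<in> ext I m \<Longrightarrow> f \<in> ext I m"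
    and r2: "\<And>f. f \<in> S \<Longrightarrow> y * f \<in> colon I m \<Longrightarrow> f \<in> colon I m"
    using Cons.prems by auto
  have "f \<in> I" if f: "f \<in> S" "y * f \<in> I" for f
  proof -
    have "f \<in> ext I m" using r1[OF f(1)] f(2) ext_superset by blast
    then obtain i g where ig: "i \<in> I" "g \<in> S" "f = i + g * m" by (rule extE)
    have "y * i \<in> I" using ig yS idlD[OF I] by auto
    then have "y * g * m \<in> I" using f(2) idlD(7)[OF I, of "y * f" "y * i"] ig by (simp add: algebra_simps)
    then have "g \<in> colon I m" using r2[OF ig(2)] yS ig(2) by (auto simp: colon_def)
    then show ?thesis using ig idlD(3)[OF I] by (auto simp: colon_def)
  qed
  moreover have "weakly_regular (ext I y) ys"
  proof (rule Cons.IH)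
    show "idl (ext I y)" using ext_idl[OF I yS] .
    show "m \<in> S" "set ys \<subseteq> S" using Cons.prems by auto
    show "weakly_regular (ext (ext I y) m) ys" using Cons.prems(4) ext_swap[of I m y] by simp
    have "colon (ext I y) m = ext (colon I m) y"
    proof
      show "ext (colon I m) y \<subseteq> colon (ext I y) m"
      proof (rule ext_least)
        show "idl (colon (ext I y) m)" using colon_idl ext_idl I yS mS by blast
        show "colon I m \<subseteq> colon (ext I y) m" using ext_superset[of I y] by (auto simp: colon_def)
        show "y \<in> colon (ext I y) m"
          using yS mS ext_mem[OF I, of y] ext_idl[OF I yS] by (auto simp: colon_def idlD)
      qed
      show "colon (ext I y) m \<subseteq> ext (colon I m) y"
      proof
        fix g assume "g \<in> colon (ext I y) m"
        then have g: "g \<in> S" "g * m \<in> ext I y" by (auto simp: colon_def)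
        then obtain i h where ih: "i \<in> I" "h \<in> S" "g * m = i + h * y" by (meson extE)
        have "y * h \<in> ext I m"
          using extI[of "- i" I g "y * h" m] ih g idlD(6)[OF I ih(1)] by (simp add: algebra_simps)
        then have "h \<in> ext I m" using r1 ih by auto
        then obtain j k where jk: "j \<in> I" "k \<in> S" "h = j + k * m" by (rule extE)
        have "(g - k * y) * m = i + y * j" using ih jk by (simp add: algebra_simps)
        then have "(g - k * y) * m \<in> I" using ih jk idlD[OF I] yS by auto
        then have "g - k * y \<in> colon I m" using g jk yS by (auto simp: colon_def)
        then show "g \<in> ext (colon I m) y" using extI[of "g - k * y" _ k g y] jk by simp
      qed
    qed
    then show "weakly_regular (colon (ext I y) m) ys" using Cons.prems(5) by simp
  qed
  ultimately show ?case by simp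
qed simp

section \<open>Associated primes\<close>

lemma noeth_maximal:
  assumes noeth "F \<noteq> {}" "\<And>J. J \<in> F \<Longrightarrow> idl J"
  obtains q where "q \<in> F" "\<And>J. J \<in> F \<Longrightarrow> q \<subseteq> J \<Longrightarrow> J = q"
proof -
  have "\<Union>C \<in> F" if C: "C \<noteq> {}" "subset.chain F C" for C
  proof -
    have "idl (\<Union>C)" using Union_chain_idl[OF C(1) assms(3) C(2)] .
    then obtain X where X: "finite X" "X \<subseteq> \<Union>C" "\<Union>C = gen X"
      using assms(1) by (auto simp: noeth_def)
    obtain J where J: "J \<in> C" "X \<subseteq> J"
      using finite_subset_Union_chain[OF X(1,2) C] by blast
    then have JF: "J \<in> F" using C(2) by (auto simp: subset.chain_def)
    then have "\<Union>C \<subseteq> J" using gen_least[OF assms(3)[OF JF] J(2)] X(3) by simp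
    then have "\<Union>C = J" using J by blast
    then show ?thesis using JF by simp
  qed
  then show ?thesis using subset_Zorn_nonempty[OF assms(2)] that by metis
qed

lemma noeth_stable:
  assumes noeth "\<And>k::nat. idl (E k)" "\<And>k. E k \<subseteq> E (Suc k)"
  obtains k where "E (Suc k) = E k"
proof -
  have "range E \<noteq> {}" "\<And>J. J \<in> range E \<Longrightarrow> idl J" using assms(2) by auto
  then obtain q where q: "q \<in> range E" "\<And>J. J \<in> range E \<Longrightarrow> q \<subseteq> J \<Longrightarrow> J = q"
    using noeth_maximal[OF assms(1)] by metis
  from q(1) obtain k where "q = E k" by blast
  then have "E (Suc k) = E k" using q(2)[of "E (Suc k)"] assms(3)[of k] by simp
  then show ?thesis by (rule that)
qed

text \<open>A Krull intersection argument: if every element killed by \<open>q\<close> were, locally at \<open>m\<close>, divisible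
  by \<open>y\<close>, then dividing \<open>z\<close> repeatedly would give a strictly ascending chain of ideals.\<close>

lemma colon_below:
  assumes N: noeth and I: "idl I" and m: "prime_idl m" and y: "y \<in> m"
    and reg: "\<And>f. f \<in> S \<Longrightarrow> y * f \<in> I \<Longrightarrow> f \<in> I"
    and q: "q = colon I z" "q \<subseteq> m" and z: "z \<in> S"
  obtains w where "w \<in> S" "\<And>a. a \<in> q \<Longrightarrow> a * w \<in> I" "colon (ext I y) w \<subseteq> m"
proof (rule ccontr)
  assume "\<not> thesis"
  then have no: "\<not> colon (ext I y) w \<subseteq> m" if "w \<in> S" "\<And>a. a \<in> q \<Longrightarrow> a * w \<in> I" for w
    using \<open>\<And>w. w \<in> S \<Longrightarrow> (\<And>a. a \<in> q \<Longrightarrow> a * w \<in> I) \<Longrightarrow> colon (ext I y) w \<subseteq> m \<Longrightarrow> thesis\<close> that by blast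
  define N where "N = {w \<in> S. \<forall>a\<in>q. a * w \<in> I}"
  have mi: "idl m" "m \<subseteq> S" using m by (auto simp: prime_idl_def idl_def)
  have yS: "y \<in> S" and qS: "q \<subseteq> S" using y mi q(2) by auto
  have zN: "z \<in> N" using z q(1) by (auto simp: N_def colon_def)
  \<comment> \<open>Division by \<open>y\<close> up to a factor \<open>s\<close> outside
    \<open>m\<close>; the quotient is again annihilated by \<open>q\<close> because \<open>y\<close>
    is regular modulo \<open>I\<close>.\<close>
  have "\<exists>s w'. s \<in> S - m \<and> w' \<in> N \<and> s * w - w' * y \<in> I" if w: "w \<in> N" for w
  proof -
    have "\<not> colon (ext I y) w \<subseteq> m" using no w unfolding N_def by blast
    then obtain s where s: "s \<in> S - m" "s * w \<in> ext I y" by (auto simp: colon_def)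
    then obtain i w' where w': "i \<in> I" "w' \<in> S" "s * w = i + w' * y" by (meson extE)
    have "a * w' \<in> I" if a: "a \<in> q" for a
    proof (rule reg)
      show "a * w' \<in> S" using a qS w' by auto
      have "y * (a * w') = s * (a * w) - a * i" using w' by (simp add: algebra_simps)
      then show "y * (a * w') \<in> I"
        using idlD[OF I] s a w w' qS by (auto simp: N_def)
    qed
    then show ?thesis using s w' by (intro exI[of _ s] exI[of _ w']) (auto simp: N_def)
  qed
  then obtain s d where sd: "\<And>w. w \<in> N \<Longrightarrow> s w \<in> S - m \<and> d w \<in> N \<and> s w * w - d w * y \<in> I"
    by metis
  define w where "w k = (d ^^ k) z" for k
  have w0: "w 0 = z" and wS: "\<And>k. w (Suc k) = d (w k)" by (auto simp: w_def)
  have wN: "w k \<in> N" for k by (induction k) (auto simp: w0 wS zN sd)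
  have wsd: "s (w k) \<in> S - m" "s (w k) * w k - w (Suc k) * y \<in> I" for k
    using sd[OF wN[of k]] by (auto simp: wS)
  have wk: "w k \<in> S" for k using wN by (auto simp: N_def)
  have unit: "a * b \<in> S - m" if "a \<in> S - m" "b \<in> S - m" for a b
    using that m by (auto simp: prime_idl_def)
  \<comment> \<open>The contraction to \<open>S\<close> of the ideal that \<open>I\<close> and
    \<open>w k\<close> generate in the localization at \<open>m\<close>.\<close>
  define E where "E k = {v \<in> S. \<exists>t\<in>S-m. t * v \<in> ext I (w k)}" for k
  have ek: "idl (ext I (w k))" for k using ext_idl[OF I wk] .
  have Ei: "idl (E k)" for k
    unfolding idl_def
  proof (intro conjI ballI)
    show "E k \<subseteq> S" by (auto simp: E_def)
    show "0 \<in> E k" using idlD(2)[OF ek] m by (auto simp: E_def prime_idl_def intro!: bexI[of _ 1])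
    fix a b assume "a \<in> E k" "b \<in> E k"
    then obtain t u where tu: "a \<in> S" "b \<in> S" "t \<in> S-m" "u \<in> S-m" "t * a \<in> ext I (w k)" "u * b \<in> ext I (w k)"
      by (auto simp: E_def)
    have "u * (t * a) + t * (u * b) \<in> ext I (w k)"
      using tu idlD(4)[OF ek, of u "t * a" k] idlD(4)[OF ek, of t "u * b" k]
      by (intro idlD(3)[OF ek]) auto
    moreover have "(t * u) * (a + b) = u * (t * a) + t * (u * b)" by (simp add: algebra_simps)
    ultimately show "a + b \<in> E k" using unit[OF tu(3,4)] tu unfolding E_def by (auto intro!: bexI[of _ "t * u"])
  next
    fix v a assume v: "v \<in> S" "a \<in> E k"
    then obtain t where t: "a \<in> S" "t \<in> S-m" "t * a \<in> ext I (w k)" by (auto simp: E_def)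
    have "t * (v * a) \<in> ext I (w k)" using idlD(4)[OF ek v(1) t(3)] by (simp add: algebra_simps)
    then show "v * a \<in> E k" using v t by (auto simp: E_def)
  qed
  have "E k \<subseteq> E (Suc k)" for k
  proof
    fix v assume "v \<in> E k"
    then obtain t where t: "v \<in> S" "t \<in> S-m" "t * v \<in> ext I (w k)" by (auto simp: E_def)
    then obtain i r where ir: "i \<in> I" "r \<in> S" "t * v = i + r * w k" by (meson extE)
    have "(s (w k) * t) * v = s (w k) * (i + r * w k)"
      using ir(3) by (simp add: mult.assoc)
    also have "\<dots> = (s (w k) * i + r * (s (w k) * w k - w (Suc k) * y)) + (r * y) * w (Suc k)"
      by (simp add: algebra_simps)
    finally have "(s (w k) * t) * v = \<dots>" .
    moreover have "s (w k) * i + r * (s (w k) * w k - w (Suc k) * y) \<in> I"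
      using ir wsd[of k] by (intro idlD(3)[OF I] idlD(4)[OF I]) auto
    ultimately have "(s (w k) * t) * v \<in> ext I (w (Suc k))"
      using ir yS by (intro extI[of _ I "r * y"]) auto
    then show "v \<in> E (Suc k)" using t unit[OF wsd(1) t(2), of k] unfolding E_def by blast
  qed
  then obtain k where k: "E (Suc k) = E k" using noeth_stable[OF N Ei] by blast
  have "w (Suc k) \<in> E (Suc k)"
    using wk[of "Suc k"] ext_mem[OF I, of "w (Suc k)"] m unfolding E_def
    by (auto simp: prime_idl_def intro!: bexI[of _ 1])
  then obtain t where t: "t \<in> S-m" "t * w (Suc k) \<in> ext I (w k)" using k by (auto simp: E_def)
  then obtain i r where ir: "i \<in> I" "r \<in> S" "t * w (Suc k) = i + r * w k" by (meson extE)
  \<comment> \<open>Nakayama's argument: modulo \<open>I\<close> and up to factors outside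
    \<open>m\<close>, \<open>w (Suc k)\<close> is a multiple of \<open>w k\<close>, and
    \<open>w k\<close> equals \<open>w (Suc k)\<close> times \<open>y\<close>. As \<open>y\<close>
    lies in \<open>m\<close>, the resulting annihilator \<open>t * s (w k) - y * r\<close> of
    \<open>w k\<close> lies outside \<open>m\<close>.\<close>
  have "\<exists>t\<in>S-m. t * w k \<in> I"
  proof (rule bexI)
    have "r * w k = t * w (Suc k) - i" using ir(3) by simp
    then have "y * r * w k = y * (t * w (Suc k) - i)" by (simp add: mult.assoc)
    then have "(t * s (w k) - y * r) * w k = t * (s (w k) * w k - w (Suc k) * y) + y * i"
      by (simp add: algebra_simps)
    also have "\<dots> \<in> I" using t wsd[of k] ir yS by (intro idlD(3)[OF I] idlD(4)[OF I]) auto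
    finally show "(t * s (w k) - y * r) * w k \<in> I" .
    have "y * r \<in> m" using idlD(5)[OF mi(1)] y ir by auto
    then show "t * s (w k) - y * r \<in> S - m"
      using unit[OF t(1) wsd(1)[of k]] idl_diff_cong[OF mi(1), of "t * s (w k)" "t * s (w k) - y * r"]
        ir yS by auto
  qed
  \<comment> \<open>Being annihilated by an element outside \<open>m\<close> passes down to
    \<open>w 0 = z\<close>, whose annihilator \<open>q\<close> lies inside \<open>m\<close>.\<close>
  then have "\<exists>t\<in>S-m. t * w (k - j) \<in> I" if "j \<le> k" for j
    using that
  proof (induction j)
    case (Suc j)
    then obtain t where t: "t \<in> S-m" "t * w (k - j) \<in> I" by auto
    have kj: "k - j = Suc (k - Suc j)" using Suc.prems by simp
    let ?k = "k - Suc j"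
    have "(t * s (w ?k)) * w ?k = t * (s (w ?k) * w ?k - w (Suc ?k) * y) + y * (t * w (Suc ?k))"
      by (simp add: algebra_simps)
    also have "\<dots> \<in> I"
    proof (rule idlD(3)[OF I])
      show "t * (s (w ?k) * w ?k - w (Suc ?k) * y) \<in> I" using t wsd[of ?k] idlD(4)[OF I] by auto
      show "y * (t * w (Suc ?k)) \<in> I" using t(2) yS idlD(4)[OF I] unfolding kj by auto
    qed
    finally show ?case using unit[OF t(1) wsd(1)] by blast
  qed simp
  from this[of k] obtain t where "t \<in> S-m" "t * z \<in> I" by (auto simp: w0)
  then show False using q by (auto simp: colon_def)
qed

text \<open>Among the annihilators modulo \<open>ext I y\<close> of elements killed by
  \<open>q\<close>, a maximal one inside \<open>m\<close> is prime; \<open>colon_below\<close> shows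
  that there are any. The inclusion of \<open>q\<close> is strict because \<open>y\<close> lies in
  the new prime but, being regular modulo \<open>I\<close>, not in \<open>q\<close>.\<close>

lemma associated_prime_step:
  assumes N: noeth and I: "idl I" and m: "prime_idl m" and y: "y \<in> m"
    and reg: "\<And>f. f \<in> S \<Longrightarrow> y * f \<in> I \<Longrightarrow> f \<in> I"
    and q: "q = colon I z" "q \<subseteq> m" and z: "z \<in> S" "z \<notin> I"
  obtains p v where "prime_idl p" "q \<subset> p" "p \<subseteq> m" "v \<in> S" "v \<notin> ext I y" "p = colon (ext I y) v"
proof -
  have mi: "idl m" "m \<subseteq> S" using m by (auto simp: prime_idl_def idl_def)
  have yS: "y \<in> S" and qS: "q \<subseteq> S" using y mi q(2) by auto
  let ?J = "ext I y"
  have J: "idl ?J" using ext_idl[OF I yS] .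
  define N where "N = {w \<in> S. \<forall>a\<in>q. a * w \<in> I}"
  define F where "F = {colon ?J w | w. w \<in> N \<and> colon ?J w \<subseteq> m}"
  have Nmult: "a * w \<in> N" if "a \<in> S" "w \<in> N" for a w
    using that qS idlD(4)[OF I, of a] by (auto simp: N_def mult.left_commute[of _ a])
  obtain w where "w \<in> S" "\<And>a. a \<in> q \<Longrightarrow> a * w \<in> I" "colon ?J w \<subseteq> m"
    using colon_below[OF N I m y reg q z(1)] by blast
  then have ne: "F \<noteq> {}" by (auto simp: F_def N_def)
  have "idl K" if "K \<in> F" for K using that colon_idl[OF J] by (auto simp: F_def N_def)
  then obtain p where pF: "p \<in> F" and pmax: "\<And>K. K \<in> F \<Longrightarrow> p \<subseteq> K \<Longrightarrow> K = p"
    using noeth_maximal[OF N ne] by blast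
  then obtain v where v: "v \<in> N" "p = colon ?J v" "p \<subseteq> m" by (auto simp: F_def)
  have vS: "v \<in> S" using v by (auto simp: N_def)
  have pi: "idl p" using colon_idl[OF J vS] v by simp
  have sub: "p \<subseteq> colon ?J (a * v)" if "a \<in> S" for a
    using that idlD(4)[OF J, of a] v(2) by (auto simp: colon_def mult.left_commute[of _ a])
  have 1: "1 \<notin> p" using v(3) m by (auto simp: prime_idl_def)
  have "prime_idl p" unfolding prime_idl_def
  proof (intro conjI ballI impI)
    fix a b assume ab: "a \<in> S" "b \<in> S" "a * b \<in> p"
    show "a \<in> p \<or> b \<in> p"
    proof (cases "colon ?J (a * v) \<subseteq> m")
      case True
      then have "colon ?J (a * v) = p" using pmax sub[OF ab(1)] Nmult[OF ab(1) v(1)] by (auto simp: F_def)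
      moreover have "b \<in> colon ?J (a * v)" using ab v(2) by (auto simp: colon_def algebra_simps)
      ultimately show ?thesis by simp
    next
      \<comment> \<open>Maximality concerns only annihilators inside \<open>m\<close>. Here some
        \<open>s\<close> outside \<open>m\<close> kills \<open>a * v\<close> modulo
        \<open>ext I y\<close>, while multiplying \<open>v\<close> by \<open>s\<close> does not
        change its annihilator.\<close>
      case False
      then obtain s where s: "s \<in> S" "s \<notin> m" "s * (a * v) \<in> ?J" by (auto simp: colon_def)
      have "colon ?J (s * v) \<subseteq> m"
      proof
        fix t assume "t \<in> colon ?J (s * v)"
        then have "t \<in> S" "t * s \<in> p" using s v(2) by (auto simp: colon_def mult.assoc)
        then show "t \<in> m" using v(3) m s by (auto simp: prime_idl_def)
      qed
      then have "colon ?J (s * v) = p" using pmax sub[OF s(1)] Nmult[OF s(1) v(1)] by (auto simp: F_def)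
      moreover have "a \<in> colon ?J (s * v)" using s ab by (auto simp: colon_def algebra_simps)
      ultimately show ?thesis by simp
    qed
  qed (use pi 1 in auto)
  moreover have "q \<subseteq> p" using v qS ext_superset[of I y] by (auto simp: colon_def N_def)
  moreover have "y \<in> p" using v vS yS ext_mem[OF I, of y] idlD(5)[OF J] by (auto simp: colon_def)
  moreover have "y \<notin> q" using reg[OF z(1)] q(1) z(2) by (auto simp: colon_def)
  moreover have "v \<notin> ?J" using 1 v(2) by (auto simp: colon_def)
  ultimately show ?thesis using that[of p v] v vS by blast
qed

text \<open>Depth at \<open>m\<close> is at most the dimension of any associated prime
  \<open>q\<close> of \<open>I\<close> inside \<open>m\<close>: each element of the sequence pushes
  \<open>q\<close> strictly up by \<open>associated_prime_step\<close>.\<close>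

lemma regular_imp_chain_above:
  assumes noeth "idl I" "prime_idl m" "set ys \<subseteq> m" "weakly_regular I ys"
    "prime_idl q" "q = colon I z" "q \<subseteq> m" "z \<in> S" "z \<notin> I"
  shows "\<exists>p. prime_chain q (length ys) p"
  using assms(2-)
proof (induction ys arbitrary: I q z)
  case Nil
  then show ?case by (intro exI[of _ "\<lambda>_. q"]) (auto simp: prime_chain_def)
next
  case (Cons y ys)
  have yS: "y \<in> S" using Cons.prems by (auto simp: prime_idl_def idl_def)
  have ym: "y \<in> m" and reg: "\<And>f. f \<in> S \<Longrightarrow> y * f \<in> I \<Longrightarrow> f \<in> I" using Cons.prems by auto
  obtain p v where p: "prime_idl p" "q \<subset> p" "p \<subseteq> m" "v \<in> S" "v \<notin> ext I y" "p = colon (ext I y) v"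
    using associated_prime_step[OF assms(1) Cons.prems(1,2) ym reg Cons.prems(6,7,8,9)] by blast
  obtain r where r: "prime_chain p (length ys) r"
    using Cons.IH[OF ext_idl[OF Cons.prems(1) yS] Cons.prems(2) _ _ p(1,6,3,4,5)] Cons.prems by auto
  have "prime_chain q (length (y # ys)) (case_nat q r)"
    using r p(2) Cons.prems(5) unfolding prime_chain_def
    by (auto split: nat.split simp: less_Suc_eq_0_disj)
  then show ?case by blast
qed

end

section \<open>The Nullstellensatz\<close>

definition coeffs_in :: "'r::comm_ring_1 set \<Rightarrow> 'r poly set" where
  "coeffs_in A = {p. \<forall>i. coeff p i \<in> A}"

definition adjoin :: "'r::comm_ring_1 set \<Rightarrow> 'r \<Rightarrow> 'r set" where
  "adjoin A x = (\<lambda>p. poly p x) ` coeffs_in A"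

text \<open>For a prime \<open>m\<close> this is algebraicity over the field of fractions of
  \<open>A\<close> modulo \<open>m\<close>, with denominators cleared.\<close>

definition algebraic_mod :: "'r::comm_ring_1 set \<Rightarrow> 'r set \<Rightarrow> 'r \<Rightarrow> bool" where
  "algebraic_mod m A x \<longleftrightarrow> (\<exists>p\<in>coeffs_in A. poly p x \<in> m \<and> (\<exists>i. coeff p i \<notin> m))"

text \<open>Modulo \<open>m\<close>, inverting a single element \<open>u\<close> turns \<open>A\<close> into a field.\<close>

definition G_domain_mod :: "'r::comm_ring_1 set \<Rightarrow> 'r set \<Rightarrow> bool" where
  "G_domain_mod m A \<longleftrightarrow> (\<exists>u\<in>A-m. \<forall>b\<in>A-m. \<exists>c\<in>A. \<exists>N. b * c - u ^ N \<in> m)"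

context relative_ring
begin

lemma coeffs_in_closed [intro]:
  "p \<in> coeffs_in S \<Longrightarrow> q \<in> coeffs_in S \<Longrightarrow> p + q \<in> coeffs_in S"
  "p \<in> coeffs_in S \<Longrightarrow> q \<in> coeffs_in S \<Longrightarrow> p - q \<in> coeffs_in S"
  "p \<in> coeffs_in S \<Longrightarrow> q \<in> coeffs_in S \<Longrightarrow> p * q \<in> coeffs_in S"
  "a \<in> S \<Longrightarrow> p \<in> coeffs_in S \<Longrightarrow> smult a p \<in> coeffs_in S"
  "a \<in> S \<Longrightarrow> monom a n \<in> coeffs_in S"
  "a \<in> S \<Longrightarrow> p \<in> coeffs_in S \<Longrightarrow> pCons a p \<in> coeffs_in S"
  "0 \<in> coeffs_in S" "1 \<in> coeffs_in S"
  by (auto simp: coeffs_in_def coeff_mult coeff_pCons split: nat.split intro!: sum_in)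

lemma coeffs_inD: "p \<in> coeffs_in S \<Longrightarrow> coeff p i \<in> S"
  by (simp add: coeffs_in_def)

lemma relative_ring_adjoin: "relative_ring (adjoin S x)"
proof
  show "1 \<in> adjoin S x" unfolding adjoin_def by (rule image_eqI[of _ _ 1]) auto
  fix a b assume "a \<in> adjoin S x" "b \<in> adjoin S x"
  then obtain p q where "a = poly p x" "b = poly q x" "p \<in> coeffs_in S" "q \<in> coeffs_in S"
    by (auto simp: adjoin_def)
  then show "a - b \<in> adjoin S x" "a * b \<in> adjoin S x"
    unfolding adjoin_def by (auto intro: image_eqI[of _ _ "p - q"] image_eqI[of _ _ "p * q"])
qed

lemma adjoin_superset: "S \<subseteq> adjoin S x"
  by (auto simp: adjoin_def intro!: image_eqI[of _ _ "[:a:]" for a])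

lemma adjoin_mem: "x \<in> adjoin S x"
  unfolding adjoin_def by (rule image_eqI[of _ _ "[:0, 1:]"]) auto

lemma poly_in: "x \<in> S \<Longrightarrow> p \<in> coeffs_in S \<Longrightarrow> poly p x \<in> S"
  by (auto simp: poly_altdef intro!: sum_in dest: coeffs_inD)

lemma idl_poly_cong:
  assumes I: "idl I" and "a \<in> S" "b \<in> S" "a - b \<in> I" "p \<in> coeffs_in S"
  shows "poly p a - poly p b \<in> I"
proof -
  have "poly p a - poly p b = (\<Sum>i\<le>degree p. coeff p i * (a ^ i - b ^ i))"
    by (simp add: poly_altdef algebra_simps sum_subtractf)
  also have "\<dots> \<in> I"
    using assms by (intro idl_sum[OF I] idlD(4)[OF I] idl_power_cong) (auto dest: coeffs_inD)
  finally show ?thesis .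
qed

text \<open>Powers of the leading coefficient replace its inverse. The bound on
  \<open>degree q\<close> lets \<open>G_domain_adjoin_base\<close> apply the minimality of a degree
  to the quotient.\<close>

lemma pseudo_division:
  assumes "h \<in> coeffs_in S" "degree h \<ge> 1" "g \<in> coeffs_in S"
  shows "\<exists>q\<in>coeffs_in S. \<exists>r\<in>coeffs_in S. \<exists>N. smult (lead_coeff h ^ N) g = q * h + r \<and>
           degree r < degree h \<and> degree q \<le> degree g - degree h"
  using assms(3)
proof (induction "degree g" arbitrary: g rule: less_induct)
  case less
  let ?c = "lead_coeff h"
  show ?case
  proof (cases "degree g < degree h")
    case True
    then show ?thesis using less.prems
      by (intro bexI[of _ 0] bexI[of _ g] exI[of _ 0]) auto
  next
    case False
    define t where "t = monom (lead_coeff g) (degree g - degree h)"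
    define g' where "g' = smult ?c g - t * h"
    have t: "t \<in> coeffs_in S" using less.prems by (auto simp: t_def dest: coeffs_inD)
    have c: "?c \<in> S" using assms(1) by (auto dest: coeffs_inD)
    have g': "g' \<in> coeffs_in S" using t c less.prems assms(1) by (auto simp: g'_def)
    have "degree (t * h) \<le> degree g"
      using degree_mult_le[of t h] degree_monom_le[of "lead_coeff g" "degree g - degree h"] False
      by (simp add: t_def)
    then have "degree g' \<le> degree g"
      unfolding g'_def by (intro degree_diff_le) (auto intro: order.trans[OF degree_smult_le])
    moreover have "coeff g' (degree g) = 0"
      using False coeff_monom_mult[of "lead_coeff g" "degree g - degree h" h "degree g"]
      by (simp add: g'_def t_def mult.commute)
    ultimately have lt: "degree g' < degree g"
      using False assms(2) by (metis degree_0 eq_zero_or_degree_less le_neq_implies_less leading_coeff_0_iff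
          less_le_trans linorder_not_less not_one_le_zero zero_less_iff_neq_zero)
    obtain q r N where *: "q \<in> coeffs_in S" "r \<in> coeffs_in S" "smult (?c ^ N) g' = q * h + r"
      "degree r < degree h" "degree q \<le> degree g' - degree h"
      using less.hyps[OF lt g'] by blast
    have "smult (?c ^ Suc N) g = smult (?c ^ N) g' + smult (?c ^ N) t * h"
      by (simp add: g'_def smult_diff_right mult.commute)
    also have "\<dots> = (q + smult (?c ^ N) t) * h + r" using *(3) by (simp add: algebra_simps)
    finally have eq: "smult (?c ^ Suc N) g = (q + smult (?c ^ N) t) * h + r" .
    have "degree (q + smult (?c ^ N) t) \<le> degree g - degree h"
      using *(5) lt degree_monom_le[of "lead_coeff g" "degree g - degree h"]
      by (intro degree_add_le order.trans[OF degree_smult_le]) (auto simp: t_def)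
    moreover have "q + smult (?c ^ N) t \<in> coeffs_in S" using * c t by auto
    ultimately show ?thesis using eq *(2,4) by blast
  qed
qed

end

section \<open>Subrings modulo a prime: algebraic elements and G-domains\<close>

locale subring_mod_prime = relative_ring S + A: relative_ring A for S A :: "'r::comm_ring_1 set" +
  fixes m assumes sub: "A \<subseteq> S" and prime: "prime_idl m"
begin

lemma m_idl: "idl m" and m_one: "1 \<notin> m" using prime by (auto simp: prime_idl_def)

lemma m_mult: "a \<in> S \<Longrightarrow> b \<in> S \<Longrightarrow> a * b \<in> m \<Longrightarrow> a \<in> m \<or> b \<in> m"
  using prime by (auto simp: prime_idl_def)

lemma coeffs_in_sub: "p \<in> coeffs_in A \<Longrightarrow> p \<in> coeffs_in S"
  using sub by (auto simp: coeffs_in_def)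

lemma poly_in_m:
  assumes "p \<in> coeffs_in A" "x \<in> S" "\<And>i. coeff p i \<in> m"
  shows "poly p x \<in> m"
  unfolding poly_altdef
  using idlD(5)[OF m_idl power_in[OF assms(2)] assms(3)] by (intro idl_sum[OF m_idl]) auto

lemma trim:
  assumes "p \<in> coeffs_in A" "x \<in> S" "coeff p i \<notin> m"
  shows "\<exists>p'\<in>coeffs_in A. lead_coeff p' \<notin> m \<and> poly p x - poly p' x \<in> m \<and> degree p' \<le> degree p"
  using assms
proof (induction "degree p" arbitrary: p rule: less_induct)
  case less
  show ?case
  proof (cases "lead_coeff p \<in> m")
    case True
    define p' where "p' = p - monom (lead_coeff p) (degree p)"
    have "p' \<in> coeffs_in A" using less.prems by (auto simp: p'_def dest: A.coeffs_inD)
    moreover have i: "i \<noteq> degree p" using less.prems True by auto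
    then have "coeff p' i \<notin> m" using less.prems by (simp add: p'_def)
    moreover have "degree p' < degree p"
    proof -
      have "degree p' \<le> degree p" unfolding p'_def
        by (intro degree_diff_le) (auto simp: degree_monom_le)
      moreover have "coeff p' (degree p) = 0" by (simp add: p'_def)
      moreover have "degree p \<noteq> 0"
      proof
        assume "degree p = 0"
        then have "coeff p i = 0" using i by (intro coeff_eq_0) auto
        then show False using less.prems idlD(2)[OF m_idl] by simp
      qed
      ultimately show ?thesis by (metis degree_0 le_neq_implies_less leading_coeff_0_iff)
    qed
    ultimately obtain p'' where p'': "p'' \<in> coeffs_in A" "lead_coeff p'' \<notin> m" "poly p' x - poly p'' x \<in> m"
      "degree p'' \<le> degree p'" "degree p' < degree p" using less by blast
    have "poly p x - poly p'' x = lead_coeff p * x ^ degree p + (poly p' x - poly p'' x)"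
      by (simp add: p'_def poly_monom)
    also have "\<dots> \<in> m" using True p'' idlD(5)[OF m_idl] less.prems by (intro idlD(3)[OF m_idl]) auto
    finally show ?thesis using p'' by (intro bexI[of _ p'']) auto
  next
    case False
    then show ?thesis using less.prems idlD(2)[OF m_idl] by (intro bexI[of _ p]) auto
  qed
qed

lemmas power_cong = idl_power_cong[OF m_idl]

text \<open>If \<open>x\<close> were transcendental, \<open>1 + x u\<close> would divide a power of \<open>u\<close>, and hence \<open>1\<close>.\<close>

lemma G_domain_adjoin_algebraic:
  assumes x: "x \<in> S" and G: "G_domain_mod m (adjoin A x)"
  shows "algebraic_mod m A x"
proof (rule ccontr)
  assume "\<not> ?thesis"
  then have tr: "\<And>p i. p \<in> coeffs_in A \<Longrightarrow> poly p x \<in> m \<Longrightarrow> coeff p i \<in> m"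
    unfolding algebraic_mod_def by blast
  interpret B: relative_ring "adjoin A x" by (rule A.relative_ring_adjoin)
  have BS: "adjoin A x \<subseteq> S" using x by (auto simp: adjoin_def intro!: poly_in coeffs_in_sub)
  obtain u where u: "u \<in> adjoin A x" "u \<notin> m"
    "\<And>b. b \<in> adjoin A x - m \<Longrightarrow> \<exists>c\<in>adjoin A x. \<exists>N. b * c - u ^ N \<in> m"
    using G by (auto simp: G_domain_mod_def)
  have trimmed: "\<exists>U\<in>coeffs_in A. lead_coeff U \<notin> m \<and> u - poly U x \<in> m"
    if u: "u \<in> adjoin A x" "u \<notin> m" for u
  proof -
    obtain p where p: "p \<in> coeffs_in A" "u = poly p x" using u(1) by (auto simp: adjoin_def)
    then obtain i where "coeff p i \<notin> m" using poly_in_m[OF p(1) x] u(2) by auto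
    then show ?thesis using trim[OF p(1) x] p(2) by blast
  qed
  obtain U where U: "U \<in> coeffs_in A" "lead_coeff U \<notin> m" "u - poly U x \<in> m"
    using trimmed[OF u(1,2)] by blast
  define v where "v = poly U x"
  define b where "b = 1 + x * v"
  define B where "B = 1 + pCons 0 U"
  have U0: "U \<noteq> 0" using U(2) idlD(2)[OF m_idl] by auto
  have B: "B \<in> coeffs_in A" "poly B x = b" using U by (auto simp: B_def b_def v_def)
  have degB: "degree B = Suc (degree U)"
    using U0 unfolding B_def by (subst degree_add_eq_right) auto
  have lcB: "lead_coeff B \<notin> m" using U(2) degB by (simp add: B_def)
  have vB: "v \<in> adjoin A x" using U(1) by (auto simp: v_def adjoin_def)
  have xB: "x \<in> adjoin A x" by (rule A.adjoin_mem)
  have bB: "b \<in> adjoin A x" using vB xB by (auto simp: b_def)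
  have "b \<notin> m" using tr[OF B(1), of "degree B"] B(2) lcB by auto
  then obtain c N where c: "c \<in> adjoin A x" "b * c - u ^ N \<in> m" using u(3) bB by blast
  \<comment> \<open>Since \<open>x * v = b - 1\<close>, the power \<open>(x * v) ^ N\<close> is
    congruent to \<open>(- 1) ^ N\<close> modulo \<open>b\<close>; as \<open>b\<close> also divides
    \<open>v ^ N\<close> modulo \<open>m\<close>, it divides 1, with the cofactor \<open>e\<close>
    below.\<close>
  have "\<exists>k\<in>adjoin A x. (b - 1) ^ N = b * k + (- 1) ^ N" for N
  proof (induction N)
    case (Suc N)
    then obtain k where "k \<in> adjoin A x" "(b - 1) ^ N = b * k + (- 1) ^ N" by blast
    moreover from this have "(b - 1) ^ N - k \<in> adjoin A x"
      using bB by (intro B.diff_in B.power_in) auto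
    ultimately show ?case by (intro bexI[of _ "(b - 1) ^ N - k"]) (simp_all add: algebra_simps)
  qed (rule bexI[of _ 0]; simp)
  then obtain k where k: "k \<in> adjoin A x" "(b - 1) ^ N = b * k + (- 1) ^ N" by blast
  define e where "e = (- 1) ^ N * (x ^ N * c - k)"
  have eB: "e \<in> adjoin A x" using c k xB by (auto simp: e_def)
  have S: "u \<in> S" "v \<in> S" "e \<in> S" "b \<in> S" "c \<in> S" using BS u vB eB bB c by auto
  have "u ^ N - v ^ N \<in> m" using power_cong[OF S(1,2)] U(3) v_def by simp
  then have "b * c - v ^ N \<in> m" using idlD(3)[OF m_idl c(2)] by fastforce
  moreover have "b * e - 1 = (- 1) ^ N * x ^ N * (b * c - v ^ N)"
  proof -
    have "x ^ N * v ^ N = b * k + (- 1) ^ N" using k(2) by (simp add: b_def power_mult_distrib)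
    then have *: "x ^ N * (b * c - v ^ N) = b * (x ^ N * c - k) - (- 1) ^ N" by (simp add: algebra_simps)
    have "(- 1) ^ N * x ^ N * (b * c - v ^ N) = (- 1) ^ N * (x ^ N * (b * c - v ^ N))"
      by (simp add: mult.assoc)
    also have "\<dots> = (- 1) ^ N * (b * (x ^ N * c - k) - (- 1) ^ N)" by (simp only: *)
    also have "\<dots> = b * e - (- 1) ^ N * (- 1) ^ N" by (simp add: e_def algebra_simps)
    also have "\<dots> = b * e - 1" by (simp flip: power_mult_distrib)
    finally show ?thesis by simp
  qed
  moreover have "(- 1) ^ N * x ^ N \<in> S" using x by (intro mult_in power_in uminus_in) auto
  ultimately have be: "b * e - 1 \<in> m" using idlD(4)[OF m_idl] by simp
  have "e \<notin> m"
  proof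
    assume "e \<in> m"
    then have "b * e \<in> m" using idlD(4)[OF m_idl] S by auto
    then show False using idl_diff_cong[OF m_idl, of "b * e" "1"] idlD(7)[OF m_idl _ be, of "b * e"] m_one by simp
  qed
  then obtain E where E: "E \<in> coeffs_in A" "lead_coeff E \<notin> m" "e - poly E x \<in> m"
    using trimmed[OF eB] by blast
  \<comment> \<open>The relation \<open>b * e = 1\<close> modulo \<open>m\<close> becomes a
    polynomial relation for \<open>x\<close>. As \<open>B\<close> has positive degree, the constant
    1 does not touch the top coefficient, a product of two leading coefficients outside
    \<open>m\<close>.\<close>
  have "poly (B * E - 1) x = (b * e - 1) - b * (e - poly E x)" using B(2) by (simp add: algebra_simps)
  also have "\<dots> \<in> m" by (rule idlD(7)[OF m_idl be idlD(4)[OF m_idl S(4) E(3)]])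
  finally have "coeff (B * E - 1) (degree B + degree E) \<in> m"
    by (intro tr) (use B E in auto)
  moreover have "coeff (B * E - 1) (degree B + degree E) = lead_coeff B * lead_coeff E"
    using degB coeff_mult_degree_sum[of B E] by (simp add: coeff_1)
  ultimately have "lead_coeff B \<in> m \<or> lead_coeff E \<in> m"
    using m_mult B(1) E(1) sub A.coeffs_inD by (metis subsetD)
  then show False using lcB E(2) by blast
qed

text \<open>Modulo \<open>m\<close> let \<open>f\<close> be a polynomial of minimal degree over \<open>A\<close> that vanishes at \<open>x\<close>, with leading
  coefficient \<open>a\<close>, and let \<open>e \<in> A\<close> be a multiple of \<open>u\<close>.  For \<open>b \<in> A\<close> the quotient \<open>u\<^sup>N / b\<close>, multiplied by
  suitable powers of \<open>a\<close> and \<open>e\<close>, reduces modulo \<open>f\<close> to its constant coefficient.\<close>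

lemma G_domain_adjoin_base:
  assumes x: "x \<in> S" and G: "G_domain_mod m (adjoin A x)"
  shows "G_domain_mod m A"
proof -
  interpret B: relative_ring "adjoin A x" by (rule A.relative_ring_adjoin)
  have BS: "adjoin A x \<subseteq> S" using x by (auto simp: adjoin_def intro!: poly_in coeffs_in_sub)
  have AB: "A \<subseteq> adjoin A x" by (rule A.adjoin_superset)
  have pS: "poly p x \<in> S" if "p \<in> coeffs_in A" for p
    using that x by (auto intro!: poly_in coeffs_in_sub)
  have pB: "poly p x \<in> adjoin A x" if "p \<in> coeffs_in A" for p using that by (auto simp: adjoin_def)
  define Z where "Z = {p \<in> coeffs_in A. poly p x \<in> m \<and> lead_coeff p \<notin> m}"
  obtain p i where "p \<in> coeffs_in A" "poly p x \<in> m" "coeff p i \<notin> m"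
    using G_domain_adjoin_algebraic[OF x G] by (auto simp: algebraic_mod_def)
  then obtain p' where "p' \<in> coeffs_in A" "lead_coeff p' \<notin> m" "poly p x - poly p' x \<in> m"
    "poly p x \<in> m" using trim x by blast
  then have "p' \<in> Z" using idl_diff_cong[OF m_idl] by (auto simp: Z_def)
  then have "(ARG_MIN degree p. p \<in> Z) \<in> Z" by (rule arg_min_natI)
  then obtain f where f: "f \<in> Z" "\<And>g. g \<in> Z \<Longrightarrow> degree f \<le> degree g"
    using arg_min_nat_le[of "\<lambda>p. p \<in> Z" _ degree] by blast
  define n a where "n = degree f" and "a = lead_coeff f"
  have fA: "f \<in> coeffs_in A" and fm: "poly f x \<in> m" and am: "a \<notin> m"
    using f(1) by (auto simp: Z_def a_def)
  have aA: "a \<in> A" using fA by (auto simp: a_def dest: A.coeffs_inD)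
  have n1: "degree f \<ge> 1"
  proof (rule ccontr)
    assume "\<not> ?thesis"
    then have "degree f = 0" by simp
    then have "poly f x = a" by (simp add: a_def poly_altdef)
    then show False using fm am by simp
  qed
  have small: "coeff g i \<in> m" if g: "g \<in> coeffs_in A" "poly g x \<in> m" "degree g < n" for g i
  proof (rule ccontr)
    assume "coeff g i \<notin> m"
    then obtain g' where g': "g' \<in> coeffs_in A" "lead_coeff g' \<notin> m" "poly g x - poly g' x \<in> m"
      "degree g' \<le> degree g" using trim[OF g(1) x] by blast
    then have "g' \<in> Z" using g(2) idl_diff_cong[OF m_idl] by (auto simp: Z_def)
    then show False using f(2)[of g'] g'(4) g(3) by (simp add: n_def)
  qed
  have unit: "b * c \<in> A - m" if "b \<in> A - m" "c \<in> A - m" for b c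
    using that m_mult sub by auto
  have powm: "b ^ k \<in> A - m" if "b \<in> A - m" for b k
    by (induction k) (use m_one that unit in auto)
  obtain u where u: "u \<in> adjoin A x" "u \<notin> m"
    "\<And>b. b \<in> adjoin A x - m \<Longrightarrow> \<exists>c\<in>adjoin A x. \<exists>N. b * c - u ^ N \<in> m"
    using G by (auto simp: G_domain_mod_def)
  have uS: "u \<in> S" using u BS by auto
  \<comment> \<open>Polynomials of degree below \<open>n\<close> whose value is a nonzero multiple
    of \<open>u\<close> modulo \<open>m\<close>. A member of least degree, once trimmed, turns out
    to be constant, which places a nonzero multiple of \<open>u\<close> in \<open>A\<close>.\<close>
  define W where "W = {w \<in> coeffs_in A. degree w < n \<and> poly w x \<notin> m \<and> (\<exists>h\<in>adjoin A x. poly w x - u * h \<in> m)}"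
  obtain U where U: "U \<in> coeffs_in A" "u = poly U x" using u(1) by (auto simp: adjoin_def)
  obtain q r N where qr: "q \<in> coeffs_in A" "r \<in> coeffs_in A" "smult (a ^ N) U = q * f + r" "degree r < n"
    using A.pseudo_division[OF fA n1 U(1)] by (auto simp: n_def a_def)
  have "a ^ N * u = poly q x * poly f x + poly r x"
    using arg_cong[OF qr(3), of "\<lambda>p. poly p x"] U(2) by simp
  then have r: "poly r x - u * a ^ N = - (poly q x * poly f x)" by (simp add: algebra_simps)
  have rm: "poly r x - u * a ^ N \<in> m"
    unfolding r using pS[OF qr(1)] fm by (intro idlD(6)[OF m_idl] idlD(4)[OF m_idl])
  moreover have "u * a ^ N \<notin> m"
    using m_mult[of u "a ^ N"] uS u(2) powm[of a N] aA am sub by auto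
  ultimately have "poly r x \<notin> m" using idl_diff_cong[OF m_idl] by blast
  then have "r \<in> W" using qr(2,4) rm A.power_in[OF aA] AB by (auto simp: W_def)
  then have "(ARG_MIN degree p. p \<in> W) \<in> W" by (rule arg_min_natI)
  then obtain w0 where w0: "w0 \<in> W" "\<And>g. g \<in> W \<Longrightarrow> degree w0 \<le> degree g"
    using arg_min_nat_le[of "\<lambda>p. p \<in> W" _ degree] by blast
  obtain i where i: "coeff w0 i \<notin> m" using w0(1) poly_in_m[of w0, OF _ x] by (auto simp: W_def)
  obtain w where w: "w \<in> coeffs_in A" "lead_coeff w \<notin> m" "poly w0 x - poly w x \<in> m" "degree w \<le> degree w0"
    using trim[OF _ x i] w0(1) unfolding W_def by blast
  obtain h where h: "h \<in> adjoin A x" "poly w0 x - u * h \<in> m" using w0(1) by (auto simp: W_def)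
  have wh: "poly w x - u * h \<in> m" using idlD(7)[OF m_idl h(2) w(3)] by simp
  have wm: "poly w x \<notin> m" using w0(1) w(3) idl_diff_cong[OF m_idl] by (auto simp: W_def)
  have wn: "degree w < n" using w(4) w0(1) by (auto simp: W_def)
  have hS: "h \<in> S" using h BS by auto
  \<comment> \<open>Dividing \<open>f\<close> by a nonconstant \<open>w\<close> leaves a remainder
    whose value is a multiple of \<open>u\<close>, hence in \<open>m\<close> by minimality of
    \<open>w0\<close>. Then the value of \<open>Q\<close> is in \<open>m\<close>, so are its
    coefficients by minimality of \<open>f\<close>, and the leading coefficient of \<open>f\<close>
    would follow.\<close>
  have "degree w = 0"
  proof (rule ccontr)
    assume d: "degree w \<noteq> 0"
    obtain Q R M where QR: "Q \<in> coeffs_in A" "R \<in> coeffs_in A" "smult (lead_coeff w ^ M) f = Q * w + R"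
      "degree R < degree w" "degree Q \<le> n - degree w"
      using A.pseudo_division[OF w(1) _ fA] d by (auto simp: n_def)
    have lw: "lead_coeff w ^ M \<in> A - m" using powm w(1,2) by (auto dest: A.coeffs_inD)
    have "lead_coeff w ^ M * poly f x = poly Q x * poly w x + poly R x"
      using arg_cong[OF QR(3), of "\<lambda>p. poly p x"] by simp
    then have R: "poly R x = lead_coeff w ^ M * poly f x - poly Q x * poly w x" by (simp add: algebra_simps)
    have lf: "lead_coeff w ^ M * poly f x \<in> m" using lw sub fm idlD(4)[OF m_idl] by auto
    have "poly R x - u * (- poly Q x * h) = lead_coeff w ^ M * poly f x - poly Q x * (poly w x - u * h)"
      by (simp add: R algebra_simps)
    also have "\<dots> \<in> m" by (rule idlD(7)[OF m_idl lf idlD(4)[OF m_idl pS[OF QR(1)] wh]])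
    finally have Rh: "poly R x - u * (- poly Q x * h) \<in> m" .
    have "poly R x \<in> m"
    proof (rule ccontr)
      assume "poly R x \<notin> m"
      then have "R \<in> W" using QR(2,4) wn Rh pB[OF QR(1)] h(1)
        unfolding W_def by (auto intro!: bexI[of _ "- poly Q x * h"])
      then show False using w0(2)[of R] QR(4) w(4) by simp
    qed
    then have "poly Q x * poly w x \<in> m" using R lf idlD(7)[OF m_idl lf, of "poly R x"] by simp
    then have "poly Q x \<in> m" using m_mult pS[OF QR(1)] pS[OF w(1)] wm by blast
    then have Qi: "coeff Q i \<in> m" for i using small[OF QR(1)] QR(5) d wn by simp
    have "coeff (Q * w) n \<in> m" unfolding coeff_mult
      using Qi w(1) sub by (intro idl_sum[OF m_idl] idlD(5)[OF m_idl]) (auto dest: A.coeffs_inD)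
    moreover have "coeff R n = 0" using QR(4) wn by (intro coeff_eq_0) simp
    moreover have "lead_coeff w ^ M * a = coeff (Q * w) n + coeff R n"
      using arg_cong[OF QR(3), of "\<lambda>p. coeff p n"] by (simp add: a_def n_def)
    ultimately show False using unit[OF lw, of a] aA am by auto
  qed
  then have w_const: "poly w x = lead_coeff w" by (simp add: poly_altdef)
  define e where "e = lead_coeff w"
  have e: "e \<in> A - m" "e - u * h \<in> m"
    using w(1,2) wh w_const by (auto simp: e_def dest: A.coeffs_inD)
  show ?thesis unfolding G_domain_mod_def
  proof (rule bexI[of _ "a * e"], rule ballI)
    show "a * e \<in> A - m" using unit e aA am by auto
    fix b assume b: "b \<in> A - m"
    then obtain c N where c: "c \<in> adjoin A x" "b * c - u ^ N \<in> m" using u(3) AB by blast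
    have cS: "c \<in> S" using c BS by auto
    obtain C where C: "C \<in> coeffs_in A" "c * h ^ N = poly C x"
      using c(1) h(1) B.mult_in B.power_in unfolding adjoin_def by (metis (no_types, lifting) imageE)
    obtain q r M where qr: "q \<in> coeffs_in A" "r \<in> coeffs_in A" "smult (a ^ M) C = q * f + r" "degree r < n"
      using A.pseudo_division[OF fA n1 C(1)] by (auto simp: n_def a_def)
    have "a ^ M * (c * h ^ N) = poly q x * poly f x + poly r x"
      using arg_cong[OF qr(3), of "\<lambda>p. poly p x"] C(2) by simp
    then have rx: "poly r x = a ^ M * (c * h ^ N) - poly q x * poly f x" by simp
    have eN: "e ^ N - (u * h) ^ N \<in> m" using e sub uS hS by (intro power_cong) auto
    define g where "g = smult b r - [:a ^ M * e ^ N:]"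
    have "poly g x = a ^ M * h ^ N * (b * c - u ^ N) - a ^ M * (e ^ N - (u * h) ^ N)
        - b * poly q x * poly f x"
      by (simp add: g_def rx algebra_simps power_mult_distrib)
    also have "\<dots> \<in> m"
    proof -
      have "a ^ M \<in> S" "a ^ M * h ^ N \<in> S" "b * poly q x \<in> S"
        using b sub aA hS pS[OF qr(1)] by auto
      then show ?thesis using c(2) eN fm
        by (intro idlD(7)[OF m_idl idlD(7)[OF m_idl]] idlD(4)[OF m_idl])
    qed
    finally have "poly g x \<in> m" .
    moreover have "degree g < n" unfolding g_def using qr(4) n1
      by (intro degree_diff_less order.strict_trans1[OF degree_smult_le]) (auto simp: n_def)
    moreover have "g \<in> coeffs_in A" unfolding g_def using qr(2) b aA e(1) by auto
    ultimately have "coeff g 0 \<in> m" using small by blast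
    then have g0: "b * coeff r 0 - a ^ M * e ^ N \<in> m" by (simp add: g_def)
    show "\<exists>c\<in>A. \<exists>N. b * c - (a * e) ^ N \<in> m"
    proof (intro bexI exI)
      show "coeff r 0 * a ^ N * e ^ M \<in> A" using qr(2) aA e(1) by (auto dest: A.coeffs_inD)
      \<comment> \<open>The factor \<open>a ^ N * e ^ M\<close> evens out the exponents, since a
        power of the single element \<open>a * e\<close> is required.\<close>
      have "b * (coeff r 0 * a ^ N * e ^ M) - (a * e) ^ (M + N) =
          (a ^ N * e ^ M) * (b * coeff r 0 - a ^ M * e ^ N)"
        by (simp add: algebra_simps power_add power_mult_distrib)
      also have "\<dots> \<in> m" using g0 aA e(1) sub by (intro idlD(4)[OF m_idl]) auto
      finally show "b * (coeff r 0 * a ^ N * e ^ M) - (a * e) ^ (M + N) \<in> m" .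
    qed
  qed
qed

end

section \<open>Iterated adjunction and the Nullstellensatz\<close>

lemma (in relative_ring) relative_ring_adjoins: "relative_ring (foldl adjoin S xs)"
  using relative_ring_axioms
proof (induction xs arbitrary: S)
  case (Cons x xs)
  interpret T: relative_ring S by fact
  show ?case using Cons.IH[OF T.relative_ring_adjoin] by simp
qed simp

lemma (in relative_ring) adjoins_superset: "S \<subseteq> foldl adjoin S xs"
  using relative_ring_axioms
proof (induction xs arbitrary: S)
  case (Cons x xs)
  interpret T: relative_ring S by fact
  show ?case using Cons.IH[OF T.relative_ring_adjoin, of x] T.adjoin_superset[of x] by simp
qed simp

lemma (in relative_ring) adjoins_mem: "set xs \<subseteq> foldl adjoin S xs"
  using relative_ring_axioms
proof (induction xs arbitrary: S)
  case (Cons x xs)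
  interpret T: relative_ring S by fact
  interpret U: relative_ring "adjoin S x" by (rule T.relative_ring_adjoin)
  show ?case using Cons.IH[OF T.relative_ring_adjoin, of x] T.adjoin_mem[of x] U.adjoins_superset by auto
qed simp

text \<open>Zariski's lemma by way of G-domains: \<open>S\<close> modulo \<open>m\<close> is a
  field, so \<open>u = 1\<close> serves, and stripping the adjoined elements from the end keeps the
  property down to \<open>adjoin K x\<close>. The element of interest heads the list because
  algebraicity is read off at the last adjunction that remains.\<close>

theorem (in relative_ring) nullstellensatz:
  assumes m: "maximal_idl m" and K: "relative_ring K" and S: "S = foldl adjoin K (x # xs)"
  shows "algebraic_mod m K x"
proof -
  have prime: "prime_idl m" using maximal_imp_prime[OF m] .
  have mi: "idl m" "1 \<notin> m" using m by (auto simp: maximal_idl_def)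
  interpret K: relative_ring K by fact
  have full: "G_domain_mod m S" unfolding G_domain_mod_def
  proof (rule bexI[of _ 1], rule ballI)
    fix b assume b: "b \<in> S - m"
    then have "1 \<in> ext m b"
      using m ext_idl[OF mi(1), of b] ext_superset[of m b] ext_mem[OF mi(1), of b] unfolding maximal_idl_def by blast
    then obtain i c where "i \<in> m" "c \<in> S" "1 = i + c * b" by (rule extE)
    then have "b * c - 1 ^ 0 = - i" "c \<in> S" "i \<in> m" by (auto simp: algebra_simps)
    then show "\<exists>c\<in>S. \<exists>N. b * c - 1 ^ N \<in> m" using idlD(6)[OF mi(1)] by metis
  qed (use mi in auto)
  have descend: "G_domain_mod m (foldl adjoin L ys)"
    if "relative_ring L" "foldl adjoin L (ys @ zs) \<subseteq> S" "G_domain_mod m (foldl adjoin L (ys @ zs))" for L ys zs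
    using that
  proof (induction zs rule: rev_induct)
    case (snoc z zs)
    interpret L: relative_ring L by fact
    let ?A = "foldl adjoin L (ys @ zs)"
    interpret A: relative_ring ?A by (rule L.relative_ring_adjoins)
    have AS: "adjoin ?A z \<subseteq> S" using snoc.prems by simp
    then have "?A \<subseteq> S" using A.adjoin_superset by blast
    then interpret AM: subring_mod_prime S ?A m by unfold_locales (use prime in auto)
    have "G_domain_mod m ?A"
      using AM.G_domain_adjoin_base[of z] A.adjoin_mem[of z] AS snoc.prems by auto
    then show ?case using snoc.IH[OF snoc.prems(1)] \<open>?A \<subseteq> S\<close> by simp
  qed simp
  have "G_domain_mod m (adjoin K x)" using descend[OF K, of "[x]" xs] S full by simp
  moreover have xS: "x \<in> S" and KS: "K \<subseteq> S"
    using K.adjoins_mem[of "x # xs"] K.adjoins_superset[of "x # xs"] S by auto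
  moreover have "subring_mod_prime S K m" by unfold_locales (use prime KS in auto)
  ultimately show ?thesis using subring_mod_prime.G_domain_adjoin_algebraic by blast
qed

section \<open>Monomial ideals in polynomial rings\<close>

type_synonym ('v, 'k) mpoly = "('v \<Rightarrow>\<^sub>0 nat) \<Rightarrow>\<^sub>0 'k"

abbreviation keys where "keys \<equiv> Poly_Mapping.keys"
abbreviation lookup where "lookup \<equiv> Poly_Mapping.lookup"
abbreviation single where "single \<equiv> Poly_Mapping.single"

definition poly_carrier :: "'v set \<Rightarrow> ('v, 'k::field) mpoly set" where
  "poly_carrier V = {p. \<forall>m\<in>keys p. keys m \<subseteq> V}"

text \<open>For a complex \<open>\<Gamma>\<close> on \<open>V\<close> this is its Stanley--Reisner
  ideal; for \<open>\<Gamma> = Pow F\<close> it is the prime generated by the variables outside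
  \<open>F\<close>; for empty \<open>\<Gamma>\<close> it is the whole ring.\<close>

definition mono_ideal :: "'v set \<Rightarrow> 'v set set \<Rightarrow> ('v, 'k::field) mpoly set" where
  "mono_ideal V \<Gamma> = {p \<in> poly_carrier V. \<forall>m\<in>keys p. keys m \<notin> \<Gamma>}"

text \<open>Divides the terms divisible by \<open>variable v\<close> by that variable and drops the
  others: a left inverse of multiplication by it.\<close>

definition shift_down :: "'v \<Rightarrow> ('v, 'k::field) mpoly \<Rightarrow> ('v, 'k) mpoly" where
  "shift_down v = Poly_Mapping.map_key (\<lambda>m. m + single v 1)"

definition constants :: "('v, 'k::field) mpoly set" where
  "constants = range (single 0)"

lemma keys_plus_nat: "keys (a + b :: 'v \<Rightarrow>\<^sub>0 nat) = keys a \<union> keys b"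
  by (auto simp: in_keys_iff lookup_add)

lemma sum_singles: "(\<Sum>m\<in>keys f. single m (lookup f m)) = f"
  by (rule poly_mapping_eqI)
    (auto simp: lookup_sum lookup_single when_def sum.delta' in_keys_iff)

lemma lookup_times:
  fixes f g :: "('v, 'k::field) mpoly"
  shows "lookup (f * g) k = (\<Sum>a\<in>keys f. \<Sum>b\<in>keys g. if a + b = k then lookup f a * lookup g b else 0)"
proof -
  have "f * g = (\<Sum>a\<in>keys f. single a (lookup f a)) * (\<Sum>b\<in>keys g. single b (lookup g b))"
    by (simp add: sum_singles)
  also have "\<dots> = (\<Sum>a\<in>keys f. \<Sum>b\<in>keys g. single (a + b) (lookup f a * lookup g b))"
    by (simp add: sum_product mult_single)
  finally show ?thesis by (simp add: lookup_sum lookup_single when_def)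
qed

lemma lookup_single_times:
  fixes f :: "('v, 'k::field) mpoly"
  shows "lookup (single t c * f) (t + m) = c * lookup f m"
proof (cases "c = 0")
  case False
  have "lookup (single t c * f) (t + m) = (\<Sum>b\<in>keys f. if b = m then c * lookup f b else 0)"
    using False by (simp add: lookup_times)
  also have "\<dots> = c * lookup f m" by (auto simp: sum.delta in_keys_iff)
  finally show ?thesis .
qed simp

lemma lookup_const_times:
  fixes f :: "('v, 'k::field) mpoly"
  shows "lookup (single 0 c * f) m = c * lookup f m"
  using lookup_single_times[of 0 c f m] by simp

lemma keys_single_times:
  fixes f :: "('v, 'k::field) mpoly"
  shows "k \<in> keys (single t c * f) \<Longrightarrow> \<exists>m\<in>keys f. k = t + m"
  using keys_mult[of "single t c" f] by (auto split: if_splits)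

lemma keys_times:
  fixes f g :: "('v, 'k::field) mpoly"
  shows "k \<in> keys (f * g) \<Longrightarrow> \<exists>a\<in>keys f. \<exists>b\<in>keys g. k = a + b"
  using keys_mult[of f g] by blast

lemma keys_power:
  fixes f :: "('v, 'k::field) mpoly"
  assumes "\<And>m v. m \<in> keys f \<Longrightarrow> lookup m v \<le> D" "m \<in> keys (f ^ n)"
  shows "lookup m v \<le> D * n"
  using assms(2)
proof (induction n arbitrary: m)
  case (Suc n)
  then obtain a b where "a \<in> keys f" "b \<in> keys (f ^ n)" "m = a + b" using keys_times by fastforce
  then show ?case using Suc.IH assms(1)[of a v] by (fastforce simp: lookup_add intro: add_mono)
qed simp

lemma keys_prod:
  fixes f :: "'i \<Rightarrow> ('v, 'k::field) mpoly"
  assumes "\<And>i m. i \<in> I \<Longrightarrow> m \<in> keys (f i) \<Longrightarrow> lookup m v \<le> D" "m \<in> keys (prod f I)"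
  shows "lookup m v \<le> D * card I"
  using assms
proof (induction I arbitrary: m rule: infinite_finite_induct)
  case (insert i I)
  then obtain a b where "a \<in> keys (f i)" "b \<in> keys (prod f I)" "m = a + b"
    using keys_times[of m "f i" "prod f I"] by auto
  then show ?case using insert.IH[of b] insert.prems(1)[of i a] insert.prems(1) insert.hyps
    by (force simp: lookup_add intro: add_mono)
qed auto

lemma relative_ring_poly_carrier:
  "relative_ring (poly_carrier V :: ('v, 'k::field) mpoly set)"
proof
  show "1 \<in> poly_carrier V" by (simp add: poly_carrier_def)
  fix a b :: "('v, 'k) mpoly" assume ab: "a \<in> poly_carrier V" "b \<in> poly_carrier V"
  show "a - b \<in> poly_carrier V"
    using ab keys_diff[of a b] by (auto simp: poly_carrier_def)
  show "a * b \<in> poly_carrier V"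
    using ab keys_times[of _ a b] by (fastforce simp: poly_carrier_def keys_plus_nat)
qed

lemma relative_ring_constants: "relative_ring constants"
proof
  show "1 \<in> constants" by (auto simp: constants_def intro: image_eqI[of _ _ 1])
qed (auto simp: constants_def single_diff[symmetric] mult_single)

interpretation PC: relative_ring "poly_carrier V" by (rule relative_ring_poly_carrier)

lemma constants_subset: "constants \<subseteq> poly_carrier V"
  by (auto simp: constants_def poly_carrier_def split: if_splits)

lemma const_in_carrier [simp]: "single 0 c \<in> poly_carrier V"
  by (auto simp: poly_carrier_def)

lemma single_in_carrier: "keys m \<subseteq> V \<Longrightarrow> single m c \<in> poly_carrier V"
  by (auto simp: poly_carrier_def)

lemma variable_in_carrier: "v \<in> V \<Longrightarrow> variable v \<in> poly_carrier V"
  unfolding variable_def by (rule single_in_carrier) simp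

lemma const_unit: "PC.idl V I \<Longrightarrow> single 0 c * f \<in> I \<Longrightarrow> c \<noteq> 0 \<Longrightarrow> f \<in> I"
proof -
  assume I: "PC.idl V I" and f: "single 0 c * f \<in> I" and c: "c \<noteq> 0"
  have "single 0 (inverse c) * (single 0 c * f) = f"
    using c by (simp add: mult_single flip: mult.assoc)
  then show "f \<in> I" using PC.idlD(4)[OF I const_in_carrier f] by metis
qed

lemma const_in_proper_idl: "PC.idl V I \<Longrightarrow> 1 \<notin> I \<Longrightarrow> single 0 c \<in> I \<Longrightarrow> c = 0"
  using const_unit[of V I c 1] by auto

lemma variable_power: "variable v ^ n = single (single v n) 1"
  by (induction n) (auto simp: variable_def mult_single single_add[symmetric])

lemma monomial_prod:
  assumes "finite V" "keys m \<subseteq> V"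
  shows "single m 1 = (\<Prod>v\<in>V. variable v ^ lookup m v)"
proof -
  have "(\<Prod>v\<in>W. single (single v (lookup m v)) 1) = single (\<Sum>v\<in>W. single v (lookup m v)) (1::'b::field)"
    if "finite W" for W
    using that by (induction W rule: finite_induct) (auto simp: mult_single)
  moreover have "(\<Sum>v\<in>V. single v (lookup m v)) = m"
    by (rule poly_mapping_eqI)
      (use assms in \<open>auto simp: lookup_sum lookup_single when_def sum.delta' in_keys_iff\<close>)
  ultimately show ?thesis using assms by (simp add: variable_power)
qed

lemma mono_ideal_idl:
  assumes "\<And>F G. F \<in> \<Gamma> \<Longrightarrow> G \<subseteq> F \<Longrightarrow> G \<in> \<Gamma>"
  shows "PC.idl V (mono_ideal V \<Gamma> :: ('v, 'k::field) mpoly set)"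
  unfolding PC.idl_def
proof (intro conjI ballI)
  show "mono_ideal V \<Gamma> \<subseteq> poly_carrier V" "0 \<in> mono_ideal V \<Gamma>" by (auto simp: mono_ideal_def)
  fix a b :: "('v, 'k) mpoly" assume "a \<in> mono_ideal V \<Gamma>" "b \<in> mono_ideal V \<Gamma>"
  then show "a + b \<in> mono_ideal V \<Gamma>" using keys_add[of a b] by (fastforce simp: mono_ideal_def)
next
  fix s a :: "('v, 'k) mpoly" assume sa: "s \<in> poly_carrier V" "a \<in> mono_ideal V \<Gamma>"
  have "keys k \<notin> \<Gamma>" if k: "k \<in> keys (s * a)" for k
  proof -
    obtain x y where "y \<in> keys a" "k = x + y" using keys_times[OF k] by blast
    then show ?thesis using sa(2) assms by (fastforce simp: mono_ideal_def keys_plus_nat)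
  qed
  then show "s * a \<in> mono_ideal V \<Gamma>" using sa by (auto simp: mono_ideal_def)
qed

lemma mono_ideal_singles:
  assumes I: "PC.idl V I" and f: "f \<in> poly_carrier V" and "\<And>m. m \<in> keys f \<Longrightarrow> single m 1 \<in> I"
  shows "f \<in> I"
proof -
  have "single m (lookup f m) \<in> I" if "m \<in> keys f" for m
    using PC.idlD(4)[OF I const_in_carrier assms(3)[OF that], of "lookup f m"] by (simp add: mult_single)
  then show ?thesis using PC.idl_sum[OF I, of "keys f"] sum_singles[of f] by metis
qed

section \<open>The lexicographic order on monomials\<close>

fun mono_less :: "'v list \<Rightarrow> ('v \<Rightarrow>\<^sub>0 nat) \<Rightarrow> ('v \<Rightarrow>\<^sub>0 nat) \<Rightarrow> bool" where
  "mono_less [] a b \<longleftrightarrow> False"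
| "mono_less (v # vs) a b \<longleftrightarrow> lookup a v < lookup b v \<or> lookup a v = lookup b v \<and> mono_less vs a b"

lemma mono_less_irrefl: "\<not> mono_less vs a a"
  by (induction vs) auto

lemma mono_less_trans: "mono_less vs a b \<Longrightarrow> mono_less vs b c \<Longrightarrow> mono_less vs a c"
  by (induction vs) auto

lemma mono_less_add: "mono_less vs (a + c) (b + c) \<longleftrightarrow> mono_less vs a b"
  by (induction vs) (auto simp: lookup_add)

lemma mono_less_total:
  assumes "keys a \<subseteq> set vs" "keys b \<subseteq> set vs" "a \<noteq> b"
  shows "mono_less vs a b \<or> mono_less vs b a"
proof (rule ccontr)
  assume "\<not> ?thesis"
  then have "\<forall>v\<in>set vs. lookup a v = lookup b v" by (induction vs) auto
  then have "a = b" using assms by (intro poly_mapping_eqI) (metis in_keys_iff subsetD)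
  then show False using assms by simp
qed

lemma wf_mono_less: "wf {(a, b). mono_less vs a b}"
proof (induction vs)
  case (Cons v vs)
  have "{(a, b). mono_less (v # vs) a b} \<subseteq>
      inv_image (less_than <*lex*> {(a, b). mono_less vs a b}) (\<lambda>a. (lookup a v, a))"
    by auto
  moreover have "wf (inv_image (less_than <*lex*> {(a, b). mono_less vs a b}) (\<lambda>a. (lookup a v, a)))"
    using Cons by (intro wf_inv_image wf_lex_prod wf_less_than)
  ultimately show ?case by (rule wf_subset[rotated])
qed simp

lemma mono_maximal:
  assumes "finite M" "M \<noteq> {}" "\<And>m. m \<in> M \<Longrightarrow> keys m \<subseteq> set vs"
  obtains m where "m \<in> M" "\<And>k. k \<in> M \<Longrightarrow> k \<noteq> m \<Longrightarrow> mono_less vs k m"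
proof -
  have "\<exists>m\<in>M. \<forall>k\<in>M. k \<noteq> m \<longrightarrow> mono_less vs k m"
    using assms
  proof (induction M rule: finite_ne_induct)
    case (insert x M)
    then obtain m where m: "m \<in> M" "\<forall>k\<in>M. k \<noteq> m \<longrightarrow> mono_less vs k m" by auto
    then have "mono_less vs x m \<or> mono_less vs m x" using insert mono_less_total by (metis insert_iff)
    then show ?case using m mono_less_trans by (metis insert_iff)
  qed simp
  then show ?thesis using that by blast
qed

text \<open>Terms supported in \<open>G\<close> are those that survive modulo the ideal. If both
  factors have one, the product of the lexicographically largest such terms cannot cancel, because
  every factorization of its monomial involves only monomials supported in \<open>G\<close>.\<close>

lemma mono_ideal_prime:
  assumes "finite V" "G \<subseteq> V"
  shows "PC.prime_idl V (mono_ideal V (Pow G))"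
  unfolding PC.prime_idl_def
proof (intro conjI ballI impI)
  show "PC.idl V (mono_ideal V (Pow G))" by (rule mono_ideal_idl) auto
  show "1 \<notin> mono_ideal V (Pow G)" by (simp add: mono_ideal_def)
  fix f g :: "('a, 'b) mpoly"
  assume fg: "f \<in> poly_carrier V" "g \<in> poly_carrier V" "f * g \<in> mono_ideal V (Pow G)"
  obtain vs where vs: "set vs = V" using finite_list[OF assms(1)] by blast
  show "f \<in> mono_ideal V (Pow G) \<or> g \<in> mono_ideal V (Pow G)"
  proof (rule ccontr)
    assume no: "\<not> ?thesis"
    define A B where "A = {m \<in> keys f. keys m \<subseteq> G}" and "B = {m \<in> keys g. keys m \<subseteq> G}"
    have "A \<noteq> {}" "B \<noteq> {}" using no fg by (auto simp: mono_ideal_def A_def B_def)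
    moreover have fin: "finite A" "finite B" by (auto simp: A_def B_def)
    moreover have sub: "\<And>m. m \<in> A \<Longrightarrow> keys m \<subseteq> set vs" "\<And>m. m \<in> B \<Longrightarrow> keys m \<subseteq> set vs"
      using vs assms by (auto simp: A_def B_def)
    ultimately obtain a where a: "a \<in> A" "\<And>k. k \<in> A \<Longrightarrow> k \<noteq> a \<Longrightarrow> mono_less vs k a"
      using mono_maximal[of A vs] by blast
    obtain b where b: "b \<in> B" "\<And>k. k \<in> B \<Longrightarrow> k \<noteq> b \<Longrightarrow> mono_less vs k b"
      using mono_maximal[of B vs] \<open>B \<noteq> {}\<close> fin sub by blast
    have uniq: "x = a \<and> y = b" if "x \<in> keys f" "y \<in> keys g" "x + y = a + b" for x y
    proof -
      have "keys x \<union> keys y \<subseteq> G" using a b that(3) unfolding A_def B_def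
        by (metis (mono_tags, lifting) Un_subset_iff keys_plus_nat mem_Collect_eq)
      then have xy: "x \<in> A" "y \<in> B" using that by (auto simp: A_def B_def)
      show ?thesis
      proof (rule ccontr)
        assume "\<not> ?thesis"
        then have "x \<noteq> a" "y \<noteq> b" using that(3) by auto
        then have "mono_less vs (x + y) (a + y)" "mono_less vs (a + y) (a + b)"
          using a(2)[OF xy(1)] b(2)[OF xy(2)] mono_less_add[of vs x y a] mono_less_add[of vs y a b]
          by (auto simp: add.commute)
        then show False using mono_less_trans mono_less_irrefl that(3) by metis
      qed
    qed
    have "lookup (f * g) (a + b) = (\<Sum>x\<in>keys f. \<Sum>y\<in>keys g. if x = a then if y = b then lookup f x * lookup g y else 0 else 0)"
      unfolding lookup_times using uniq by (intro sum.cong) auto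
    also have "\<dots> = lookup f a * lookup g b"
    proof -
      have "(\<Sum>y\<in>keys g. if x = a then if y = b then lookup f x * lookup g y else 0 else 0) =
          (if x = a then lookup f x * lookup g b else 0)" for x
        using b by (auto simp: B_def sum.delta)
      then show ?thesis using a by (simp add: A_def sum.delta)
    qed
    finally have "a + b \<in> keys (f * g)" using a b by (auto simp: A_def B_def in_keys_iff)
    moreover have "keys (a + b) \<subseteq> G" using a(1) b(1) by (auto simp: keys_plus_nat A_def B_def)
    ultimately show False using fg(3) by (auto simp: mono_ideal_def)
  qed
qed

section \<open>Noetherianity\<close>

lemma monotone_subsequence:
  fixes f :: "nat \<Rightarrow> nat"
  obtains r :: "nat \<Rightarrow> nat" where "strict_mono r" "mono (f \<circ> r)"
proof -
  obtain r :: "nat \<Rightarrow> nat" where r: "strict_mono r" "monoseq (f \<circ> r)"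
    using seq_monosub[of f] by (auto simp: o_def)
  show ?thesis
  proof (cases "incseq (f \<circ> r)")
    case False
    then have dec: "decseq (f \<circ> r)" using r(2) by (auto simp: monoseq_iff)
    \<comment> \<open>A decreasing sequence of natural numbers is constant from its minimum
      on.\<close>
    obtain N where N: "\<And>n. f (r N) \<le> f (r n)"
      using ex_has_least_nat[of "\<lambda>_. True" 0 "f \<circ> r"] by auto
    have "f (r (N + n)) = f (r N)" for n
      using N[of "N + n"] decseqD[OF dec, of N "N + n"] by simp
    then have "mono (f \<circ> (\<lambda>n. r (N + n)))" by (simp add: mono_def)
    moreover have "strict_mono (\<lambda>n. r (N + n))" using r(1) by (simp add: strict_mono_def)
    ultimately show ?thesis using that by blast
  qed (use r that in auto)
qed

text \<open>Passage to a monotone subsequence, once for each variable.\<close>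

lemma dickson:
  fixes s :: "nat \<Rightarrow> 'v \<Rightarrow> nat"
  assumes "finite V"
  obtains r :: "nat \<Rightarrow> nat" where "strict_mono r" "\<And>v. v \<in> V \<Longrightarrow> mono (\<lambda>i. s (r i) v)"
proof -
  have "\<exists>r::nat \<Rightarrow> nat. strict_mono r \<and> (\<forall>v\<in>V. mono (\<lambda>i. s (r i) v))"
    using assms
  proof (induction V rule: finite_induct)
    case empty
    then show ?case by (intro exI[of _ id]) (auto simp: strict_mono_def)
  next
    case (insert v V)
    then obtain r :: "nat \<Rightarrow> nat" where r: "strict_mono r" "\<forall>v\<in>V. mono (\<lambda>i. s (r i) v)" by blast
    obtain r' :: "nat \<Rightarrow> nat" where r': "strict_mono r'" "mono ((\<lambda>i. s (r i) v) \<circ> r')"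
      using monotone_subsequence by blast
    have "mono r'" using r'(1) by (rule strict_mono_mono)
    then have "\<forall>w\<in>insert v V. mono (\<lambda>i. s ((r \<circ> r') i) w)"
      using r r' by (auto simp: mono_def)
    then show ?case using strict_mono_o[OF r(1) r'(1)] by blast
  qed
  then show ?thesis using that by blast
qed

definition lead_mono :: "'v list \<Rightarrow> ('v, 'k::field) mpoly \<Rightarrow> ('v \<Rightarrow>\<^sub>0 nat)" where
  "lead_mono vs f = (SOME m. m \<in> keys f \<and> (\<forall>k\<in>keys f. k \<noteq> m \<longrightarrow> mono_less vs k m))"

lemma lead_mono:
  assumes "f \<noteq> 0" "f \<in> poly_carrier (set vs)"
  shows "lead_mono vs f \<in> keys f" "\<And>k. k \<in> keys f \<Longrightarrow> k \<noteq> lead_mono vs f \<Longrightarrow> mono_less vs k (lead_mono vs f)"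
proof -
  obtain m where "m \<in> keys f" "\<And>k. k \<in> keys f \<Longrightarrow> k \<noteq> m \<Longrightarrow> mono_less vs k m"
    using mono_maximal[of "keys f" vs] assms by (auto simp: poly_carrier_def)
  then have "\<exists>m. m \<in> keys f \<and> (\<forall>k\<in>keys f. k \<noteq> m \<longrightarrow> mono_less vs k m)" by blast
  from someI_ex[OF this, folded lead_mono_def]
  show "lead_mono vs f \<in> keys f" "\<And>k. k \<in> keys f \<Longrightarrow> k \<noteq> lead_mono vs f \<Longrightarrow> mono_less vs k (lead_mono vs f)"
    by blast+
qed

text \<open>In a non-finitely generated ideal, repeatedly pick an element with minimal leading monomial
  outside the ideal generated so far; by Dickson's lemma one of them can be reduced by an earlier one.\<close>

theorem hilbert_basis:
  assumes "finite V"
  shows "relative_ring.noeth (poly_carrier V :: ('v, 'k::field) mpoly set)"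
proof -
  obtain vs where vs: "set vs = V" using finite_list[OF assms] by blast
  let ?S = "poly_carrier V :: ('v, 'k) mpoly set"
  show ?thesis unfolding PC.noeth_def
  proof (intro allI impI, rule ccontr)
    fix I :: "('v, 'k) mpoly set"
    assume I: "PC.idl V I" and nf: "\<not> (\<exists>X. finite X \<and> X \<subseteq> I \<and> I = PC.gen V X)"
    have IS: "I \<subseteq> ?S" using PC.idlD(1)[OF I] .
    have pick: "\<exists>f. f \<in> I - PC.gen V X \<and> (\<forall>g\<in>I - PC.gen V X. \<not> mono_less vs (lead_mono vs g) (lead_mono vs f))"
      if X: "finite X" "X \<subseteq> I" for X
    proof -
      have "I - PC.gen V X \<noteq> {}" using nf X PC.gen_least[OF I X(2)] by blast
      then have "lead_mono vs ` (I - PC.gen V X) \<noteq> {}" by blast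
      then obtain m where m: "m \<in> lead_mono vs ` (I - PC.gen V X)"
        "\<And>k. mono_less vs k m \<Longrightarrow> k \<notin> lead_mono vs ` (I - PC.gen V X)"
        using wfE_min[OF wf_mono_less[of vs]] by (metis (no_types, lifting) case_prodI ex_in_conv mem_Collect_eq)
      then show ?thesis by blast
    qed
    define nx where "nx X = (SOME f. f \<in> I - PC.gen V X \<and>
      (\<forall>g\<in>I - PC.gen V X. \<not> mono_less vs (lead_mono vs g) (lead_mono vs f)))" for X
    have nx: "nx X \<in> I - PC.gen V X" "\<And>g. g \<in> I - PC.gen V X \<Longrightarrow> \<not> mono_less vs (lead_mono vs g) (lead_mono vs (nx X))"
      if "finite X" "X \<subseteq> I" for X
      using someI_ex[OF pick[OF that]] unfolding nx_def by blast+
    define X where "X n = ((\<lambda>X. insert (nx X) X) ^^ n) {}" for n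
    have X0: "X 0 = {}" and XS: "\<And>n. X (Suc n) = insert (nx (X n)) (X n)" by (auto simp: X_def)
    have Xf: "finite (X n) \<and> X n \<subseteq> I" for n
      by (induction n) (use nx in \<open>auto simp: X0 XS\<close>)
    have Xmono: "X i \<subseteq> X j" if "i \<le> j" for i j
      using lift_Suc_mono_le[of X, OF _ that] XS by auto
    define f where "f n = nx (X n)" for n
    have f: "f n \<in> I" "f n \<notin> PC.gen V (X n)"
      "\<And>g. g \<in> I \<Longrightarrow> g \<notin> PC.gen V (X n) \<Longrightarrow> \<not> mono_less vs (lead_mono vs g) (lead_mono vs (f n))" for n
      using nx[of "X n"] Xf[of n] by (auto simp: f_def)
    obtain r :: "nat \<Rightarrow> nat" where r: "strict_mono r" "\<And>v. v \<in> V \<Longrightarrow> mono (\<lambda>i. lookup (lead_mono vs (f (r i))) v)"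
      using dickson[OF assms, of "\<lambda>i. lookup (lead_mono vs (f i))"] by blast
    define i j where "i = r 0" and "j = r 1"
    have ij: "i < j" using r(1) by (simp add: i_def j_def strict_mono_def)
    have genI: "PC.idl V (PC.gen V (X n))" for n using PC.gen_idl Xf IS by blast
    have nz: "f n \<noteq> 0" for n using f(2)[of n] PC.idlD(2)[OF genI] by metis
    have fS: "f n \<in> poly_carrier (set vs)" for n using f(1) IS vs by auto
    note lm = lead_mono[OF nz fS]
    define a b where "a = lead_mono vs (f i)" and "b = lead_mono vs (f j)"
    have ab: "keys a \<subseteq> V" "keys b \<subseteq> V" using lm(1)[of i] lm(1)[of j] fS vs by (auto simp: a_def b_def poly_carrier_def)
    have le: "lookup a v \<le> lookup b v" for v
    proof (cases "v \<in> V")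
      case True
      then show ?thesis using r(2)[OF True] by (auto simp: mono_def a_def b_def i_def j_def)
    next
      case False
      then have "v \<notin> keys a" using ab by blast
      then show ?thesis by (simp add: in_keys_iff)
    qed
    have ba: "b - a + a = b" by (rule poly_mapping_eqI) (simp add: lookup_add lookup_minus le)
    define c where "c = lookup (f j) b / lookup (f i) a"
    define t where "t = single (b - a) c"
    define g where "g = f j - t * f i"
    have "keys (b - a) \<subseteq> V" using ab by (auto simp: in_keys_iff lookup_minus)
    then have tS: "t \<in> ?S" by (auto simp: t_def intro: single_in_carrier)
    have "f i \<in> X (Suc i)" by (simp add: XS f_def)
    then have "f i \<in> PC.gen V (X j)" using Xmono[of "Suc i" j] ij PC.gen_superset by fastforce
    then have tf: "t * f i \<in> PC.gen V (X j)" using PC.idlD(4)[OF genI tS] by blast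
    have gX: "g \<notin> PC.gen V (X j)"
      using f(2)[of j] PC.idlD(3)[OF genI _ tf, of g] by (auto simp: g_def)
    have gI: "g \<in> I" unfolding g_def using PC.idlD(7)[OF I f(1)] PC.idlD(4)[OF I tS f(1)] by blast
    have g0: "g \<noteq> 0" using gX PC.idlD(2)[OF genI] by metis
    have lca: "lookup (f i) a \<noteq> 0" using lm(1)[of i] by (auto simp: a_def in_keys_iff)
    have "lookup (t * f i) b = c * lookup (f i) a"
      using lookup_single_times[of "b - a" c "f i" a] by (simp add: t_def ba)
    then have gb: "lookup g b = 0" using lca by (simp add: g_def lookup_minus c_def)
    have "mono_less vs k b" if k: "k \<in> keys g" for k
    proof -
      have kb: "k \<noteq> b" using k gb by (auto simp: in_keys_iff)
      have "k \<in> keys (f j) \<or> k \<in> keys (t * f i)" using k keys_diff[of "f j" "t * f i"] unfolding g_def by blast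
      then show ?thesis
      proof
        assume "k \<in> keys (f j)" then show ?thesis using lm(2)[of k j] kb by (simp add: b_def)
      next
        assume "k \<in> keys (t * f i)"
        then obtain k' where k': "k' \<in> keys (f i)" "k = (b - a) + k'" using keys_single_times unfolding t_def by blast
        then have "k' \<noteq> a" using kb ba by auto
        then have "mono_less vs k' a" using lm(2)[OF k'(1)] by (simp add: a_def)
        then have "mono_less vs (k' + (b - a)) (a + (b - a))" by (simp add: mono_less_add)
        then show ?thesis using k'(2) ba by (simp add: add.commute)
      qed
    qed
    moreover have "lead_mono vs g \<in> keys g" using lead_mono(1)[OF g0] gI IS vs by auto
    ultimately show False using f(3)[OF gI gX] by (simp add: b_def)
  qed
qed

section \<open>Regular sequences on Stanley--Reisner rings\<close>

lemma inj_shift: "inj (\<lambda>m::'v \<Rightarrow>\<^sub>0 nat. m + single v 1)"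
  by (simp add: inj_def)

lemma lookup_shift_down: "lookup (shift_down v f) m = lookup f (m + single v 1)"
  unfolding shift_down_def by (subst map_key.rep_eq[OF inj_shift]) simp

lemma shift_down_add: "shift_down v (f + g) = shift_down v f + shift_down v g"
  by (rule poly_mapping_eqI) (simp add: lookup_shift_down lookup_add)

lemma shift_down_0 [simp]: "shift_down v 0 = 0"
  by (rule poly_mapping_eqI) (simp add: lookup_shift_down)

lemma shift_down_sum: "shift_down v (sum f A) = (\<Sum>i\<in>A. shift_down v (f i))"
  by (induction A rule: infinite_finite_induct) (auto simp: shift_down_add)

lemma shift_down_variable: "shift_down v (variable v * f) = f"
proof (rule poly_mapping_eqI)
  fix m
  show "lookup (shift_down v (variable v * f)) m = lookup f m"
    using lookup_single_times[of "single v 1" 1 f m]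
    by (simp add: lookup_shift_down variable_def add.commute)
qed

lemma keys_shift_down: "m \<in> keys (shift_down v f) \<longleftrightarrow> m + single v 1 \<in> keys f"
  by (simp add: in_keys_iff lookup_shift_down)

lemma shift_down_in: "f \<in> poly_carrier V \<Longrightarrow> shift_down v f \<in> poly_carrier V"
proof -
  assume f: "f \<in> poly_carrier V"
  have "keys m \<subseteq> V" if "m \<in> keys (shift_down v f)" for m
    using f that keys_plus_nat[of m "single v 1"] unfolding poly_carrier_def keys_shift_down by auto
  then show ?thesis by (auto simp: poly_carrier_def)
qed

lemma lookup_shift_down_funpow: "lookup ((shift_down v ^^ n) f) m = lookup f (m + single v n)"
proof (induction n arbitrary: m)
  case (Suc n)
  have "m + single v 1 + single v n = m + single v (Suc n)"
    by (simp add: add.assoc single_add[symmetric])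
  then show ?case using Suc by (simp add: lookup_shift_down)
qed simp

lemma shift_down_nilpotent: "\<exists>n. (shift_down v ^^ n) f = 0"
proof -
  define n where "n = Suc (\<Sum>m\<in>keys f. lookup m v)"
  have "lookup f (m + single v n) = 0" for m
  proof (rule ccontr)
    assume "\<not> ?thesis"
    then have "m + single v n \<in> keys f" by (simp add: in_keys_iff)
    then have "lookup (m + single v n) v \<le> (\<Sum>m\<in>keys f. lookup m v)"
      by (intro member_le_sum) auto
    then show False by (simp add: lookup_add n_def)
  qed
  then have "(shift_down v ^^ n) f = 0" by (intro poly_mapping_eqI) (simp add: lookup_shift_down_funpow)
  then show ?thesis by blast
qed

text \<open>A factor free of \<open>v\<close> affects neither the divisibility of a term by
  \<open>v\<close> nor the quotient, so \<open>shift_down v\<close> is linear over such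
  factors.\<close>

lemma shift_down_mult_free:
  fixes s h :: "('v, 'k::field) mpoly"
  assumes free: "\<And>m. m \<in> keys h \<Longrightarrow> lookup m v = 0"
  shows "shift_down v (s * h) = shift_down v s * h"
proof -
  have 1: "shift_down v (single t c * h) = shift_down v (single t c) * h" for t :: "'v \<Rightarrow>\<^sub>0 nat" and c
  proof (cases "lookup t v")
    case 0
    have "shift_down v (single t c) = 0"
    proof (rule poly_mapping_eqI)
      fix m
      have "t \<noteq> m + single v 1" using 0 by (auto simp: lookup_add)
      then show "lookup (shift_down v (single t c)) m = lookup 0 m"
        by (simp add: lookup_shift_down lookup_single)
    qed
    moreover have "shift_down v (single t c * h) = 0"
    proof (rule poly_mapping_eqI)
      fix m
      have "m + single v 1 \<notin> keys (single t c * h)"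
      proof
        assume "m + single v 1 \<in> keys (single t c * h)"
        then obtain b where "b \<in> keys h" "m + single v 1 = t + b" using keys_single_times by blast
        then have "lookup (m + single v 1) v = lookup t v + lookup b v" by (simp add: lookup_add)
        then show False using free[OF \<open>b \<in> keys h\<close>] 0 by (simp add: lookup_add)
      qed
      then show "lookup (shift_down v (single t c * h)) m = lookup 0 m"
        by (simp add: lookup_shift_down in_keys_iff)
    qed
    ultimately show ?thesis by simp
  next
    case (Suc n)
    define t' where "t' = t - single v 1"
    have t: "t = single v 1 + t'"
      by (rule poly_mapping_eqI) (use Suc in \<open>auto simp: t'_def lookup_add lookup_minus lookup_single when_def\<close>)
    have "single t c = variable v * single t' c" by (simp add: variable_def t mult_single)
    then show ?thesis by (simp add: mult.assoc shift_down_variable)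
  qed
  have "shift_down v (s * h) = shift_down v ((\<Sum>m\<in>keys s. single m (lookup s m)) * h)"
    by (simp add: sum_singles)
  also have "\<dots> = (\<Sum>m\<in>keys s. shift_down v (single m (lookup s m))) * h"
    by (simp add: sum_distrib_right shift_down_sum 1)
  also have "\<dots> = shift_down v s * h"
    by (simp add: shift_down_sum[symmetric] sum_singles)
  finally show ?thesis .
qed

lemma shift_down_funpow_add: "(shift_down v ^^ n) (f + g) = (shift_down v ^^ n) f + (shift_down v ^^ n) g"
  by (rule poly_mapping_eqI) (simp add: lookup_shift_down_funpow lookup_add)

lemma shift_down_funpow_diff: "(shift_down v ^^ n) (f - g) = (shift_down v ^^ n) f - (shift_down v ^^ n) g"
  by (rule poly_mapping_eqI) (simp add: lookup_shift_down_funpow lookup_minus)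

lemma shift_down_funpow_0 [simp]: "(shift_down v ^^ n) 0 = 0"
  by (rule poly_mapping_eqI) (simp add: lookup_shift_down_funpow)

lemma shift_down_funpow_sum: "(shift_down v ^^ n) (sum f A) = (\<Sum>i\<in>A. (shift_down v ^^ n) (f i))"
  by (induction A rule: infinite_finite_induct) (auto simp: shift_down_funpow_add)

lemma shift_down_funpow_const: "(shift_down v ^^ n) (single 0 c * f) = single 0 c * (shift_down v ^^ n) f"
  by (rule poly_mapping_eqI) (simp add: lookup_shift_down_funpow lookup_const_times)

lemma shift_down_funpow_variable: "(shift_down v ^^ n) (variable v ^ n * f) = f"
  by (induction n) (auto simp: funpow_swap1 mult.assoc shift_down_variable)

text \<open>Stability under \<open>shift_down v\<close> means that \<open>J\<close> is generated by
  polynomials free of \<open>v\<close>; modulo \<open>J\<close> the ring is then polynomial in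
  \<open>v\<close>, where a nonzero polynomial in \<open>v\<close> with constant coefficients is
  regular. The induction peels off the top coefficient \<open>(shift_down v ^^ N) f\<close>.\<close>

lemma polynomial_in_variable_regular:
  fixes J :: "('v, 'k::field) mpoly set"
  assumes J: "PC.idl V J" and D: "\<And>f. f \<in> J \<Longrightarrow> shift_down v f \<in> J" and v: "v \<in> V"
    and G: "G \<in> coeffs_in constants" "G \<noteq> 0" and f: "f \<in> poly_carrier V" "poly G (variable v) * f \<in> J"
  shows "f \<in> J"
proof -
  let ?D = "shift_down v :: ('v, 'k) mpoly \<Rightarrow> _" and ?x = "variable v :: ('v, 'k) mpoly"
  have Dn: "(?D ^^ n) g \<in> J" if "g \<in> J" for n g
    using that by (induction n) (auto intro: D)
  define n where "n = degree G"
  have "\<exists>c. coeff G i = single 0 c" for i using G(1) by (auto simp: coeffs_in_def constants_def)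
  then obtain c where c: "\<And>i. coeff G i = single 0 (c i)" by metis
  have cn: "c n \<noteq> 0" using G(2) c[of n] by (auto simp: n_def)
  obtain N where "(?D ^^ N) f = 0" using shift_down_nilpotent[of v f] by auto
  then show ?thesis using f
  proof (induction N arbitrary: f)
    case 0
    then show ?case using PC.idlD(2)[OF J] by simp
  next
    case (Suc N)
    \<comment> \<open>As \<open>N + 1\<close> shifts annihilate \<open>f\<close>, only the leading
      term of \<open>G\<close> survives \<open>n + N\<close> shifts of the product.\<close>
    have "(?D ^^ (n + N)) (?x ^ i * f) = (if i = n then (?D ^^ N) f else 0)" if "i \<le> n" for i
    proof -
      have "(?D ^^ (n + N)) (?x ^ i * f) = (?D ^^ (n + N - i)) ((?D ^^ i) (?x ^ i * f))"
        using that by (metis comp_apply funpow_add le_add1 le_add_diff_inverse2 le_trans)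
      then have *: "(?D ^^ (n + N)) (?x ^ i * f) = (?D ^^ (n + N - i)) f"
        by (simp add: shift_down_funpow_variable)
      show ?thesis
      proof (cases "i = n")
        case False
        then have "n + N - i = (n - Suc i) + Suc N" using that by simp
        then have "(?D ^^ (n + N - i)) f = (?D ^^ (n - Suc i)) ((?D ^^ Suc N) f)"
          by (simp only: funpow_add comp_apply)
        then show ?thesis using * False Suc.prems(1) by simp
      qed (use * in simp)
    qed
    note 1 = this
    have "(?D ^^ (n + N)) (poly G ?x * f) = (\<Sum>i\<le>n. single 0 (c i) * (?D ^^ (n + N)) (?x ^ i * f))"
      by (simp add: poly_altdef n_def[symmetric] c sum_distrib_right shift_down_funpow_sum mult.assoc
          shift_down_funpow_const)
    also have "\<dots> = (\<Sum>i\<le>n. if i = n then single 0 (c i) * (?D ^^ N) f else 0)"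
      by (intro sum.cong) (auto simp: 1)
    also have "\<dots> = single 0 (c n) * (?D ^^ N) f" by simp
    finally have "single 0 (c n) * (?D ^^ N) f \<in> J" using Dn[OF Suc.prems(3)] by metis
    then have DN: "(?D ^^ N) f \<in> J" using const_unit[OF J _ cn] by blast
    define g where "g = ?x ^ N * (?D ^^ N) f"
    have xN: "?x ^ N \<in> poly_carrier V" using variable_in_carrier[OF v] by (rule PC.power_in)
    have g: "g \<in> J" unfolding g_def using PC.idlD(4)[OF J xN DN] .
    have gS: "g \<in> poly_carrier V" using g PC.idlD(8)[OF J] by blast
    have "(?D ^^ N) (f - g) = 0" by (simp add: g_def shift_down_funpow_diff shift_down_funpow_variable)
    moreover have GS: "poly G ?x \<in> poly_carrier V"
      using G(1) constants_subset[of V] variable_in_carrier[OF v]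
      by (intro PC.poly_in) (auto simp: coeffs_in_def)
    have "poly G ?x * (f - g) \<in> J"
      using Suc.prems(3) PC.idlD(4)[OF J GS g] PC.idlD(7)[OF J] by (simp add: right_diff_distrib)
    ultimately have "f - g \<in> J" using Suc.IH Suc.prems(2) gS by blast
    then show ?case using PC.idlD(3)[OF J _ g, of "f - g"] by simp
  qed
qed

lemma (in relative_ring) ext_cong:
  assumes I: "idl I" and y: "y \<in> S" "y' \<in> S" "y - y' \<in> I"
  shows "ext I y = ext I y'"
proof -
  have "ext I y \<subseteq> ext I y'" if y: "y \<in> S" "y' \<in> S" "y - y' \<in> I" for y y'
  proof (rule ext_least)
    show i: "idl (ext I y')" using ext_idl[OF I y(2)] .
    show "I \<subseteq> ext I y'" by (rule ext_superset)
    then show "y \<in> ext I y'" using y(3) ext_mem[OF I, of y'] idl_diff_cong[OF i, of y y'] by blast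
  qed
  from this[OF y] this[OF y(2,1)] show ?thesis using idlD(6)[OF I y(3)] by simp
qed

lemma polynomial_variable_free:
  assumes "G \<in> coeffs_in constants" "w \<noteq> v" "m \<in> keys (poly G (variable w))"
  shows "lookup m v = 0"
proof -
  have "poly G (variable w) = (\<Sum>i\<le>degree G. coeff G i * single (single w i) 1)"
    by (simp add: poly_altdef variable_power)
  then obtain i where "m \<in> keys (coeff G i * single (single w i) 1)" using keys_sum assms(3) by fastforce
  moreover obtain c where "coeff G i = single 0 c" using assms(1) by (auto simp: coeffs_in_def constants_def)
  ultimately have "m \<in> keys (single (single w i) c)" by (simp add: mult_single)
  then show ?thesis using assms(2) by (auto simp: lookup_single split: if_splits)
qed

text \<open>Modulo the prime of \<open>F\<close> the elements are polynomials in distinct variables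
  \<open>w i\<close> of \<open>F\<close>. The ideal of the first \<open>k\<close> of them is
  therefore stable under \<open>shift_down\<close> for each remaining variable of \<open>F\<close>,
  and \<open>polynomial_in_variable_regular\<close> applies.\<close>

lemma simplex_weakly_regular:
  fixes y :: "nat \<Rightarrow> ('v, 'k::field) mpoly"
  assumes F: "F \<subseteq> V" and w: "inj_on w {..<d}" "w ` {..<d} \<subseteq> F"
    and G: "\<And>i. i < d \<Longrightarrow> G i \<in> coeffs_in constants \<and> G i \<noteq> 0"
    and y: "\<And>i. i < d \<Longrightarrow> y i \<in> poly_carrier V"
      "\<And>i. i < d \<Longrightarrow> y i - poly (G i) (variable (w i)) \<in> mono_ideal V (Pow F)"
  shows "PC.weakly_regular V (mono_ideal V (Pow F)) (map y [0..<d])"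
proof -
  let ?S = "poly_carrier V :: ('v, 'k) mpoly set"
  let ?P = "mono_ideal V (Pow F) :: ('v, 'k) mpoly set"
  let ?J = "\<lambda>k. foldl (PC.ext V) ?P (map y [0..<k])"
  have P: "PC.idl V ?P" by (rule mono_ideal_idl) auto
  have J: "PC.idl V (?J k)" if "k \<le> d" for k using that y(1) by (intro PC.exts_idl[OF P]) auto
  have PJ: "?P \<subseteq> ?J k" for k by (rule PC.exts_superset)
  have wV: "w i \<in> V" if "i < d" for i using w F that by blast
  have g: "poly (G i) (variable (w i)) \<in> ?S" if "i < d" for i
    using G[OF that] constants_subset[of V] variable_in_carrier[OF wV[OF that]]
    by (intro PC.poly_in) (auto simp: coeffs_in_def)
  have shift: "shift_down v f \<in> ?J k" if "k \<le> d" "v \<in> F" "v \<notin> w ` {..<k}" "f \<in> ?J k" for k v f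
    using that
  proof (induction k arbitrary: f)
    case 0
    then show ?case by (force simp: mono_ideal_def keys_shift_down keys_plus_nat intro: shift_down_in)
  next
    case (Suc k)
    have k: "k < d" "k \<le> d" using Suc.prems by auto
    have eq: "?J (Suc k) = PC.ext V (?J k) (poly (G k) (variable (w k)))"
      using PC.ext_cong[OF J[OF k(2)] y(1)[OF k(1)] g[OF k(1)]] y(2)[OF k(1)] PJ by auto
    obtain i s where f: "i \<in> ?J k" "s \<in> ?S" "f = i + s * poly (G k) (variable (w k))"
      using Suc.prems(4) unfolding eq by (meson PC.extE)
    have "v \<noteq> w k" using Suc.prems by auto
    then have "shift_down v f = shift_down v i + shift_down v s * poly (G k) (variable (w k))"
      using f(3) polynomial_variable_free[of "G k" "w k" v] G[OF k(1)]
      by (simp add: shift_down_add shift_down_mult_free)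
    moreover have "v \<notin> w ` {..<k}" using Suc.prems(3) by auto
    then have "shift_down v i \<in> ?J k" using Suc.IH[OF k(2) Suc.prems(2)] f by auto
    ultimately show ?case unfolding eq using f(2) shift_down_in by (metis PC.extI)
  qed
  have "f \<in> ?J k" if k: "k < d" and f: "f \<in> ?S" "y k * f \<in> ?J k" for k f
  proof (rule polynomial_in_variable_regular[OF J])
    show "k \<le> d" using k by simp
    show "w k \<in> V" using wV k .
    show "G k \<in> coeffs_in constants" "G k \<noteq> 0" using G k by auto
    show "f \<in> ?S" by fact
    have "y k - poly (G k) (variable (w k)) \<in> ?J k" using PJ y(2)[OF k] by blast
    then have "(y k - poly (G k) (variable (w k))) * f \<in> ?J k" using PC.idlD(5)[OF J f(1)] k by auto
    then have "y k * f - poly (G k) (variable (w k)) * f \<in> ?J k" by (simp add: left_diff_distrib)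
    then show "poly (G k) (variable (w k)) * f \<in> ?J k" using PC.idl_diff_cong[OF J] f(2) k by auto
    show "shift_down (w k) g \<in> ?J k" if "g \<in> ?J k" for g
    proof (rule shift[OF _ _ _ that])
      show "w k \<notin> w ` {..<k}"         using inj_onD[OF w(1), of k] k by fastforce
    qed (use k w in auto)
  qed
  then show ?thesis unfolding PC.weakly_regular_nth by (auto simp: take_map)
qed

section \<open>Shellings\<close>

text \<open>The condition of \<open>shellable\<close> freed of dimension: the earlier facets meet
  \<open>Fs ! i\<close> in a complex generated by sets that lack a single vertex of
  \<open>Fs ! i\<close>.\<close>

definition shelling :: "'v set list \<Rightarrow> bool" where
  "shelling Fs \<longleftrightarrow> (\<forall>i<length Fs. \<forall>j<i. \<exists>k<i. \<exists>v\<in>Fs ! i. v \<notin> Fs ! j \<and> Fs ! i - {v} \<subseteq> Fs ! k)"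

lemma shelling_snoc:
  "shelling (Fs @ [F]) \<longleftrightarrow> shelling Fs \<and>
     (\<forall>G\<in>set Fs. \<exists>H\<in>set Fs. \<exists>v\<in>F. v \<notin> G \<and> F - {v} \<subseteq> H)" (is "?L \<longleftrightarrow> ?R")
proof -
  define Q where "Q Gs i \<longleftrightarrow> (\<forall>j<i. \<exists>k<i. \<exists>v\<in>Gs ! i. v \<notin> Gs ! j \<and> Gs ! i - {v} \<subseteq> Gs ! k)"
    for Gs :: "'a set list" and i
  have "?L \<longleftrightarrow> Q (Fs @ [F]) (length Fs) \<and> (\<forall>i<length Fs. Q (Fs @ [F]) i)"
    unfolding shelling_def length_append_singleton All_less_Suc Q_def by blast
  moreover have "Q (Fs @ [F]) i \<longleftrightarrow> Q Fs i" if "i < length Fs" for i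
    using that by (simp add: Q_def nth_append cong: conj_cong)
  moreover have "Q (Fs @ [F]) (length Fs) \<longleftrightarrow>
      (\<forall>j<length Fs. \<exists>k<length Fs. \<exists>v\<in>F. v \<notin> Fs ! j \<and> F - {v} \<subseteq> Fs ! k)"
    by (simp add: Q_def nth_append cong: conj_cong)
  ultimately have "?L \<longleftrightarrow> (\<forall>i<length Fs. \<forall>j<i. \<exists>k<i. \<exists>v\<in>Fs ! i. v \<notin> Fs ! j \<and> Fs ! i - {v} \<subseteq> Fs ! k) \<and>
    (\<forall>j<length Fs. \<exists>k<length Fs. \<exists>v\<in>F. v \<notin> Fs ! j \<and> F - {v} \<subseteq> Fs ! k)"
    unfolding Q_def by auto
  moreover have "(\<exists>H\<in>set Fs. Q H) \<longleftrightarrow> (\<exists>k<length Fs. Q (Fs ! k))" for Q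
    by (metis in_set_conv_nth)
  ultimately show ?thesis by (simp add: shelling_def all_set_conv_all_nth)
qed

definition squarefree_mono :: "'v set \<Rightarrow> ('v \<Rightarrow>\<^sub>0 nat)" where
  "squarefree_mono R = (\<Sum>v\<in>R. single v 1)"

lemma lookup_squarefree_mono: "finite R \<Longrightarrow> lookup (squarefree_mono R) v = (if v \<in> R then 1 else 0)"
  by (simp add: squarefree_mono_def lookup_sum lookup_single when_def)

lemma keys_squarefree_mono: "finite R \<Longrightarrow> keys (squarefree_mono R) = R"
  by (auto simp: in_keys_iff lookup_squarefree_mono split: if_splits)

lemma squarefree_mono_dvd:
  assumes "finite R" "R \<subseteq> keys m"
  shows "m = (m - squarefree_mono R) + squarefree_mono R"
proof (rule poly_mapping_eqI)
  fix v
  have "v \<in> R \<Longrightarrow> lookup m v \<ge> 1" using assms(2) by (auto simp: in_keys_iff Suc_le_eq)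
  then show "lookup m v = lookup (m - squarefree_mono R + squarefree_mono R) v"
    by (auto simp: lookup_add lookup_minus lookup_squarefree_mono assms(1))
qed

text \<open>With \<open>R\<close> the minimal new face of the last facet \<open>F\<close>, adding the monomial of \<open>R\<close> removes \<open>F\<close>,
  and dividing by it leaves the ideal of the simplex \<open>F\<close>.\<close>

lemma shelling_weakly_regular:
  fixes ys :: "('v, 'k::field) mpoly list"
  assumes V: "finite V" and "shelling Fs" "\<Union>(set Fs) \<subseteq> V" "set ys \<subseteq> poly_carrier V"
    and "\<And>F. F \<in> set Fs \<Longrightarrow> PC.weakly_regular V (mono_ideal V (Pow F)) ys"
  shows "PC.weakly_regular V (mono_ideal V (\<Union>F\<in>set Fs. Pow F)) ys"
  using assms(2-)
proof (induction Fs rule: rev_induct)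
  case Nil
  \<comment> \<open>With no facet at all the ideal is the whole ring, modulo which every sequence is
    weakly regular.\<close>
  have "PC.weakly_regular V (poly_carrier V) ys"
    using Nil(3)
  proof (induction ys)
    case (Cons y ys)
    have "PC.ext V (poly_carrier V) y \<subseteq> poly_carrier V" using Cons.prems by (auto simp: PC.ext_def)
    then have "PC.ext V (poly_carrier V) y = poly_carrier V" using PC.ext_superset by blast
    then show ?case using Cons by simp
  qed simp
  then show ?case by (simp add: mono_ideal_def)
next
  case (snoc F Fs)
  let ?\<Gamma> = "\<Union>F\<in>set Fs. Pow F" and ?\<Delta> = "\<Union>F\<in>set (Fs @ [F]). Pow F"
  define R where "R = {v \<in> F. \<exists>H\<in>set Fs. F - {v} \<subseteq> H}"
  have FV: "F \<subseteq> V" using snoc.prems by auto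
  have "finite F" using V FV by (rule finite_subset[rotated])
  then have R: "finite R" "R \<subseteq> F" "R \<subseteq> V" using FV by (auto simp: R_def)
  \<comment> \<open>The shelling condition at \<open>F\<close> gives each old face a vertex of
    \<open>R\<close> that it misses; conversely a vertex of \<open>R\<close> missing from
    \<open>G\<close> names an earlier facet that contains \<open>G\<close>.\<close>
  have new: "G \<in> ?\<Gamma> \<longleftrightarrow> \<not> R \<subseteq> G" if GF: "G \<subseteq> F" for G
  proof
    assume "G \<in> ?\<Gamma>"
    then obtain H where "H \<in> set Fs" "G \<subseteq> H" by auto
    have "\<forall>G\<in>set Fs. \<exists>H\<in>set Fs. \<exists>v\<in>F. v \<notin> G \<and> F - {v} \<subseteq> H"
      using snoc.prems(1) unfolding shelling_snoc by blast
    then obtain v where "v \<in> R" "v \<notin> H" using \<open>H \<in> set Fs\<close> unfolding R_def by blast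
    then show "\<not> R \<subseteq> G" using \<open>G \<subseteq> H\<close> by auto
  next
    assume "\<not> R \<subseteq> G"
    then obtain v where "v \<in> R" "v \<notin> G" by auto
    then obtain H where "H \<in> set Fs" "F - {v} \<subseteq> H" by (auto simp: R_def)
    then have "H \<in> set Fs" "G \<subseteq> H" using GF \<open>v \<notin> G\<close> by auto
    then show "G \<in> ?\<Gamma>" by auto
  qed
  have notin: "G \<notin> ?\<Gamma>" if "R \<subseteq> G" for G
  proof
    assume "G \<in> ?\<Gamma>"
    then have "R \<in> ?\<Gamma>" using that by auto
    then show False using new[OF R(2)] by simp
  qed
  define x where "x = (single (squarefree_mono R) 1 :: ('v, 'k) mpoly)"
  have xS: "x \<in> poly_carrier V" unfolding x_def using R by (intro single_in_carrier) (simp add: keys_squarefree_mono)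
  have i: "PC.idl V (mono_ideal V ?\<Gamma>)" "PC.idl V (mono_ideal V ?\<Delta>)" by (rule mono_ideal_idl; auto)+
  have "PC.ext V (mono_ideal V ?\<Delta>) x = mono_ideal V ?\<Gamma>"
  proof
    show "PC.ext V (mono_ideal V ?\<Delta>) x \<subseteq> mono_ideal V ?\<Gamma>"
    proof (rule PC.ext_least[OF i(1)])
      show "mono_ideal V ?\<Delta> \<subseteq> mono_ideal V ?\<Gamma>" by (auto simp: mono_ideal_def)
      show "x \<in> mono_ideal V ?\<Gamma>"
        using xS notin[of R] R by (auto simp: mono_ideal_def x_def keys_squarefree_mono)
    qed
    have e: "PC.idl V (PC.ext V (mono_ideal V ?\<Delta>) x)" by (rule PC.ext_idl[OF i(2) xS])
    show "mono_ideal V ?\<Gamma> \<subseteq> PC.ext V (mono_ideal V ?\<Delta>) x"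
    proof
      fix f :: "('v, 'k) mpoly" assume f: "f \<in> mono_ideal V ?\<Gamma>"
      show "f \<in> PC.ext V (mono_ideal V ?\<Delta>) x"
      proof (rule mono_ideal_singles[OF e])
        show "f \<in> poly_carrier V" using f by (simp add: mono_ideal_def)
        fix m assume "m \<in> keys f"
        then have m: "keys m \<notin> ?\<Gamma>" "keys m \<subseteq> V" using f by (auto simp: mono_ideal_def poly_carrier_def)
        show "single m 1 \<in> PC.ext V (mono_ideal V ?\<Delta>) x"
        proof (cases "keys m \<subseteq> F")
          case True
          then have "R \<subseteq> keys m" using new m by blast
          then have "m = (m - squarefree_mono R) + squarefree_mono R" using squarefree_mono_dvd R by blast
          then have "single m 1 = single (m - squarefree_mono R) 1 * x" by (simp add: x_def mult_single)
          moreover have "keys (m - squarefree_mono R) \<subseteq> V" using m by (auto simp: in_keys_iff lookup_minus)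
          ultimately show ?thesis
            using PC.idlD(4)[OF e] PC.ext_mem[OF i(2), of x] by (simp add: single_in_carrier)
        next
          case False
          then have "single m 1 \<in> mono_ideal V ?\<Delta>"
            using m by (auto simp: mono_ideal_def intro: single_in_carrier)
          then show ?thesis using PC.ext_superset by blast
        qed
      qed
    qed
  qed
  moreover have "PC.colon V (mono_ideal V ?\<Delta>) x = mono_ideal V (Pow F)"
  proof (rule Set.set_eqI)
    fix f :: "('v, 'k) mpoly"
    have k: "keys (f * x) = (\<lambda>m. squarefree_mono R + m) ` keys f"
      using keys_single_times[of _ "squarefree_mono R" 1 f]
      by (auto simp: x_def mult.commute[of f] in_keys_iff lookup_single_times)
    have old: "keys (squarefree_mono R + m) \<in> ?\<Delta> \<longleftrightarrow> keys m \<subseteq> F" for m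
    proof -
      have "R \<union> keys m \<notin> ?\<Gamma>" by (rule notin) auto
      then show ?thesis using R by (auto simp: keys_plus_nat keys_squarefree_mono)
    qed
    have "f \<in> PC.colon V (mono_ideal V ?\<Delta>) x \<longleftrightarrow> f \<in> poly_carrier V \<and> f * x \<in> poly_carrier V \<and>
        (\<forall>m\<in>keys f. keys (squarefree_mono R + m) \<notin> ?\<Delta>)"
      by (simp add: PC.colon_def mono_ideal_def k)
    also have "\<dots> \<longleftrightarrow> f \<in> mono_ideal V (Pow F)"
      unfolding old using xS by (auto simp: mono_ideal_def PC.mult_in)
    finally show "f \<in> PC.colon V (mono_ideal V ?\<Delta>) x \<longleftrightarrow> f \<in> mono_ideal V (Pow F)" .
  qed
  moreover have "PC.weakly_regular V (mono_ideal V ?\<Gamma>) ys"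
    using snoc by (auto simp: shelling_snoc)
  moreover have "PC.weakly_regular V (mono_ideal V (Pow F)) ys" using snoc.prems by auto
  ultimately show ?case using PC.weakly_regular_extension[OF i(2) xS snoc.prems(3)] by simp
qed

section \<open>Dimension\<close>

text \<open>Gaussian elimination with more unknowns \<open>A\<close> than equations
  \<open>B\<close>: \<open>a0\<close> is a pivot for the equation \<open>b\<close>, \<open>H\<close>
  the system with that unknown eliminated, and \<open>- s\<close> the value that the equation
  \<open>b\<close> forces on it.\<close>

lemma homogeneous_system:
  fixes F :: "'a \<Rightarrow> 'b \<Rightarrow> 'k::field"
  assumes "finite B" "finite A" "card B < card A"
  shows "\<exists>c. (\<exists>a\<in>A. c a \<noteq> 0) \<and> (\<forall>b\<in>B. (\<Sum>a\<in>A. c a * F a b) = 0)"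
  using assms
proof (induction B arbitrary: A F rule: finite_induct)
  case empty
  then have "A \<noteq> {}" by auto
  then show ?case by (intro exI[of _ "\<lambda>_. 1"]) auto
next
  case (insert b B)
  show ?case
  proof (cases "\<forall>a\<in>A. F a b = 0")
    case True
    obtain c where "\<exists>a\<in>A. c a \<noteq> 0" "\<forall>b\<in>B. (\<Sum>a\<in>A. c a * F a b) = 0"
      using insert.IH[of A F] insert.prems insert.hyps by auto
    then show ?thesis using True by (intro exI[of _ c]) auto
  next
    case False
    then obtain a0 where a0: "a0 \<in> A" "F a0 b \<noteq> 0" by auto
    let ?A = "A - {a0}"
    define H where "H a x = F a x - F a b / F a0 b * F a0 x" for a x
    have "card B < card ?A" using insert a0 by simp
    then obtain c where c: "\<exists>a\<in>?A. c a \<noteq> 0" "\<forall>b\<in>B. (\<Sum>a\<in>?A. c a * H a b) = 0"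
      using insert.IH[of ?A H] insert.prems by auto
    define s where "s = (\<Sum>a\<in>?A. c a * F a b) / F a0 b"
    define e where "e = c(a0 := - s)"
    have split: "(\<Sum>a\<in>A. e a * F a x) = (\<Sum>a\<in>?A. c a * F a x) - s * F a0 x" for x
    proof -
      have "(\<Sum>a\<in>?A. e a * F a x) = (\<Sum>a\<in>?A. c a * F a x)" by (intro sum.cong) (auto simp: e_def)
      then show ?thesis using sum.remove[OF insert.prems(1) a0(1), of "\<lambda>a. e a * F a x"] by (simp add: e_def)
    qed
    have sH: "(\<Sum>a\<in>A. e a * F a x) = (\<Sum>a\<in>?A. c a * H a x)" for x
    proof -
      have "(\<Sum>a\<in>?A. c a * H a x) = (\<Sum>a\<in>?A. c a * F a x) - (\<Sum>a\<in>?A. c a * F a b * (F a0 x / F a0 b))"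
        by (simp add: H_def right_diff_distrib sum_subtractf mult.assoc mult.commute[of "F a0 x"])
      also have "(\<Sum>a\<in>?A. c a * F a b * (F a0 x / F a0 b)) = (\<Sum>a\<in>?A. c a * F a b) * (F a0 x / F a0 b)"
        by (simp only: sum_distrib_right)
      also have "\<dots> = s * F a0 x" by (simp add: s_def)
      finally show ?thesis by (simp add: split)
    qed
    have "(\<Sum>a\<in>A. e a * F a b) = 0" using a0(2) by (simp add: split s_def)
    moreover have "\<exists>a\<in>A. e a \<noteq> 0" using c(1) by (auto simp: e_def)
    ultimately show ?thesis using c(2) sH by (intro exI[of _ e]) auto
  qed
qed

text \<open>A relation is read from its lexicographically smallest term: successively cancelling
  \<open>f i \<notin> q i\<close> and reducing modulo \<open>f i \<in> q (Suc i)\<close> leaves a nonzero constant in a proper ideal.\<close>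

lemma prime_chain_independent:
  fixes q :: "nat \<Rightarrow> ('v, 'k::field) mpoly set"
  assumes q: "\<And>i. i \<le> Suc d \<Longrightarrow> PC.prime_idl V (q i)" and le: "\<And>i. i \<le> d \<Longrightarrow> q i \<subseteq> q (Suc i)"
    and f: "\<And>i. i \<le> d \<Longrightarrow> f i \<in> q (Suc i)" "\<And>i. i \<le> d \<Longrightarrow> f i \<notin> q i"
    and "i \<le> Suc d" "finite X" "inj_on (\<lambda>\<alpha>. restrict \<alpha> {i..d}) X"
    and "(\<Sum>\<alpha>\<in>X. single 0 (c \<alpha>) * (\<Prod>j\<in>{i..d}. f j ^ \<alpha> j)) \<in> q i"
  shows "\<forall>\<alpha>\<in>X. c \<alpha> = 0"
  using assms(5-)
proof (induction i arbitrary: X rule: inc_induct)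
  case base
  show ?case
  proof
    fix \<alpha> assume "\<alpha> \<in> X"
    \<comment> \<open>The interval \<open>{Suc d..d}\<close> is empty, so injectivity of the
      restrictions leaves a single term.\<close>
    then have "X = {\<alpha>}" using base by (auto simp: inj_on_def)
    then have "single 0 (c \<alpha>) \<in> q (Suc d)" using base by simp
    then show "c \<alpha> = 0" using const_in_proper_idl q by (auto simp: PC.prime_idl_def)
  qed
next
  case (step n X)
  let ?S = "poly_carrier V :: ('v, 'k) mpoly set"
  have n: "n \<le> d" using step.hyps by simp
  have qn: "PC.prime_idl V (q n)" and qS: "PC.prime_idl V (q (Suc n))" using q n by auto
  have qi: "PC.idl V (q n)" "PC.idl V (q (Suc n))" using qn qS by (auto simp: PC.prime_idl_def)
  have fS: "f j \<in> ?S" if "j \<le> d" for j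
    using f(1)[OF that] q[of "Suc j"] that by (auto simp: PC.prime_idl_def PC.idl_def)
  define P where "P \<alpha> = (\<Prod>j\<in>{Suc n..d}. f j ^ \<alpha> j)" for \<alpha>
  have PS: "P \<alpha> \<in> ?S" for \<alpha> unfolding P_def using fS by (intro PC.prod_in) auto
  have prod: "(\<Prod>j\<in>{n..d}. f j ^ \<alpha> j) = f n ^ \<alpha> n * P \<alpha>" for \<alpha>
    using n by (simp add: P_def prod.atLeast_Suc_atMost)
  show ?case
  proof (rule ccontr)
    assume nonzero: "\<not> (\<forall>\<alpha>\<in>X. c \<alpha> = 0)"
    define X' where "X' = {\<alpha>\<in>X. c \<alpha> \<noteq> 0}"
    have X': "finite X'" "X' \<noteq> {}" using nonzero step.prems by (auto simp: X'_def)
    \<comment> \<open>The least exponent of \<open>f n\<close> among the nonzero terms: once this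
      power is cancelled, only the terms in \<open>Y\<close> remain modulo
      \<open>f n\<close>.\<close>
    define a where "a = Min ((\<lambda>\<alpha>. \<alpha> n) ` X')"
    have a: "a \<le> \<alpha> n" if "\<alpha> \<in> X'" for \<alpha> using that X' by (auto simp: a_def)
    define Y where "Y = {\<alpha>\<in>X'. \<alpha> n = a}"
    have "a \<in> (\<lambda>\<alpha>. \<alpha> n) ` X'" unfolding a_def using X' by (intro Min_in) auto
    then have Y: "Y \<noteq> {}" "Y \<subseteq> X'" "finite Y" using X' by (auto simp: Y_def)
    define T where "T \<alpha> = single 0 (c \<alpha>) * (f n ^ (\<alpha> n - a) * P \<alpha>)" for \<alpha>
    have TS: "T \<alpha> \<in> ?S" for \<alpha> unfolding T_def using PS fS[OF n]
      by (intro PC.mult_in const_in_carrier PC.power_in)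
    have "(\<Sum>\<alpha>\<in>X. single 0 (c \<alpha>) * (\<Prod>j\<in>{n..d}. f j ^ \<alpha> j)) =
        (\<Sum>\<alpha>\<in>X'. single 0 (c \<alpha>) * (\<Prod>j\<in>{n..d}. f j ^ \<alpha> j))"
      by (rule sum.mono_neutral_right) (use step.prems in \<open>auto simp: X'_def\<close>)
    also have "\<dots> = (\<Sum>\<alpha>\<in>X'. f n ^ a * T \<alpha>)"
    proof (rule sum.cong[OF refl])
      fix \<alpha> assume "\<alpha> \<in> X'"
      then have "f n ^ \<alpha> n = f n ^ a * f n ^ (\<alpha> n - a)" using a by (simp flip: power_add)
      then show "single 0 (c \<alpha>) * (\<Prod>j\<in>{n..d}. f j ^ \<alpha> j) = f n ^ a * T \<alpha>"
        by (simp add: prod T_def mult_ac)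
    qed
    also have "\<dots> = f n ^ a * (\<Sum>\<alpha>\<in>X'. T \<alpha>)" by (simp add: sum_distrib_left)
    finally have "f n ^ a * (\<Sum>\<alpha>\<in>X'. T \<alpha>) \<in> q n" using step.prems(3) by simp
    moreover have "f n ^ a \<notin> q n" using PC.prime_idl_power[OF qn fS[OF n]] f(2)[OF n] by blast
    moreover have "(\<Sum>\<alpha>\<in>X'. T \<alpha>) \<in> ?S" using TS by (intro PC.sum_in)
    ultimately have "(\<Sum>\<alpha>\<in>X'. T \<alpha>) \<in> q n"
      using qn fS[OF n] PC.power_in[of "f n" V a] unfolding PC.prime_idl_def by blast
    then have 1: "(\<Sum>\<alpha>\<in>X'. T \<alpha>) \<in> q (Suc n)" using le[OF n] by blast
    have "T \<alpha> \<in> q (Suc n)" if "\<alpha> \<in> X' - Y" for \<alpha>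
    proof -
      have "\<alpha> n - a \<noteq> 0" using a[of \<alpha>] that by (auto simp: Y_def)
      then obtain k where k: "\<alpha> n - a = Suc k" by (meson not0_implies_Suc)
      have "T \<alpha> = (single 0 (c \<alpha>) * (f n ^ k * P \<alpha>)) * f n" by (simp add: T_def k mult_ac)
      moreover have "single 0 (c \<alpha>) * (f n ^ k * P \<alpha>) \<in> ?S"
        using PS fS[OF n] by (intro PC.mult_in const_in_carrier PC.power_in)
      ultimately show ?thesis using PC.idlD(4)[OF qi(2) _ f(1)[OF n]] by metis
    qed
    then have "(\<Sum>\<alpha>\<in>X'-Y. T \<alpha>) \<in> q (Suc n)" by (intro PC.idl_sum[OF qi(2)])
    then have sY: "(\<Sum>\<alpha>\<in>Y. T \<alpha>) \<in> q (Suc n)"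
      using PC.idlD(7)[OF qi(2) 1] sum.subset_diff[OF Y(2) X'(1), of T] by fastforce
    have TY: "(\<Sum>\<alpha>\<in>Y. T \<alpha>) = (\<Sum>\<alpha>\<in>Y. single 0 (c \<alpha>) * (\<Prod>j\<in>{Suc n..d}. f j ^ \<alpha> j))"
      by (intro sum.cong) (auto simp: T_def P_def Y_def)
    have inj: "inj_on (\<lambda>\<alpha>. restrict \<alpha> {Suc n..d}) Y"
    proof (rule inj_onI)
      fix \<alpha> \<beta> assume ab: "\<alpha> \<in> Y" "\<beta> \<in> Y" "restrict \<alpha> {Suc n..d} = restrict \<beta> {Suc n..d}"
      have "restrict \<alpha> {n..d} = restrict \<beta> {n..d}"
      proof
        fix j
        show "restrict \<alpha> {n..d} j = restrict \<beta> {n..d} j"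
          using fun_cong[OF ab(3), of j] ab(1,2) by (cases "j = n") (auto simp: Y_def restrict_def)
      qed
      moreover have "\<alpha> \<in> X" "\<beta> \<in> X" using ab(1,2) by (auto simp: Y_def X'_def)
      ultimately show "\<alpha> = \<beta>" by (rule inj_onD[OF step.prems(2)])
    qed
    have "\<forall>\<alpha>\<in>Y. c \<alpha> = 0" by (rule step.IH[OF Y(3) inj sY[unfolded TY]])
    then show False using Y(1,2) by (auto simp: X'_def)
  qed
qed

lemma card_bounded_monomials:
  assumes "finite F"
  shows "finite {m :: 'v \<Rightarrow>\<^sub>0 nat. keys m \<subseteq> F \<and> (\<forall>v. lookup m v \<le> E)}" (is "finite ?B")
    "card {m :: 'v \<Rightarrow>\<^sub>0 nat. keys m \<subseteq> F \<and> (\<forall>v. lookup m v \<le> E)} \<le> (E + 1) ^ card F"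
proof -
  let ?r = "\<lambda>m :: 'v \<Rightarrow>\<^sub>0 nat. restrict (lookup m) F"
  have inj: "inj_on ?r ?B"
  proof (rule inj_onI)
    fix m m' :: "'v \<Rightarrow>\<^sub>0 nat" assume m: "m \<in> ?B" "m' \<in> ?B" "?r m = ?r m'"
    show "m = m'"
    proof (rule poly_mapping_eqI)
      fix v
      show "lookup m v = lookup m' v"
      proof (cases "v \<in> F")
        case True
        then show ?thesis using fun_cong[OF m(3), of v] by simp
      next
        case False
        then have "v \<notin> keys m" "v \<notin> keys m'" using m(1,2) by auto
        then show ?thesis by (simp add: in_keys_iff)
      qed
    qed
  qed
  have sub: "?r ` ?B \<subseteq> PiE F (\<lambda>_. {..E})" by auto
  have fin: "finite (PiE F (\<lambda>_. {..E}))" using assms by (intro finite_PiE) auto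
  show "finite ?B" using inj_on_finite[OF inj sub fin] .
  show "card ?B \<le> (E + 1) ^ card F"
    using card_inj_on_le[OF inj sub fin] by (simp add: card_PiE[OF assms])
qed

text \<open>A chain longer than \<open>d\<close> provides \<open>d + 1\<close> polynomials, one from
  each successive difference. Their products with exponents below \<open>M\<close> number
  \<open>M ^ (d + 1)\<close>, while the monomials supported on a face and bounded accordingly number
  at most a constant times \<open>M ^ d\<close>. Hence a nontrivial combination lies in the ideal,
  against \<open>prime_chain_independent\<close>.\<close>

theorem dimension_bound:
  assumes V: "finite V" and \<Gamma>: "\<And>F. F \<in> \<Gamma> \<Longrightarrow> F \<subseteq> V" "\<And>F. F \<in> \<Gamma> \<Longrightarrow> card F \<le> d"
    and chain: "PC.prime_chain V (mono_ideal V \<Gamma> :: ('v, 'k::field) mpoly set) h q"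
  shows "h \<le> d"
proof (rule ccontr)
  assume "\<not> h \<le> d"
  then have h: "Suc d \<le> h" by simp
  let ?S = "poly_carrier V :: ('v, 'k) mpoly set"
  have q: "PC.prime_idl V (q i)" if "i \<le> Suc d" for i using that chain h by (auto simp: PC.prime_chain_def)
  have lt: "q i \<subset> q (Suc i)" if "i \<le> d" for i using that chain h by (auto simp: PC.prime_chain_def)
  then have "\<forall>i. \<exists>x. i \<le> d \<longrightarrow> x \<in> q (Suc i) \<and> x \<notin> q i" by blast
  then obtain f where f: "\<And>i. i \<le> d \<Longrightarrow> f i \<in> q (Suc i)" "\<And>i. i \<le> d \<Longrightarrow> f i \<notin> q i" by metis
  have fS: "f j \<in> ?S" if "j \<le> d" for j
    using f(1)[OF that] q[of "Suc j"] that by (auto simp: PC.prime_idl_def PC.idl_def)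
  define D where "D = (\<Sum>i\<le>d. \<Sum>m\<in>keys (f i). \<Sum>v\<in>V. lookup m v)"
  have D: "lookup m v \<le> D" if m: "i \<le> d" "m \<in> keys (f i)" for i m v
  proof (cases "v \<in> V")
    case True
    have "lookup m v \<le> (\<Sum>v\<in>V. lookup m v)" by (rule member_le_sum) (use True V in auto)
    also have "\<dots> \<le> (\<Sum>m\<in>keys (f i). \<Sum>v\<in>V. lookup m v)" by (rule member_le_sum) (use m in auto)
    also have "\<dots> \<le> D" unfolding D_def by (rule member_le_sum) (use m in auto)
    finally show ?thesis .
  next
    case False
    then have "v \<notin> keys m" using fS[OF m(1)] m(2) by (auto simp: poly_carrier_def)
    then show ?thesis by (simp add: in_keys_iff)
  qed
  have fin\<Gamma>: "finite \<Gamma>" using \<Gamma>(1) V by (meson Pow_iff finite_Pow_iff finite_subset subsetI)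
  \<comment> \<open>\<open>E\<close> bounds the exponents that occur in the products, and
    \<open>E + 1\<close> is at most \<open>(D * Suc d + 1) * M\<close>. So \<open>B\<close> has at
    most \<open>C * M ^ d\<close> elements, and \<open>M = C + 1\<close> yields more products than
    monomials.\<close>
  define C where "C = card \<Gamma> * (D * Suc d + 1) ^ d"
  define M where "M = C + 1"
  define E where "E = D * M * Suc d"
  define A where "A = PiE {..d} (\<lambda>_. {..<M})"
  define B where "B = {m :: 'v \<Rightarrow>\<^sub>0 nat. keys m \<in> \<Gamma> \<and> (\<forall>v. lookup m v \<le> E)}"
  define P where "P \<alpha> = (\<Prod>j\<in>{0..d}. f j ^ \<alpha> j)" for \<alpha>
  have finA: "finite A" unfolding A_def by (intro finite_PiE) auto
  have cardA: "card A = M ^ Suc d" by (simp add: A_def card_PiE)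
  have Bsub: "B \<subseteq> (\<Union>F\<in>\<Gamma>. {m. keys m \<subseteq> F \<and> (\<forall>v. lookup m v \<le> E)})" by (auto simp: B_def)
  have finU: "finite (\<Union>F\<in>\<Gamma>. {m :: 'v \<Rightarrow>\<^sub>0 nat. keys m \<subseteq> F \<and> (\<forall>v. lookup m v \<le> E)})"
    using fin\<Gamma> card_bounded_monomials(1) finite_subset[OF \<Gamma>(1) V] by (intro finite_UN_I) auto
  have finB: "finite B" using finite_subset[OF Bsub finU] .
  have "card B \<le> card (\<Union>F\<in>\<Gamma>. {m :: 'v \<Rightarrow>\<^sub>0 nat. keys m \<subseteq> F \<and> (\<forall>v. lookup m v \<le> E)})"
    by (rule card_mono[OF finU Bsub])
  also have "\<dots> \<le> (\<Sum>F\<in>\<Gamma>. card {m :: 'v \<Rightarrow>\<^sub>0 nat. keys m \<subseteq> F \<and> (\<forall>v. lookup m v \<le> E)})"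
    by (rule card_UN_le[OF fin\<Gamma>])
  also have "\<dots> \<le> (\<Sum>F\<in>\<Gamma>. (E + 1) ^ d)"
  proof (rule sum_mono)
    fix F assume F: "F \<in> \<Gamma>"
    have "(E + 1) ^ card F \<le> (E + 1) ^ d" using \<Gamma>(2)[OF F] by (intro power_increasing) auto
    then show "card {m :: 'v \<Rightarrow>\<^sub>0 nat. keys m \<subseteq> F \<and> (\<forall>v. lookup m v \<le> E)} \<le> (E + 1) ^ d"
      using card_bounded_monomials(2)[OF finite_subset[OF \<Gamma>(1)[OF F] V], of E] by linarith
  qed
  also have "\<dots> = card \<Gamma> * (E + 1) ^ d" by simp
  also have "\<dots> \<le> card \<Gamma> * ((D * Suc d + 1) * M) ^ d"
  proof -
    have "E + 1 \<le> (D * Suc d + 1) * M" by (simp add: E_def M_def algebra_simps)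
    then show ?thesis by (intro mult_left_mono power_mono) auto
  qed
  also have "\<dots> = C * M ^ d" by (simp only: C_def power_mult_distrib mult.assoc)
  also have "\<dots> < M * M ^ d" by (simp add: M_def)
  finally have "card B < card A" by (simp add: cardA)
  then obtain c where c: "\<exists>\<alpha>\<in>A. c \<alpha> \<noteq> 0" "\<forall>m\<in>B. (\<Sum>\<alpha>\<in>A. c \<alpha> * lookup (P \<alpha>) m) = 0"
    using homogeneous_system[OF finB finA, of "\<lambda>\<alpha>. lookup (P \<alpha>)"] by auto
  define p where "p = (\<Sum>\<alpha>\<in>A. single 0 (c \<alpha>) * P \<alpha>)"
  have "P \<alpha> \<in> ?S" for \<alpha> unfolding P_def using fS by (intro PC.prod_in) auto
  then have pS: "p \<in> ?S" unfolding p_def by (intro PC.sum_in PC.mult_in const_in_carrier)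
  have "keys m \<notin> \<Gamma>" if m: "m \<in> keys p" for m
  proof
    assume \<Gamma>m: "keys m \<in> \<Gamma>"
    obtain \<alpha> where \<alpha>: "\<alpha> \<in> A" "m \<in> keys (single 0 (c \<alpha>) * P \<alpha>)"
      using m keys_sum[of "\<lambda>\<alpha>. single 0 (c \<alpha>) * P \<alpha>" A] unfolding p_def by blast
    then have "m \<in> keys (P \<alpha>)" by (auto simp: in_keys_iff lookup_const_times)
    then have "lookup m v \<le> D * M * card {0..d}" for v unfolding P_def
    proof (rule keys_prod[rotated])
      fix i m assume i: "i \<in> {0..d}" "m \<in> keys (f i ^ \<alpha> i)"
      then have "lookup m v \<le> D * \<alpha> i" using keys_power[of "f i" D m] D by auto
      also have "\<dots> \<le> D * M" using \<alpha>(1) i by (intro mult_left_mono) (auto simp: A_def PiE_iff less_imp_le)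
      finally show "lookup m v \<le> D * M" .
    qed
    then have "m \<in> B" using \<Gamma>m by (simp add: B_def E_def)
    then have "lookup p m = 0" using c(2) by (simp add: p_def lookup_sum lookup_const_times)
    then show False using m by (simp add: in_keys_iff)
  qed
  then have "p \<in> mono_ideal V \<Gamma>" using pS by (simp add: mono_ideal_def)
  then have p0: "p \<in> q 0" using chain by (auto simp: PC.prime_chain_def)
  have "inj_on (\<lambda>\<alpha>. restrict \<alpha> {0..d}) A"
    by (rule inj_onI) (auto simp: A_def PiE_restrict atLeast0AtMost dest: PiE_restrict)
  then have "\<forall>\<alpha>\<in>A. c \<alpha> = 0"
    using lt finA p0 q f unfolding p_def P_def
    by (intro prime_chain_independent[where q = q and f = f and i = 0 and d = d and V = V]) auto
  then show False using c(1) by blast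
qed

section \<open>Presentations of quotient rings\<close>

text \<open>Elements of a quotient ring are cosets. A surjection from \<open>S\<close> allows
  ideals, regular sequences and chains of primes of \<open>R\<close> to be studied in
  \<open>S\<close>, modulo \<open>ker\<close>.\<close>

locale ring_presentation = relative_ring S + R: cring R
  for S :: "'r::comm_ring_1 set" and R :: "('q, 'm) ring_scheme" (structure) +
  fixes h :: "'r \<Rightarrow> 'q"
  assumes surj: "h ` S = carrier R"
    and h_add: "\<lbrakk>a \<in> S; b \<in> S\<rbrakk> \<Longrightarrow> h (a + b) = h a \<oplus> h b"
    and h_mult: "\<lbrakk>a \<in> S; b \<in> S\<rbrakk> \<Longrightarrow> h (a * b) = h a \<otimes> h b"
    and h_one: "h 1 = \<one>" and h_zero: "h 0 = \<zero>"
begin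

definition ker :: "'r set" where "ker = {s \<in> S. h s = \<zero>}"

definition pull :: "'q set \<Rightarrow> 'r set" where "pull A = {s \<in> S. h s \<in> A}"

lemma h_closed: "s \<in> S \<Longrightarrow> h s \<in> carrier R"
  using surj by blast

lemma h_uminus: "s \<in> S \<Longrightarrow> h (- s) = \<ominus> h s"
  using h_add[of "- s" s] h_closed[of s] h_closed[of "- s"] uminus_in[of s] h_zero
  by (simp add: R.minus_equality)

lemma h_diff_ker: "\<lbrakk>a \<in> S; b \<in> S; h a = h b\<rbrakk> \<Longrightarrow> a - b \<in> ker"
  using h_add[of a "- b"] h_closed[of b] h_uminus[of b] uminus_in[of b] diff_in[of a b]
  by (simp add: ker_def R.r_neg)

lemma pull_idl:
  assumes "ideal A R" shows "idl (pull A)" "ker \<subseteq> pull A" "h ` pull A = A"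
proof -
  interpret A: ideal A R by fact
  show "idl (pull A)" unfolding idl_def pull_def
    using h_zero h_closed A.I_l_closed by (auto simp: h_add h_mult A.zero_closed A.a_closed)
  show "ker \<subseteq> pull A" using A.zero_closed by (auto simp: ker_def pull_def)
  show "h ` pull A = A" using A.a_subset surj by (auto simp: pull_def)
qed

lemma push_ideal:
  assumes J: "idl J" and k: "ker \<subseteq> J" shows "ideal (h ` J) R" "pull (h ` J) = J"
proof -
  show "ideal (h ` J) R"
  proof (rule idealI)
    show "ring R" by (rule R.ring_axioms)
    show "subgroup (h ` J) (add_monoid R)"
    proof (rule R.add.subgroupI)
      show "h ` J \<subseteq> carrier R" "h ` J \<noteq> {}" using idlD(1,2)[OF J] h_closed by auto
      fix x assume "x \<in> h ` J"
      then obtain a where a: "a \<in> J" "x = h a" by auto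
      then have "h (- a) = \<ominus> x" "- a \<in> J" using h_uminus idlD(6,8)[OF J] by auto
      then show "\<ominus> x \<in> h ` J" by (metis imageI)
      fix y assume "y \<in> h ` J"
      then obtain b where b: "b \<in> J" "y = h b" by auto
      then have "h (a + b) = x \<oplus> y" "a + b \<in> J" using a h_add idlD(3,8)[OF J] by auto
      then show "x \<oplus> y \<in> h ` J" by (metis imageI)
    qed
    fix a x assume "a \<in> h ` J" "x \<in> carrier R"
    then obtain i where i: "i \<in> J" "a = h i" by auto
    obtain s where s: "s \<in> S" "x = h s" using \<open>x \<in> carrier R\<close> surj by auto
    note eqs = i s
    from eqs have "x \<otimes> a = h (s * i)" "s * i \<in> J" using h_mult idlD[OF J] by auto
    then show "x \<otimes> a \<in> h ` J" "a \<otimes> x \<in> h ` J"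
      using \<open>a \<in> h ` J\<close> \<open>x \<in> carrier R\<close> eqs h_closed idlD(8)[OF J] by (auto simp: R.m_comm)
  qed
  show "pull (h ` J) = J"
  proof
    show "pull (h ` J) \<subseteq> J"
    proof
      fix s assume "s \<in> pull (h ` J)"
      then obtain j where "s \<in> S" "j \<in> J" "h s = h j" by (auto simp: pull_def)
      then have "s - j \<in> J" using h_diff_ker k idlD(8)[OF J] by blast
      then show "s \<in> J" using idlD(3)[OF J _ \<open>j \<in> J\<close>, of "s - j"] by simp
    qed
    show "J \<subseteq> pull (h ` J)" using idlD(1)[OF J] by (auto simp: pull_def)
  qed
qed

lemma ker_idl: "idl ker"
proof -
  have "ker = pull {\<zero>}" by (auto simp: ker_def pull_def)
  then show ?thesis using pull_idl(1)[OF R.zeroideal] by simp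
qed

lemma pull_mono_iff: "A \<subseteq> carrier R \<Longrightarrow> B \<subseteq> carrier R \<Longrightarrow> pull A \<subseteq> pull B \<longleftrightarrow> A \<subseteq> B"
proof -
  assume "A \<subseteq> carrier R" "B \<subseteq> carrier R"
  then have "A = h ` pull A" using surj by (auto simp: pull_def)
  moreover have "h ` pull B \<subseteq> B" by (auto simp: pull_def)
  ultimately have "pull A \<subseteq> pull B \<Longrightarrow> A \<subseteq> B" by (metis image_mono order.trans)
  then show ?thesis by (auto simp: pull_def)
qed

lemma pull_proper: "ideal A R \<Longrightarrow> 1 \<notin> pull A \<longleftrightarrow> carrier R \<noteq> A"
  using ideal.one_imp_carrier[of A R] R.one_closed h_one by (auto simp: pull_def)

lemma pull_prime: "primeideal A R \<Longrightarrow> prime_idl (pull A)"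
proof -
  assume "primeideal A R"
  then interpret A: primeideal A R .
  show ?thesis unfolding prime_idl_def
  proof (intro conjI ballI impI)
    show "idl (pull A)" by (rule pull_idl(1)[OF A.is_ideal])
    show "1 \<notin> pull A" using pull_proper[OF A.is_ideal] A.I_notcarr by simp
    fix a b assume "a \<in> S" "b \<in> S" "a * b \<in> pull A"
    then show "a \<in> pull A \<or> b \<in> pull A" using A.I_prime[of "h a" "h b"] h_closed by (auto simp: pull_def h_mult)
  qed
qed

lemma push_prime: "prime_idl J \<Longrightarrow> ker \<subseteq> J \<Longrightarrow> primeideal (h ` J) R"
proof -
  assume J: "prime_idl J" "ker \<subseteq> J"
  then have i: "idl J" by (simp add: prime_idl_def)
  note p = push_ideal[OF i J(2)]
  show ?thesis
  proof (rule primeidealI)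
    show "ideal (h ` J) R" "cring R" using p(1) R.cring_axioms by auto
    show "carrier R \<noteq> h ` J" using pull_proper[OF p(1)] J(1) p(2) by (simp add: prime_idl_def)
    fix a b assume ab: "a \<in> carrier R" "b \<in> carrier R" "a \<otimes> b \<in> h ` J"
    obtain s where s: "s \<in> S" "a = h s" using ab(1) surj by auto
    obtain t where t: "t \<in> S" "b = h t" using ab(2) surj by auto
    note st = s(1) t(1) s(2) t(2)
    have "s * t \<in> pull (h ` J)" using ab(3) st by (auto simp: pull_def h_mult)
    then have "s \<in> J \<or> t \<in> J" using J(1) st p(2) by (auto simp: prime_idl_def)
    then show "a \<in> h ` J \<or> b \<in> h ` J" using st by auto
  qed
qed

lemma pull_maximal: "maximalideal A R \<Longrightarrow> maximal_idl (pull A)"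
proof -
  assume "maximalideal A R"
  then interpret A: maximalideal A R .
  note pa = pull_idl[OF A.is_ideal]
  show ?thesis unfolding maximal_idl_def
  proof (intro conjI allI impI)
    show "idl (pull A)" by (rule pa)
    show "1 \<notin> pull A" using pull_proper[OF A.is_ideal] A.I_notcarr by simp
    fix J assume J: "idl J" "pull A \<subseteq> J" "1 \<notin> J"
    then have "ker \<subseteq> J" using pa by auto
    note p = push_ideal[OF J(1) this]
    have "A \<subseteq> h ` J" using J(2) pa(3) by blast
    moreover have "h ` J \<subseteq> carrier R" "h ` J \<noteq> carrier R"
      using p pull_proper[OF p(1)] J(3) idlD(1)[OF J(1)] h_closed by auto
    ultimately have "h ` J = A" using A.I_maximal[OF p(1)] by blast
    then show "J = pull A" using p(2) by simp
  qed
qed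

lemma push_maximal: "maximal_idl M \<Longrightarrow> ker \<subseteq> M \<Longrightarrow> maximalideal (h ` M) R"
proof -
  assume M: "maximal_idl M" "ker \<subseteq> M"
  then have i: "idl M" by (simp add: maximal_idl_def)
  note p = push_ideal[OF i M(2)]
  show ?thesis
  proof (rule maximalidealI)
    show "ideal (h ` M) R" using p by simp
    show "carrier R \<noteq> h ` M" using pull_proper[OF p(1)] M(1) p(2) by (simp add: maximal_idl_def)
    fix J assume J: "ideal J R" "h ` M \<subseteq> J" "J \<subseteq> carrier R"
    note pj = pull_idl[OF J(1)]
    have "M \<subseteq> pull J" using J(2) idlD(1)[OF i] by (auto simp: pull_def)
    show "J = h ` M \<or> J = carrier R"
    proof (cases "1 \<in> pull J")
      case True
      then show ?thesis using pull_proper[OF J(1)] by auto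
    next
      case False
      then have "pull J = M" using M(1) pj(1) \<open>M \<subseteq> pull J\<close> by (auto simp: maximal_idl_def)
      then show ?thesis using pj(3) by simp
    qed
  qed
qed

lemma genideal_exts:
  assumes ys: "set ys \<subseteq> S"
  shows "genideal R (h ` set ys) = h ` foldl ext ker ys"
proof
  note e = exts_idl[OF ker_idl ys] exts_superset[of ker ys] exts_mem[OF ker_idl ys]
  note p = push_ideal[OF e(1,2)]
  show "genideal R (h ` set ys) \<subseteq> h ` foldl ext ker ys"
    using e(3) by (intro R.genideal_minimal[OF p(1)]) auto
  have hy: "h ` set ys \<subseteq> carrier R" using ys h_closed by auto
  note g = pull_idl[OF R.genideal_ideal[OF hy]]
  have "set ys \<subseteq> pull (genideal R (h ` set ys))" using R.genideal_self[OF hy] ys by (auto simp: pull_def)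
  then have "foldl ext ker ys \<subseteq> pull (genideal R (h ` set ys))" using exts_least[OF g(1,2)] by blast
  then show "h ` foldl ext ker ys \<subseteq> genideal R (h ` set ys)" by (auto simp: pull_def)
qed

lemma regular_sequence_iff:
  assumes ys: "set ys \<subseteq> S"
  shows "regular_sequence R (map h ys) \<longleftrightarrow> weakly_regular ker ys \<and> 1 \<notin> foldl ext ker ys"
proof -
  have sub: "set (take i ys) \<subseteq> S" for i using ys set_take_subset by fastforce
  have e: "idl (foldl ext ker (take i ys))" "ker \<subseteq> foldl ext ker (take i ys)" for i
    using exts_idl[OF ker_idl sub] exts_superset by auto
  have g: "genideal R (set (take i (map h ys))) = h ` foldl ext ker (take i ys)" for i
    using genideal_exts[OF sub[of i]] by (simp add: take_map)
  have mem: "h f \<in> h ` foldl ext ker (take i ys) \<longleftrightarrow> f \<in> foldl ext ker (take i ys)" if "f \<in> S" for f i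
    using push_ideal(2)[OF e(1,2)[of i]] that unfolding pull_def by blast
  have "(\<forall>i<length (map h ys). \<forall>y\<in>carrier R. map h ys ! i \<otimes> y \<in> genideal R (set (take i (map h ys))) \<longrightarrow>
        y \<in> genideal R (set (take i (map h ys)))) \<longleftrightarrow>
      (\<forall>i<length ys. \<forall>f\<in>S. h (ys ! i * f) \<in> h ` foldl ext ker (take i ys) \<longrightarrow> h f \<in> h ` foldl ext ker (take i ys))"
    unfolding g using ys by (auto simp: surj[symmetric] h_mult subset_iff)
  also have "\<dots> \<longleftrightarrow> weakly_regular ker ys"
  proof -
    have "ys ! i * f \<in> S" if "i < length ys" "f \<in> S" for i f using that ys by (auto simp: subset_iff)
    then show ?thesis unfolding weakly_regular_nth by (simp add: mem)
  qed
  finally have 1: "(\<forall>i<length (map h ys). \<forall>y\<in>carrier R. map h ys ! i \<otimes> y \<in> genideal R (set (take i (map h ys))) \<longrightarrow>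
        y \<in> genideal R (set (take i (map h ys)))) \<longleftrightarrow> weakly_regular ker ys" .
  have "genideal R (set (map h ys)) \<noteq> carrier R \<longleftrightarrow> 1 \<notin> foldl ext ker ys"
    using g[of "length ys"] push_ideal[OF e(1,2)[of "length ys"]]
      pull_proper[of "h ` foldl ext ker ys"] by auto
  moreover have "set (map h ys) \<subseteq> carrier R" using ys h_closed by auto
  ultimately show ?thesis unfolding regular_sequence_def 1 by auto
qed

lemma noetherian_ring_R:
  assumes noeth shows "noetherian_ring R"
proof (rule R.noetherian_ringI)
  fix I assume I: "ideal I R"
  note p = pull_idl[OF I]
  obtain X where X: "finite X" "X \<subseteq> pull I" "pull I = gen X" using assms p(1) by (auto simp: noeth_def)
  have XS: "h ` X \<subseteq> carrier R" using X(2) h_closed by (auto simp: pull_def)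
  note g = pull_idl[OF R.genideal_ideal[OF XS]]
  have "genideal R (h ` X) \<subseteq> I" using X(2) by (intro R.genideal_minimal[OF I]) (auto simp: pull_def)
  moreover have "X \<subseteq> pull (genideal R (h ` X))"
    using R.genideal_self[OF XS] X(2) by (auto simp: pull_def)
  then have "pull I \<subseteq> pull (genideal R (h ` X))" using gen_least[OF g(1)] X(3) by simp
  then have "I \<subseteq> genideal R (h ` X)" using p(3) g(3) by blast
  ultimately show "\<exists>A\<subseteq>carrier R. finite A \<and> I = genideal R A" using X(1) XS by blast
qed

lemma prime_height_eq:
  assumes p: "primeideal p R"
  shows "prime_height R p = Sup {enat n | n. \<exists>q. prime_chain ker n q \<and> q n = pull p}"
proof -
  have "(\<exists>q. (\<forall>i\<le>n. primeideal (q i) R) \<and> (\<forall>i<n. q i \<subset> q (Suc i)) \<and> q n = p) \<longleftrightarrow>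
      (\<exists>q. prime_chain ker n q \<and> q n = pull p)" (is "?L \<longleftrightarrow> ?R") for n
  proof
    assume ?L
    then obtain q where q: "\<forall>i\<le>n. primeideal (q i) R" "\<forall>i<n. q i \<subset> q (Suc i)" "q n = p" by blast
    have i: "ideal (q i) R" if "i \<le> n" for i using q(1) that by (auto simp: primeideal_def)
    have c: "q i \<subseteq> carrier R" if "i \<le> n" for i
      using additive_subgroup.a_subset[OF ideal.axioms(1)[OF i[OF that]]] .
    have "pull (q i) \<subset> pull (q (Suc i))" if "i < n" for i
      using pull_mono_iff[of "q i" "q (Suc i)"] pull_mono_iff[of "q (Suc i)" "q i"] c[of i] c[of "Suc i"] q(2) that by auto
    then have "prime_chain ker n (\<lambda>i. pull (q i))"
      using q pull_prime pull_idl(2)[OF i[of 0]] by (auto simp: prime_chain_def)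
    then show ?R using q(3) by blast
  next
    assume ?R
    then obtain q where q: "prime_chain ker n q" "q n = pull p" by blast
    have kq: "ker \<subseteq> q i" if "i \<le> n" for i
      using that
    proof (induction i)
      case (Suc i)
      then have "q i \<subset> q (Suc i)" using q(1) by (simp add: prime_chain_def)
      then show ?case using Suc by auto
    qed (use q(1) in \<open>simp add: prime_chain_def\<close>)
    have pr: "prime_idl (q i)" if "i \<le> n" for i using q(1) that by (auto simp: prime_chain_def)
    have pp: "pull (h ` q i) = q i" if "i \<le> n" for i
      using push_ideal(2)[OF _ kq] pr that by (auto simp: prime_idl_def)
    have "h ` q i \<subset> h ` q (Suc i)" if "i < n" for i
    proof -
      have "q i \<subset> q (Suc i)" using q(1) that by (simp add: prime_chain_def)
      then show ?thesis using pp[of i] pp[of "Suc i"] that by (metis Suc_leI image_mono less_imp_le_nat psubsetE psubsetI)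
    qed
    moreover have "h ` q n = p" using q(2) pull_idl(3) p by (simp add: primeideal_def)
    ultimately show ?L using push_prime[OF pr kq] by (intro exI[of _ "\<lambda>i. h ` q i"]) auto
  qed
  then show ?thesis unfolding prime_height_def by simp
qed

text \<open>The properness clause of \<open>regular_sequence\<close> disappears since all sequences
  lie in the prime \<open>p\<close>; a sequence in \<open>p\<close> lifts to one in
  \<open>pull p\<close>.\<close>

lemma ideal_depth_eq:
  assumes p: "primeideal p R"
  shows "ideal_depth R p = Sup {enat (length ys) | ys. weakly_regular ker ys \<and> set ys \<subseteq> pull p}"
proof -
  note pp = pull_idl[OF primeideal.axioms(1)[OF p]]
  have "{enat (length xs) | xs. regular_sequence R xs \<and> set xs \<subseteq> p} =
      {enat (length ys) | ys. weakly_regular ker ys \<and> set ys \<subseteq> pull p}" (is "?A = ?B")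
  proof
    show "?A \<subseteq> ?B"
    proof
      fix n assume "n \<in> ?A"
      then obtain xs where xs: "n = enat (length xs)" "regular_sequence R xs" "set xs \<subseteq> p" by blast
      define ys where "ys = map (inv_into (pull p) h) xs"
      have x: "x \<in> h ` pull p" if "x \<in> set xs" for x using that xs(3) pp(3) by auto
      have "set ys \<subseteq> pull p" unfolding ys_def using x by (auto intro!: inv_into_into)
      moreover have "map h ys = xs"
        unfolding ys_def map_map using x by (intro map_idI) (simp add: f_inv_into_f)
      ultimately have ys: "set ys \<subseteq> pull p" "xs = map h ys" by auto
      have "set ys \<subseteq> S" using ys(1) by (auto simp: pull_def)
      then show "n \<in> ?B" using regular_sequence_iff xs ys by (auto intro!: exI[of _ ys])
    qed
    show "?B \<subseteq> ?A"
    proof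
      fix n assume "n \<in> ?B"
      then obtain ys where ys: "n = enat (length ys)" "weakly_regular ker ys" "set ys \<subseteq> pull p" by blast
      have S: "set ys \<subseteq> S" using ys(3) by (auto simp: pull_def)
      have "foldl ext ker ys \<subseteq> pull p" using exts_least[OF pp(1,2) ys(3)] .
      then have "1 \<notin> foldl ext ker ys" using pull_prime[OF p] by (auto simp: prime_idl_def)
      then have "regular_sequence R (map h ys)" using regular_sequence_iff[OF S] ys(2) by simp
      moreover have "set (map h ys) \<subseteq> p" using ys(3) by (auto simp: pull_def)
      ultimately show "n \<in> ?A" using ys(1) by (auto intro!: exI[of _ "map h ys"])
    qed
  qed
  then show ?thesis unfolding ideal_depth_def by simp
qed

text \<open>At every maximal ideal \<open>d\<close> \<le> depth \<le> height \<le> \<open>d\<close>;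
  the middle inequality is \<open>regular_imp_prime_chain\<close>.\<close>

lemma cohen_macaulayI:
  assumes noeth
    and seq: "\<And>M. maximal_idl M \<Longrightarrow> ker \<subseteq> M \<Longrightarrow> \<exists>ys. length ys = d \<and> set ys \<subseteq> M \<and> weakly_regular ker ys"
    and dim: "\<And>n q. prime_chain ker n q \<Longrightarrow> n \<le> d"
  shows "cohen_macaulay_ring R"
  unfolding cohen_macaulay_ring_def
proof (intro conjI allI impI)
  show "cring R" by (rule R.cring_axioms)
  show "noetherian_ring R" by (rule noetherian_ring_R) fact
  fix m assume m: "maximalideal m R"
  then have pm: "primeideal m R" by (rule R.maximalideal_prime)
  have M: "maximal_idl (pull m)" "ker \<subseteq> pull m"
    using pull_maximal[OF m] pull_idl(2)[OF maximalideal.axioms(1)[OF m]] by auto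
  obtain ys where ys: "length ys = d" "set ys \<subseteq> pull m" "weakly_regular ker ys" using seq[OF M] by blast
  have "enat d \<le> ideal_depth R m"
    unfolding ideal_depth_eq[OF pm] using ys by (intro Sup_upper) auto
  moreover have "ideal_depth R m \<le> prime_height R m"
    unfolding ideal_depth_eq[OF pm] prime_height_eq[OF pm]
  proof (rule Sup_mono)
    fix a assume "a \<in> {enat (length ys) | ys. weakly_regular ker ys \<and> set ys \<subseteq> pull m}"
    then obtain ys where ys: "a = enat (length ys)" "weakly_regular ker ys" "set ys \<subseteq> pull m" by blast
    obtain q where "prime_chain ker (length ys) q" "q (length ys) = pull m"
      using regular_imp_prime_chain[OF ker_idl maximal_imp_prime[OF M(1)] M(2) ys(3,2)] by blast
    then show "\<exists>b\<in>{enat n | n. \<exists>q. prime_chain ker n q \<and> q n = pull m}. a \<le> b" using ys(1) by blast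
  qed
  moreover have "prime_height R m \<le> enat d"
    unfolding prime_height_eq[OF pm] using dim by (intro Sup_least) auto
  ultimately show "ideal_depth R m = prime_height R m" by simp
qed

lemma not_cohen_macaulayI:
  assumes M: "maximal_idl M" "ker \<subseteq> M"
    and depth: "\<And>ys. set ys \<subseteq> M \<Longrightarrow> weakly_regular ker ys \<Longrightarrow> length ys \<le> e"
    and chain: "prime_chain ker n q" "q n = M" "e < n"
  shows "\<not> cohen_macaulay_ring R"
proof
  assume cm: "cohen_macaulay_ring R"
  have m: "maximalideal (h ` M) R" using push_maximal[OF M] .
  then have pm: "primeideal (h ` M) R" by (rule R.maximalideal_prime)
  have pM: "pull (h ` M) = M" using push_ideal(2) M by (auto simp: maximal_idl_def)
  have "ideal_depth R (h ` M) \<le> enat e"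
    unfolding ideal_depth_eq[OF pm] pM using depth by (intro Sup_least) auto
  moreover have "enat n \<le> prime_height R (h ` M)"
    unfolding prime_height_eq[OF pm] pM using chain by (intro Sup_upper) auto
  moreover have "ideal_depth R (h ` M) = prime_height R (h ` M)" using cm m by (simp add: cohen_macaulay_ring_def)
  ultimately show False using chain(3) by (metis enat_ord_simps(1) leD order.trans)
qed

end

section \<open>Stanley--Reisner rings as presented quotients\<close>

lemma cring_polynomial_ring: "cring (polynomial_ring V :: ('v, 'k::field) mpoly ring)"
proof -
  have c: "carrier (polynomial_ring V :: ('v, 'k) mpoly ring) = poly_carrier V"
    by (simp add: polynomial_ring_def poly_carrier_def)
  have o: "mult (polynomial_ring V) = (*)" "add (polynomial_ring V) = (+)" "one (polynomial_ring V) = 1" "zero (polynomial_ring V) = 0"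
    by (simp_all add: polynomial_ring_def)
  show ?thesis
  proof (rule cringI)
    show "abelian_group (polynomial_ring V :: ('v, 'k) mpoly ring)"
    proof (rule abelian_groupI; simp only: c o)
      fix x :: "('v, 'k) mpoly" assume "x \<in> poly_carrier V"
      then show "\<exists>y\<in>poly_carrier V. y + x = 0" using PC.uminus_in by (intro bexI[of _ "- x"]) auto
    qed (auto simp: PC.add_in ac_simps)
    show "comm_monoid (polynomial_ring V :: ('v, 'k) mpoly ring)"
      by (rule comm_monoidI; simp only: c o) (auto simp: PC.mult_in ac_simps)
  qed (simp add: o distrib_right)
qed

text \<open>The identity is a presentation with kernel zero; it serves to identify ideals of the
  record \<open>polynomial_ring V\<close> with \<open>idl\<close>.\<close>

lemma ring_presentation_id: "ring_presentation (poly_carrier V) (polynomial_ring V) (\<lambda>x. x)"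
proof -
  interpret cring "polynomial_ring V" by (rule cring_polynomial_ring)
  show ?thesis by unfold_locales (auto simp: polynomial_ring_def poly_carrier_def)
qed

lemma ideal_polynomial_ring_iff:
  fixes I :: "('v, 'k::field) mpoly set"
  shows "ideal I (polynomial_ring V) \<longleftrightarrow> PC.idl V I"
proof -
  interpret p: ring_presentation "poly_carrier V" "polynomial_ring V :: ('v, 'k) mpoly ring" "\<lambda>x. x"
    by (rule ring_presentation_id)
  have "\<zero>\<^bsub>polynomial_ring V :: ('v, 'k) mpoly ring\<^esub> = 0" by (simp add: polynomial_ring_def)
  then have "p.ker \<subseteq> I" if "0 \<in> I" using that by (auto simp: p.ker_def)
  then show ?thesis
    using p.pull_idl[of I] p.push_ideal[of I] PC.idlD(2)[of V I] by auto
qed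

lemma prod_variables: "finite F \<Longrightarrow> (\<Prod>v\<in>F. variable v) = single (squarefree_mono F) 1"
  by (induction F rule: finite_induct) (auto simp: squarefree_mono_def variable_def mult_single)

text \<open>A monomial whose support is not a face is divisible by the squarefree generator with the
  same support.\<close>

lemma stanley_reisner_ideal_eq:
  assumes "simplicial_complex \<Delta>"
  shows "(stanley_reisner_ideal \<Delta> :: ('v, 'k::field) mpoly set) = mono_ideal (\<Union>\<Delta>) \<Delta>"
proof -
  let ?V = "\<Union>\<Delta>"
  let ?X = "{\<Prod>v\<in>F. variable v | F. F \<subseteq> ?V \<and> F \<notin> \<Delta>} :: ('v, 'k) mpoly set"
  have V: "finite ?V" and down: "\<And>F G. F \<in> \<Delta> \<Longrightarrow> G \<subseteq> F \<Longrightarrow> G \<in> \<Delta>"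
    using assms by (auto simp: simplicial_complex_def)
  have gen: "stanley_reisner_ideal \<Delta> = PC.gen ?V ?X"
    unfolding stanley_reisner_ideal_def genideal_def PC.gen_def ideal_polynomial_ring_iff ..
  have fin: "finite F" if "F \<subseteq> ?V" for F using that V by (rule finite_subset)
  have XS: "?X \<subseteq> poly_carrier ?V" by (auto intro!: PC.prod_in variable_in_carrier)
  show ?thesis unfolding gen
  proof
    show "PC.gen ?V ?X \<subseteq> mono_ideal ?V \<Delta>"
    proof (rule PC.gen_least[OF mono_ideal_idl[OF down]])
      show "?X \<subseteq> mono_ideal ?V \<Delta>"
      proof
        fix f assume f: "f \<in> ?X"
        then obtain F where F: "f = (\<Prod>v\<in>F. variable v)" "F \<subseteq> ?V" "F \<notin> \<Delta>" by blast
        then have "keys f = {squarefree_mono F}" using fin by (simp add: prod_variables)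
        then show "f \<in> mono_ideal ?V \<Delta>" using f XS F fin by (auto simp: mono_ideal_def keys_squarefree_mono)
      qed
    qed
    show "mono_ideal ?V \<Delta> \<subseteq> PC.gen ?V ?X"
    proof
      fix f :: "('v, 'k) mpoly" assume f: "f \<in> mono_ideal ?V \<Delta>"
      note g = PC.gen_idl[OF XS]
      show "f \<in> PC.gen ?V ?X"
      proof (rule mono_ideal_singles[OF g])
        show "f \<in> poly_carrier ?V" using f by (simp add: mono_ideal_def)
        fix m assume "m \<in> keys f"
        then have m: "keys m \<notin> \<Delta>" "keys m \<subseteq> ?V" using f by (auto simp: mono_ideal_def poly_carrier_def)
        have "m = (m - squarefree_mono (keys m)) + squarefree_mono (keys m)"
          by (rule squarefree_mono_dvd) auto
        then have "single m 1 = single (m - squarefree_mono (keys m)) 1 * (single (squarefree_mono (keys m)) 1 :: ('v, 'k) mpoly)"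
          by (simp add: mult_single)
        also have "single (squarefree_mono (keys m)) 1 = (\<Prod>v\<in>keys m. variable v :: ('v, 'k) mpoly)"
          by (simp add: prod_variables)
        also have "single (m - squarefree_mono (keys m)) 1 * \<dots> \<in> PC.gen ?V ?X"
        proof (rule PC.idlD(4)[OF g])
          show "(\<Prod>v\<in>keys m. variable v) \<in> PC.gen ?V ?X" using m PC.gen_superset[of ?X] by blast
          show "single (m - squarefree_mono (keys m)) 1 \<in> poly_carrier ?V"
            using m(2) by (intro single_in_carrier) (auto simp: in_keys_iff lookup_minus)
        qed
        finally show "single m 1 \<in> PC.gen ?V ?X" .
      qed
    qed
  qed
qed

lemma stanley_reisner_presentation:
  assumes "simplicial_complex \<Delta>"
  defines "h \<equiv> a_r_coset (polynomial_ring (\<Union>\<Delta>)) (stanley_reisner_ideal \<Delta> :: ('v, 'k::field) mpoly set)"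
  shows "ring_presentation (poly_carrier (\<Union>\<Delta>)) (stanley_reisner_ring TYPE('k) \<Delta>) h"
    and "ring_presentation.ker (poly_carrier (\<Union>\<Delta>)) (stanley_reisner_ring TYPE('k) \<Delta>) h = mono_ideal (\<Union>\<Delta>) \<Delta>"
proof -
  let ?V = "\<Union>\<Delta>"
  let ?P = "polynomial_ring ?V :: ('v, 'k) mpoly ring"
  let ?I = "stanley_reisner_ideal \<Delta> :: ('v, 'k) mpoly set"
  let ?R = "stanley_reisner_ring TYPE('k) \<Delta>"
  have R: "?R = ?P Quot ?I" by (simp add: stanley_reisner_ring_def)
  have down: "\<And>F G. F \<in> \<Delta> \<Longrightarrow> G \<subseteq> F \<Longrightarrow> G \<in> \<Delta>"
    using assms(1) by (auto simp: simplicial_complex_def)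
  have c: "carrier ?P = poly_carrier ?V" and o: "mult ?P = (*)" "add ?P = (+)" "one ?P = 1" "zero ?P = 0"
    by (simp_all add: polynomial_ring_def poly_carrier_def)
  interpret P: cring ?P by (rule cring_polynomial_ring)
  have I: "PC.idl ?V ?I" unfolding stanley_reisner_ideal_eq[OF assms(1)] by (rule mono_ideal_idl[OF down])
  then interpret I: ideal ?I ?P by (simp add: ideal_polynomial_ring_iff)
  have hom: "h \<in> ring_hom ?P ?R" unfolding h_def R by (rule I.rcos_ring_hom)
  have Q: "cring ?R" unfolding R by (rule I.quotient_is_cring) (rule P.cring_axioms)
  interpret Q: cring ?R by (rule Q)
  show p: "ring_presentation (poly_carrier ?V) ?R h"
  proof
    show "h ` poly_carrier ?V = carrier ?R"
      unfolding R h_def FactRing_def A_RCOSETS_def' c by auto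
    show "h (a + b) = h a \<oplus>\<^bsub>?R\<^esub> h b" "h (a * b) = h a \<otimes>\<^bsub>?R\<^esub> h b"
      if "a \<in> poly_carrier ?V" "b \<in> poly_carrier ?V" for a b
      using ring_hom_add[OF hom] ring_hom_mult[OF hom] that by (simp_all add: c o)
    show "h 1 = \<one>\<^bsub>?R\<^esub>" using ring_hom_one[OF hom] by (simp add: o)
    show "h 0 = \<zero>\<^bsub>?R\<^esub>" using ring_hom_zero[OF hom P.ring_axioms Q.ring_axioms] by (simp add: o)
  qed
  have "h s = \<zero>\<^bsub>?R\<^esub> \<longleftrightarrow> s \<in> ?I" if "s \<in> poly_carrier ?V" for s
    using I.rcos_const_imp_mem[of s] P.a_rcos_zero[OF I.is_ideal, of s] that
    by (auto simp: R FactRing_def h_def c)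
  then show "ring_presentation.ker (poly_carrier ?V) ?R h = mono_ideal ?V \<Delta>"
    unfolding ring_presentation.ker_def[OF p] using PC.idlD(1)[OF I] stanley_reisner_ideal_eq[OF assms(1)] by auto
qed

section \<open>Cohen--Macaulay complexes\<close>

lemma (in relative_ring) adjoins_least:
  assumes "relative_ring A" "A \<subseteq> S" "set xs \<subseteq> S"
  shows "foldl adjoin A xs \<subseteq> S"
  using assms
proof (induction xs arbitrary: A)
  case (Cons x xs)
  interpret A: relative_ring A by fact
  have "adjoin A x \<subseteq> S"
    using Cons.prems(2,3) unfolding adjoin_def coeffs_in_def
    by (intro image_subsetI poly_in) (auto simp: coeffs_in_def)
  then show ?case using Cons.IH[OF A.relative_ring_adjoin] Cons.prems by simp
qed simp

text \<open>\<open>x\<close> is adjoined although it already belongs to the ring, because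
  \<open>nullstellensatz\<close> speaks of the first adjoined element.\<close>

lemma poly_carrier_adjoin_variables:
  assumes "set vs = V" "x \<in> poly_carrier V"
  shows "poly_carrier V = foldl adjoin constants (x # map variable vs)"
    (is "_ = ?L")
proof
  interpret C: relative_ring constants by (rule relative_ring_constants)
  interpret L: relative_ring ?L by (rule C.relative_ring_adjoins)
  have "set (x # map variable vs) \<subseteq> poly_carrier V" using assms variable_in_carrier by auto
  then show "?L \<subseteq> poly_carrier V" by (intro PC.adjoins_least relative_ring_constants constants_subset)
  show "poly_carrier V \<subseteq> ?L"
  proof
    fix f :: "('a, 'b) mpoly" assume f: "f \<in> poly_carrier V"
    have "single m (lookup f m) \<in> ?L" if "m \<in> keys f" for m
    proof -
      have "finite V" using assms(1) by auto
      then have "single m 1 = (\<Prod>v\<in>V. variable v ^ lookup m v :: ('a, 'b) mpoly)"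
        using f that by (intro monomial_prod) (auto simp: poly_carrier_def)
      also have "\<dots> \<in> ?L"
        using C.adjoins_mem[of "x # map variable vs"] assms(1) by (intro L.prod_in L.power_in) auto
      finally have "single 0 (lookup f m) * single m 1 \<in> ?L"
        using C.adjoins_superset[of "x # map variable vs"] by (intro L.mult_in) (auto simp: constants_def)
      then show ?thesis by (simp add: mult_single)
    qed
    then have "(\<Sum>m\<in>keys f. single m (lookup f m)) \<in> ?L" by (intro L.sum_in)
    then show "f \<in> ?L" by (simp add: sum_singles)
  qed
qed

text \<open>The sequence may depend on \<open>M\<close> but has to serve all facets at once, as
  \<open>shelling_weakly_regular\<close> demands; this is why \<theta> i sums a whole colour class
  instead of picking one variable.\<close>

theorem balanced_shelling_cohen_macaulay:
  fixes \<Delta> :: "'v set set" and \<kappa> :: "'v \<Rightarrow> nat"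
  assumes \<Delta>: "simplicial_complex \<Delta>" and sh: "shelling Fs" and Fs: "\<Delta> = (\<Union>F\<in>set Fs. Pow F)"
    and \<kappa>: "\<And>F. F \<in> set Fs \<Longrightarrow> bij_betw \<kappa> F {..<d}"
  shows "cohen_macaulay TYPE('k::field) \<Delta>"
proof -
  define V where "V = \<Union>\<Delta>"
  define h where "h = a_r_coset (polynomial_ring V) (stanley_reisner_ideal \<Delta> :: ('v, 'k) mpoly set)"
  have pres: "ring_presentation (poly_carrier V) (stanley_reisner_ring TYPE('k) \<Delta>) h"
    and ker: "ring_presentation.ker (poly_carrier V) (stanley_reisner_ring TYPE('k) \<Delta>) h = mono_ideal V \<Delta>"
    using stanley_reisner_presentation[OF \<Delta>, where 'k = 'k] unfolding V_def h_def by auto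
  interpret R: ring_presentation "poly_carrier V" "stanley_reisner_ring TYPE('k) \<Delta>" h by (rule pres)
  have V: "finite V" using \<Delta> by (auto simp: simplicial_complex_def V_def)
  have FV: "F \<subseteq> V" if "F \<in> set Fs" for F using that Fs by (auto simp: V_def)
  have "cohen_macaulay_ring (stanley_reisner_ring TYPE('k) \<Delta>)"
  proof (rule R.cohen_macaulayI)
    show "relative_ring.noeth (poly_carrier V :: ('v, 'k) mpoly set)" by (rule hilbert_basis[OF V])
    show "n \<le> d" if chain: "PC.prime_chain V R.ker n q" for n q
    proof (rule dimension_bound[OF V _ _ chain[unfolded ker]])
      show "F \<subseteq> V" if "F \<in> \<Delta>" for F using that by (auto simp: V_def)
      show "card F \<le> d" if F: "F \<in> \<Delta>" for F
      proof -
        obtain G where G: "G \<in> set Fs" "F \<subseteq> G" using F Fs by auto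
        then have "card G = d" using bij_betw_same_card[OF \<kappa>[OF G(1)]] by simp
        then show ?thesis using card_mono[OF finite_subset[OF FV[OF G(1)] V] G(2)] by simp
      qed
    qed
    fix M assume M: "PC.maximal_idl V M" "R.ker \<subseteq> M"
    define \<theta> where "\<theta> i = (\<Sum>v\<in>{v\<in>V. \<kappa> v = i}. variable v :: ('v, 'k) mpoly)" for i
    have \<theta>S: "\<theta> i \<in> poly_carrier V" for i unfolding \<theta>_def by (intro PC.sum_in variable_in_carrier) auto
    obtain vs where vs: "set vs = V" using finite_list[OF V] by blast
    have "\<exists>G. G \<in> coeffs_in constants \<and> G \<noteq> 0 \<and> poly G (\<theta> i) \<in> M" for i
    proof -
      have "algebraic_mod M constants (\<theta> i)"
        by (rule PC.nullstellensatz[OF M(1) relative_ring_constants poly_carrier_adjoin_variables[OF vs \<theta>S]])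
      then obtain G j where "G \<in> coeffs_in constants" "poly G (\<theta> i) \<in> M" "coeff G j \<notin> M"
        by (auto simp: algebraic_mod_def)
      moreover have "0 \<in> M" using M(1) PC.idlD(2) by (auto simp: PC.maximal_idl_def)
      ultimately show ?thesis by (intro exI[of _ G]) auto
    qed
    then obtain G where G: "\<And>i. G i \<in> coeffs_in constants" "\<And>i. G i \<noteq> 0" "\<And>i. poly (G i) (\<theta> i) \<in> M"
      by metis
    define y where "y i = poly (G i) (\<theta> i)" for i
    have GS: "G i \<in> coeffs_in (poly_carrier V)" for i
      using G(1)[of i] constants_subset[of V] by (auto simp: coeffs_in_def)
    have yS: "y i \<in> poly_carrier V" for i unfolding y_def by (intro PC.poly_in \<theta>S GS)
    have "PC.weakly_regular V (mono_ideal V (Pow F)) (map y [0..<d])" if F: "F \<in> set Fs" for F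
    proof (rule simplex_weakly_regular)
      define w where "w = inv_into F \<kappa>"
      have w: "w i \<in> F" "\<kappa> (w i) = i" if "i < d" for i
        using \<kappa>[OF F] that by (auto simp: w_def bij_betw_def inv_into_into f_inv_into_f)
      show "F \<subseteq> V" using FV F .
      show "inj_on w {..<d}" by (rule inj_onI) (metis lessThan_iff w(2))
      show "w ` {..<d} \<subseteq> F" using w by auto
      show "G i \<in> coeffs_in constants \<and> G i \<noteq> 0" for i using G by auto
      show "y i \<in> poly_carrier V" for i by (rule yS)
      fix i assume i: "i < d"
      have P: "PC.idl V (mono_ideal V (Pow F) :: ('v, 'k) mpoly set)" by (rule mono_ideal_idl) auto
      have wV: "w i \<in> V" using w(1)[OF i] FV[OF F] by blast
      \<comment> \<open>\<open>F\<close> has only one vertex of each colour, so the other variables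
        of colour \<open>i\<close> lie outside \<open>F\<close> and vanish modulo its prime.\<close>
      have "\<theta> i - variable (w i) = (\<Sum>v\<in>{v\<in>V. \<kappa> v = i} - {w i}. variable v)"
        unfolding \<theta>_def using V wV w(2)[OF i] by (subst sum.remove[of _ "w i"]) auto
      also have "\<dots> \<in> mono_ideal V (Pow F)"
      proof (rule PC.idl_sum[OF P])
        fix v assume v: "v \<in> {v\<in>V. \<kappa> v = i} - {w i}"
        have "v \<notin> F" using v w[OF i] \<kappa>[OF F] by (auto simp: bij_betw_def inj_on_def)
        then show "variable v \<in> mono_ideal V (Pow F)"
          using v variable_in_carrier[of v V] by (auto simp: mono_ideal_def variable_def)
      qed
      finally show "y i - poly (G i) (variable (w i)) \<in> mono_ideal V (Pow F)"
        unfolding y_def by (intro PC.idl_poly_cong[OF P \<theta>S variable_in_carrier[OF wV] _ GS])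
    qed
    then have "PC.weakly_regular V (mono_ideal V \<Delta>) (map y [0..<d])"
      unfolding Fs using FV yS by (intro shelling_weakly_regular[OF V sh]) auto
    moreover have "set (map y [0..<d]) \<subseteq> M" using G(3) by (auto simp: y_def)
    ultimately show "\<exists>ys. length ys = d \<and> set ys \<subseteq> M \<and> PC.weakly_regular V R.ker ys"
      unfolding ker by (intro exI[of _ "map y [0..<d]"]) auto
  qed
  then show ?thesis using \<Delta> by (simp add: cohen_macaulay_def)
qed

text \<open>The depth at the origin is at most the dimension \<open>card F\<close> of the associated prime of the facet
  \<open>F\<close>, the height at least \<open>card G\<close>.\<close>

theorem cohen_macaulay_facet_card:
  fixes \<Delta> :: "'v set set"
  assumes cm: "cohen_macaulay TYPE('k::field) \<Delta>" and F: "F \<in> facets \<Delta>" and G: "G \<in> \<Delta>"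
  shows "card G \<le> card F"
proof (rule ccontr)
  assume less: "\<not> card G \<le> card F"
  have \<Delta>: "simplicial_complex \<Delta>" using cm by (simp add: cohen_macaulay_def)
  define V where "V = \<Union>\<Delta>"
  define h where "h = a_r_coset (polynomial_ring V) (stanley_reisner_ideal \<Delta> :: ('v, 'k) mpoly set)"
  have pres: "ring_presentation (poly_carrier V) (stanley_reisner_ring TYPE('k) \<Delta>) h"
    and ker: "ring_presentation.ker (poly_carrier V) (stanley_reisner_ring TYPE('k) \<Delta>) h = mono_ideal V \<Delta>"
    using stanley_reisner_presentation[OF \<Delta>, where 'k = 'k] unfolding V_def h_def by auto
  interpret R: ring_presentation "poly_carrier V" "stanley_reisner_ring TYPE('k) \<Delta>" h by (rule pres)
  have V: "finite V" and down: "\<And>F G. F \<in> \<Delta> \<Longrightarrow> G \<subseteq> F \<Longrightarrow> G \<in> \<Delta>" and e: "{} \<in> \<Delta>"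
    using \<Delta> by (auto simp: simplicial_complex_def V_def)
  have F\<Delta>: "F \<in> \<Delta>" and Fmax: "\<And>H. H \<in> \<Delta> \<Longrightarrow> F \<subseteq> H \<Longrightarrow> H = F" using F by (auto simp: facets_def)
  have FV: "F \<subseteq> V" and GV: "G \<subseteq> V" using F\<Delta> G by (auto simp: V_def)
  have fin: "finite F" "finite G" using FV GV V finite_subset by auto
  let ?P = "\<lambda>A. mono_ideal V (Pow A) :: ('v, 'k) mpoly set"
  let ?I = "mono_ideal V \<Delta> :: ('v, 'k) mpoly set"
  have P: "PC.prime_idl V (?P A)" if "A \<subseteq> V" for A using mono_ideal_prime[OF V that] .
  have sub: "?P A \<subset> ?P B" if AB: "B \<subset> A" "A \<subseteq> V" for A B
  proof -
    obtain v where v: "v \<in> A" "v \<notin> B" using AB by auto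
    then have "variable v \<in> ?P B" "variable v \<notin> ?P A"
      using AB variable_in_carrier[of v V] by (auto simp: mono_ideal_def variable_def)
    moreover have "B \<subseteq> A" using AB(1) by blast
    then have "?P A \<subseteq> ?P B" by (auto simp: mono_ideal_def dest: subset_trans)
    ultimately show ?thesis by blast
  qed
  have I: "PC.idl V ?I" by (rule mono_ideal_idl[OF down])
  \<comment> \<open>The origin: these are the polynomials without constant term.\<close>
  have max: "PC.maximal_idl V (?P {})"
    unfolding PC.maximal_idl_def
  proof (intro conjI allI impI)
    show i: "PC.idl V (?P {})" "1 \<notin> ?P {}" using P[of "{}"] by (auto simp: PC.prime_idl_def)
    fix J assume J: "PC.idl V J" "?P {} \<subseteq> J" "1 \<notin> J"
    have "J \<subseteq> ?P {}"
    proof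
      fix f assume f: "f \<in> J"
      have fS: "f \<in> poly_carrier V" using PC.idlD(8)[OF J(1) f] .
      have g: "f - single 0 (lookup f 0) \<in> ?P {}"
        using PC.diff_in[OF fS const_in_carrier] by (auto simp: mono_ideal_def in_keys_iff lookup_minus)
      have "f - (f - single 0 (lookup f 0)) \<in> J" by (rule PC.idlD(7)[OF J(1) f subsetD[OF J(2) g]])
      then have "lookup f 0 = 0" using const_in_proper_idl[OF J(1,3)] by simp
      then show "f \<in> ?P {}" using g by simp
    qed
    then show "J = ?P {}" using J(2) by blast
  qed
  define z where "z = (single (squarefree_mono F) 1 :: ('v, 'k) mpoly)"
  have zS: "z \<in> poly_carrier V" unfolding z_def using FV fin by (intro single_in_carrier) (simp add: keys_squarefree_mono)
  have zI: "z \<notin> ?I" using F\<Delta> fin by (auto simp: z_def mono_ideal_def keys_squarefree_mono)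
  \<comment> \<open>The prime of a facet is associated: by maximality of \<open>F\<close>, a
    monomial times the monomial of \<open>F\<close> is supported on a face only if its own support
    lies in \<open>F\<close>.\<close>
  have colon: "?P F = PC.colon V ?I z"
  proof (rule Set.set_eqI)
    fix f :: "('v, 'k) mpoly"
    have k: "keys (f * z) = (\<lambda>m. squarefree_mono F + m) ` keys f"
      using keys_single_times[of _ "squarefree_mono F" 1 f]
      by (auto simp: z_def mult.commute[of f] in_keys_iff lookup_single_times)
    have face: "keys (squarefree_mono F + m) \<in> \<Delta> \<longleftrightarrow> keys m \<subseteq> F" for m
    proof -
      have "keys (squarefree_mono F + m) = F \<union> keys m" using fin by (simp add: keys_plus_nat keys_squarefree_mono)
      moreover have "F \<union> keys m \<in> \<Delta> \<longleftrightarrow> keys m \<subseteq> F"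
        using Fmax[of "F \<union> keys m"] F\<Delta> by (auto simp: Un_absorb2)
      ultimately show ?thesis by simp
    qed
    have "f \<in> PC.colon V ?I z \<longleftrightarrow> f \<in> poly_carrier V \<and> f * z \<in> poly_carrier V \<and>
        (\<forall>m\<in>keys f. keys (squarefree_mono F + m) \<notin> \<Delta>)"
      by (simp add: PC.colon_def mono_ideal_def k)
    also have "\<dots> \<longleftrightarrow> f \<in> ?P F"
      unfolding face using zS by (auto simp: mono_ideal_def PC.mult_in)
    finally show "f \<in> ?P F \<longleftrightarrow> f \<in> PC.colon V ?I z" by simp
  qed
  obtain gs where gs: "set gs = G" "distinct gs" using finite_distinct_list[OF fin(2)] by blast
  have len: "length gs = card G" using gs distinct_card by force
  \<comment> \<open>Deleting the vertices of \<open>G\<close> one by one raises the prime of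
    \<open>G\<close> to the origin in \<open>card G\<close> strict steps.\<close>
  define q where "q i = ?P (set (drop i gs))" for i
  have dV: "set (drop i gs) \<subseteq> V" for i using gs(1) GV set_drop_subset by fastforce
  have "PC.prime_chain V ?I (card G) q"
    unfolding PC.prime_chain_def
  proof (intro conjI allI impI)
    show "?I \<subseteq> q 0" using G down gs(1) by (auto simp: q_def mono_ideal_def)
    show "PC.prime_idl V (q i)" for i unfolding q_def by (rule P[OF dV])
    fix i assume "i < card G"
    then have i: "i < length gs" by (simp add: len)
    have "gs ! i \<notin> set (drop (Suc i) gs)"
      using gs(2) i by (metis Cons_nth_drop_Suc distinct.simps(2) distinct_drop)
    then have "set (drop (Suc i) gs) \<subset> set (drop i gs)"
      using Cons_nth_drop_Suc[OF i] by (metis insertI1 list.simps(15) psubsetI subset_insertI)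
    then show "q i \<subset> q (Suc i)" unfolding q_def by (intro sub dV)
  qed
  moreover have "q (card G) = ?P {}" by (simp add: q_def len[symmetric])
  moreover have "length ys \<le> card F" if ys: "set ys \<subseteq> ?P {}" "PC.weakly_regular V R.ker ys" for ys
  proof -
    have "?P F \<subseteq> ?P {}" by (auto simp: mono_ideal_def)
    then obtain p where "PC.prime_chain V (?P F) (length ys) p"
      using PC.regular_imp_chain_above[OF hilbert_basis[OF V] I P[of "{}"] ys(1) ys(2)[unfolded ker] P[OF FV] colon _ zS zI]
      by auto
    then show ?thesis
    proof (rule dimension_bound[OF V, rotated -1])
      show "A \<subseteq> V" "card A \<le> card F" if "A \<in> Pow F" for A
        using that FV card_mono[OF fin(1), of A] by auto
    qed
  qed
  moreover have "R.ker \<subseteq> ?P {}" unfolding ker using e by (auto simp: mono_ideal_def)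
  ultimately have "\<not> cohen_macaulay_ring (stanley_reisner_ring TYPE('k) \<Delta>)"
    using less by (intro R.not_cohen_macaulayI[OF max, of "card F" "card G" q]) (auto simp: ker)
  then show False using cm by (simp add: cohen_macaulay_def)
qed

section \<open>Vertex decomposable complexes\<close>

lemma simplicial_complexD:
  assumes "simplicial_complex \<Delta>"
  shows "finite (\<Union>\<Delta>)" "{} \<in> \<Delta>" "\<And>F G. F \<in> \<Delta> \<Longrightarrow> G \<subseteq> F \<Longrightarrow> G \<in> \<Delta>" "\<And>F. F \<in> \<Delta> \<Longrightarrow> finite F"
    "finite \<Delta>"
  using assms finite_UnionD[of \<Delta>] by (auto simp: simplicial_complex_def intro: finite_subset)

lemma face_in_facet:
  assumes "simplicial_complex \<Delta>" "F \<in> \<Delta>"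
  obtains G where "G \<in> facets \<Delta>" "F \<subseteq> G"
proof -
  obtain G where "G \<in> \<Delta>" "F \<subseteq> G" "\<And>H. H \<in> \<Delta> \<Longrightarrow> G \<subseteq> H \<Longrightarrow> H = G"
    using finite_has_maximal2[OF simplicial_complexD(5)[OF assms(1)] assms(2)] by auto
  then have "G \<in> facets \<Delta>" by (simp add: facets_def)
  then show ?thesis using that \<open>F \<subseteq> G\<close> by blast
qed

lemma facets_Pow: "facets (Pow V) = {V}"
  by (auto simp: facets_def)

lemma facetsD: "F \<in> facets \<Delta> \<Longrightarrow> F \<in> \<Delta>" "F \<in> facets \<Delta> \<Longrightarrow> G \<in> \<Delta> \<Longrightarrow> F \<subseteq> G \<Longrightarrow> G = F"
  by (auto simp: facets_def)

lemma vertex_decomposable_imp: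
  "vertex_decomposable \<Delta> \<Longrightarrow> simplicial_complex \<Delta> \<and> pure_complex \<Delta>"
  by (cases rule: vertex_decomposable.cases)
    (auto simp: simplicial_complex_def pure_complex_def facets_Pow)

lemma deletion_complex: "simplicial_complex \<Delta> \<Longrightarrow> simplicial_complex (deletion \<Delta> x)"
  unfolding simplicial_complex_def deletion_def by (auto intro: finite_subset[of _ "\<Union>\<Delta>"])

lemma link_vertex: "link \<Delta> {x} = {F \<in> \<Delta>. x \<notin> F \<and> insert x F \<in> \<Delta>}"
  by (auto simp: link_def)

text \<open>Invariance under relabelling, for the upper intervals, which arise by complementation
  from ideals for the reversed ranks.\<close>

lemma vertex_decomposable_image:
  assumes "vertex_decomposable \<Delta>" "inj_on f (\<Union>\<Delta>)"
  shows "vertex_decomposable ((`) f ` \<Delta>)"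
  using assms
proof (induction rule: vertex_decomposable.induct)
  case (simplex V)
  have "(`) f ` Pow V = Pow (f ` V)" by (rule image_Pow_surj) simp
  then show ?case using simplex by (simp add: vertex_decomposable.simplex)
next
  case (shedding \<Delta> x)
  note sc = simplicial_complexD[OF shedding.hyps(1)]
  let ?f = "(`) f"
  have iff: "f ` F \<subseteq> f ` G \<longleftrightarrow> F \<subseteq> G" if "F \<in> \<Delta>" "G \<in> \<Delta>" for F G
    using inj_on_image_mem_iff[OF shedding.prems] that by (metis Union_upper image_mono image_subset_iff subset_eq)
  have eq: "f ` F = f ` G \<longleftrightarrow> F = G" if "F \<in> \<Delta>" "G \<in> \<Delta>" for F G
    using iff[OF that] iff[OF that(2,1)] by blast
  have fx: "f x \<in> f ` F \<longleftrightarrow> x \<in> F" if "F \<in> \<Delta>" for F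
    using iff[OF shedding.hyps(3) that] by simp
  have facets: "facets (?f ` \<Gamma>) = ?f ` facets \<Gamma>" if "\<Gamma> \<subseteq> \<Delta>" for \<Gamma>
  proof -
    have "F \<in> \<Gamma> \<Longrightarrow> f ` F \<in> facets (?f ` \<Gamma>) \<longleftrightarrow> F \<in> facets \<Gamma>" for F
      using that iff[of F] eq[of _ F] by (simp add: facets_def subset_iff[of \<Gamma>])
    then show ?thesis using facetsD(1)[of _ "?f ` \<Gamma>"] facetsD(1)[of _ \<Gamma>] by blast
  qed
  have card: "card (f ` F) = card F" if "F \<in> \<Delta>" for F
    using that shedding.prems by (intro card_image) (auto intro: inj_on_subset)
  have del: "deletion (?f ` \<Delta>) (f x) = ?f ` deletion \<Delta> x"
    unfolding deletion_def using fx by auto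
  have ins: "insert (f x) (f ` F) \<in> ?f ` \<Delta> \<longleftrightarrow> insert x F \<in> \<Delta>" if "F \<in> \<Delta>" for F
  proof
    assume "insert (f x) (f ` F) \<in> ?f ` \<Delta>"
    then obtain G where G: "G \<in> \<Delta>" "f ` insert x F = f ` G" by auto
    have "insert x F \<subseteq> \<Union>\<Delta>" using that shedding.hyps(3) by blast
    then have "insert x F = G" using inj_on_image_eq_iff[OF shedding.prems] G by blast
    then show "insert x F \<in> \<Delta>" using G by simp
  qed (metis image_eqI image_insert)
  have lk: "link (?f ` \<Delta>) {f x} = ?f ` link \<Delta> {x}"
    unfolding link_vertex using fx ins by auto
  show ?case
  proof (rule vertex_decomposable.shedding)
    show "simplicial_complex (?f ` \<Delta>)"
      unfolding simplicial_complex_def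
    proof (intro conjI ballI allI impI)
      show "finite (\<Union> (?f ` \<Delta>))" using sc(1) by (metis finite_imageI image_Union)
      show "{} \<in> ?f ` \<Delta>" using sc(2) by auto
      fix F G assume "F \<in> ?f ` \<Delta>" "G \<subseteq> F"
      then obtain H where "H \<in> \<Delta>" "G \<subseteq> f ` H" by auto
      then obtain K where "K \<subseteq> H" "G = f ` K" by (meson subset_imageE)
      then show "G \<in> ?f ` \<Delta>" using sc(3) \<open>H \<in> \<Delta>\<close> by blast
    qed
    show "pure_complex (?f ` \<Delta>)"
      unfolding pure_complex_def facets[OF order.refl] ball_simps
    proof (intro ballI)
      fix F G assume FG: "F \<in> facets \<Delta>" "G \<in> facets \<Delta>"
      then have "card F = card G" using shedding.hyps(2) unfolding pure_complex_def by blast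
      then show "card (f ` F) = card (f ` G)" using card[OF facetsD(1)] FG by simp
    qed
    show "{f x} \<in> ?f ` \<Delta>" using shedding.hyps(3) by force
    have "inj_on f (\<Union>(deletion \<Delta> x))" "inj_on f (\<Union>(link \<Delta> {x}))"
      using shedding.prems by (auto simp: deletion_def link_def intro: inj_on_subset)
    then show "vertex_decomposable (deletion (?f ` \<Delta>) (f x))" "vertex_decomposable (link (?f ` \<Delta>) {f x})"
      unfolding del lk using shedding.IH by auto
    have "deletion \<Delta> x \<subseteq> \<Delta>" by (auto simp: deletion_def)
    then have fd: "facets (deletion (?f ` \<Delta>) (f x)) = ?f ` facets (deletion \<Delta> x)" unfolding del by (rule facets)
    have eq': "F = G" if "F \<in> link \<Delta> {x}" "G \<in> facets (deletion \<Delta> x)" "f ` F = f ` G" for F G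
      using that eq[of F G] by (auto simp: link_def facets_def deletion_def)
    show "link (?f ` \<Delta>) {f x} \<inter> facets (deletion (?f ` \<Delta>) (f x)) = {}"
      unfolding lk
    proof safe
      fix F assume F: "F \<in> link \<Delta> {x}" "f ` F \<in> facets (deletion (?f ` \<Delta>) (f x))"
      then have "f ` F \<in> ?f ` facets (deletion \<Delta> x)" using fd by simp
      then obtain G where G: "f ` F = f ` G" "G \<in> facets (deletion \<Delta> x)" by (rule imageE)
      then have "F = G" using eq'[OF F(1)] by blast
      then show "f ` F \<in> {}" using G(2) F(1) shedding.hyps(6) by blast
    qed
  qed
qed

section \<open>Joins\<close>

definition join :: "'v set set \<Rightarrow> 'v set set \<Rightarrow> 'v set set" where
  "join \<Delta> \<Gamma> = {F \<union> G | F G. F \<in> \<Delta> \<and> G \<in> \<Gamma>}"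

lemma join_commute: "join \<Delta> \<Gamma> = join \<Gamma> \<Delta>"
  by (auto simp: join_def)

lemma joinI: "F \<in> \<Delta> \<Longrightarrow> G \<in> \<Gamma> \<Longrightarrow> F \<union> G \<in> join \<Delta> \<Gamma>"
  by (auto simp: join_def)

lemma join_complex:
  assumes "simplicial_complex \<Delta>" "simplicial_complex \<Gamma>"
  shows "simplicial_complex (join \<Delta> \<Gamma>)"
  unfolding simplicial_complex_def
proof (intro conjI ballI allI impI)
  note d = simplicial_complexD[OF assms(1)] and g = simplicial_complexD[OF assms(2)]
  have "\<Union>(join \<Delta> \<Gamma>) \<subseteq> \<Union>\<Delta> \<union> \<Union>\<Gamma>" by (auto simp: join_def)
  then show "finite (\<Union>(join \<Delta> \<Gamma>))" using d(1) g(1) finite_subset by blast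
  show "{} \<in> join \<Delta> \<Gamma>" using joinI[OF d(2) g(2)] by simp
  fix F H assume "F \<in> join \<Delta> \<Gamma>" and H: "H \<subseteq> F"
  then obtain A B where AB: "A \<in> \<Delta>" "B \<in> \<Gamma>" "F = A \<union> B" by (auto simp: join_def)
  then have "H = (H \<inter> A) \<union> (H \<inter> B)" using H by auto
  then show "H \<in> join \<Delta> \<Gamma>" using joinI[OF d(3)[OF AB(1), of "H \<inter> A"] g(3)[OF AB(2), of "H \<inter> B"]] by auto
qed

lemma join_unique:
  assumes "\<Union>\<Delta> \<inter> \<Union>\<Gamma> = {}" "A \<in> \<Delta>" "A' \<in> \<Delta>" "B \<in> \<Gamma>" "B' \<in> \<Gamma>" "A \<union> B \<subseteq> A' \<union> B'"
  shows "A \<subseteq> A'" "B \<subseteq> B'"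
  using assms by blast+

lemma join_facets:
  assumes disj: "\<Union>\<Delta> \<inter> \<Union>\<Gamma> = {}"
  shows "facets (join \<Delta> \<Gamma>) = {F \<union> G | F G. F \<in> facets \<Delta> \<and> G \<in> facets \<Gamma>}"
proof
  show "facets (join \<Delta> \<Gamma>) \<subseteq> {F \<union> G | F G. F \<in> facets \<Delta> \<and> G \<in> facets \<Gamma>}"
  proof
    fix H assume H: "H \<in> facets (join \<Delta> \<Gamma>)"
    then obtain F G where FG: "F \<in> \<Delta>" "G \<in> \<Gamma>" "H = F \<union> G" by (auto simp: join_def facets_def)
    have "F' = F" if "F' \<in> \<Delta>" "F \<subseteq> F'" for F'
    proof -
      have "F' \<union> G = F \<union> G" using facetsD(2)[OF H joinI[OF that(1) FG(2)]] FG that by auto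
      then show ?thesis using join_unique[OF disj that(1) FG(1,2,2)] that(2) by auto
    qed
    moreover have "G' = G" if "G' \<in> \<Gamma>" "G \<subseteq> G'" for G'
    proof -
      have "F \<union> G' = F \<union> G" using facetsD(2)[OF H joinI[OF FG(1) that(1)]] FG that by auto
      then show ?thesis using join_unique[OF disj FG(1,1) that(1) FG(2)] that(2) by auto
    qed
    ultimately have "F \<in> facets \<Delta>" "G \<in> facets \<Gamma>" using FG(1,2) by (simp_all add: facets_def)
    then show "H \<in> {F \<union> G | F G. F \<in> facets \<Delta> \<and> G \<in> facets \<Gamma>}" using FG(3) by blast
  qed
  show "{F \<union> G | F G. F \<in> facets \<Delta> \<and> G \<in> facets \<Gamma>} \<subseteq> facets (join \<Delta> \<Gamma>)"
  proof clarify
    fix F G assume F: "F \<in> facets \<Delta>" and G: "G \<in> facets \<Gamma>"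
    have "H = F \<union> G" if H: "H \<in> join \<Delta> \<Gamma>" "F \<union> G \<subseteq> H" for H
    proof -
      obtain A B where AB: "A \<in> \<Delta>" "B \<in> \<Gamma>" "H = A \<union> B" using H(1) by (auto simp: join_def)
      then have "F \<subseteq> A" "G \<subseteq> B"
        using join_unique[OF disj facetsD(1)[OF F] AB(1) facetsD(1)[OF G] AB(2)] H(2) by auto
      then show ?thesis using facetsD(2)[OF F AB(1)] facetsD(2)[OF G AB(2)] AB(3) by simp
    qed
    then show "F \<union> G \<in> facets (join \<Delta> \<Gamma>)"
      using joinI[OF facetsD(1)[OF F] facetsD(1)[OF G]] unfolding facets_def by blast
  qed
qed

lemma join_pure:
  assumes "simplicial_complex \<Delta>" "simplicial_complex \<Gamma>" "pure_complex \<Delta>" "pure_complex \<Gamma>"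
    and disj: "\<Union>\<Delta> \<inter> \<Union>\<Gamma> = {}"
  shows "pure_complex (join \<Delta> \<Gamma>)"
proof -
  have "card (F \<union> G) = card F + card G" if "F \<in> facets \<Delta>" "G \<in> facets \<Gamma>" for F G
  proof (rule card_Un_disjoint)
    show "finite F" "finite G"
      using simplicial_complexD(4)[OF assms(1)] simplicial_complexD(4)[OF assms(2)] that by (auto simp: facets_def)
    show "F \<inter> G = {}" using disj that facetsD(1) by fast
  qed
  note card = this
  have "card (F \<union> G) = card (F' \<union> G')"
    if "F \<in> facets \<Delta>" "F' \<in> facets \<Delta>" "G \<in> facets \<Gamma>" "G' \<in> facets \<Gamma>" for F F' G G'
    using card[OF that(1,3)] card[OF that(2,4)] assms(3,4) that unfolding pure_complex_def by metis
  then show ?thesis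
    unfolding pure_complex_def join_facets[OF disj] by blast
qed

text \<open>For disjoint vertex sets, deletion and link of a vertex of \<open>\<Delta>\<close> act
  on the first factor alone, so that a shedding vertex of \<open>\<Delta>\<close> sheds the
  join.\<close>

lemma join_shedding:
  assumes \<Delta>: "simplicial_complex \<Delta>" "pure_complex \<Delta>" "{x} \<in> \<Delta>"
    "link \<Delta> {x} \<inter> facets (deletion \<Delta> x) = {}"
    and \<Gamma>: "simplicial_complex \<Gamma>" "pure_complex \<Gamma>" and disj: "\<Union>\<Delta> \<inter> \<Union>\<Gamma> = {}"
    and vd: "vertex_decomposable (join (deletion \<Delta> x) \<Gamma>)" "vertex_decomposable (join (link \<Delta> {x}) \<Gamma>)"
  shows "vertex_decomposable (join \<Delta> \<Gamma>)"
proof -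
  have x: "x \<notin> G" if "G \<in> \<Gamma>" for G using that \<Delta>(3) disj by auto
  have del: "deletion (join \<Delta> \<Gamma>) x = join (deletion \<Delta> x) \<Gamma>"
    using x by (auto simp: deletion_def join_def)
  have lk: "link (join \<Delta> \<Gamma>) {x} = join (link \<Delta> {x}) \<Gamma>"
  proof
    show "join (link \<Delta> {x}) \<Gamma> \<subseteq> link (join \<Delta> \<Gamma>) {x}"
      using x unfolding link_vertex join_def by clarsimp (metis Un_insert_left)
    show "link (join \<Delta> \<Gamma>) {x} \<subseteq> join (link \<Delta> {x}) \<Gamma>"
    proof
      fix H assume H: "H \<in> link (join \<Delta> \<Gamma>) {x}"
      then obtain F G F' G' where FG: "F \<in> \<Delta>" "G \<in> \<Gamma>" "H = F \<union> G" "x \<notin> H"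
        "F' \<in> \<Delta>" "G' \<in> \<Gamma>" "insert x H = F' \<union> G'" by (auto simp: link_vertex join_def)
      have "{x} \<union> {} \<subseteq> F' \<union> G'" "F \<union> G \<subseteq> F' \<union> G'" using FG(3,7) by auto
      then have "insert x F \<subseteq> F'"
        using join_unique(1)[OF disj \<Delta>(3) FG(5) simplicial_complexD(2)[OF \<Gamma>(1)] FG(6)]
          join_unique(1)[OF disj FG(1,5,2,6)] by auto
      then have "F \<in> link \<Delta> {x}" using FG simplicial_complexD(3)[OF \<Delta>(1) FG(5)] by (auto simp: link_vertex)
      then show "H \<in> join (link \<Delta> {x}) \<Gamma>" using FG joinI by auto
    qed
  qed
  have disj': "\<Union>(deletion \<Delta> x) \<inter> \<Union>\<Gamma> = {}" using disj by (auto simp: deletion_def)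
  show ?thesis
  proof (rule vertex_decomposable.shedding)
    show "simplicial_complex (join \<Delta> \<Gamma>)" by (rule join_complex[OF \<Delta>(1) \<Gamma>(1)])
    show "pure_complex (join \<Delta> \<Gamma>)" by (rule join_pure[OF \<Delta>(1) \<Gamma>(1) \<Delta>(2) \<Gamma>(2) disj])
    show "{x} \<in> join \<Delta> \<Gamma>" using joinI[OF \<Delta>(3) simplicial_complexD(2)[OF \<Gamma>(1)]] by simp
    show "vertex_decomposable (deletion (join \<Delta> \<Gamma>) x)" "vertex_decomposable (link (join \<Delta> \<Gamma>) {x})"
      using vd by (simp_all add: del lk)
    show "link (join \<Delta> \<Gamma>) {x} \<inter> facets (deletion (join \<Delta> \<Gamma>) x) = {}"
      unfolding lk del join_facets[OF disj']
    proof safe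
      fix F G assume FG: "F \<union> G \<in> join (link \<Delta> {x}) \<Gamma>" "F \<in> facets (deletion \<Delta> x)" "G \<in> facets \<Gamma>"
      then obtain A B where AB: "A \<in> link \<Delta> {x}" "B \<in> \<Gamma>" "F \<union> G = A \<union> B" by (auto simp: join_def)
      have "F \<in> \<Delta>" "A \<in> \<Delta>" "G \<in> \<Gamma>" using FG AB by (auto simp: facets_def deletion_def link_def)
      then have "F = A" using join_unique(1)[OF disj] AB by (metis order.refl subset_antisym)
      then show "F \<union> G \<in> {}" using AB FG \<Delta>(4) by auto
    qed
  qed
qed

text \<open>The vertices of \<open>\<Delta>\<close> are shed first; when only a simplex is left of
  it, those of \<open>\<Gamma>\<close> follow.\<close>

lemma vertex_decomposable_join:
  assumes "vertex_decomposable \<Delta>" "vertex_decomposable \<Gamma>" "\<Union>\<Delta> \<inter> \<Union>\<Gamma> = {}"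
  shows "vertex_decomposable (join \<Delta> \<Gamma>)"
  using assms
proof (induction \<Delta> rule: vertex_decomposable.induct)
  case (simplex V)
  from simplex.prems simplex.hyps show ?case
  proof (induction \<Gamma> rule: vertex_decomposable.induct)
    case (simplex W)
    have "join (Pow V) (Pow W) = Pow (V \<union> W)"
    proof
      show "Pow (V \<union> W) \<subseteq> join (Pow V) (Pow W)"
      proof
        fix X assume "X \<in> Pow (V \<union> W)"
        then have "X = (X \<inter> V) \<union> (X \<inter> W)" by auto
        then show "X \<in> join (Pow V) (Pow W)" using joinI[of "X \<inter> V" "Pow V" "X \<inter> W" "Pow W"] by auto
      qed
    qed (auto simp: join_def)
    then show ?case using simplex by (simp add: vertex_decomposable.simplex)
  next
    case (shedding \<Gamma> x)
    have V: "vertex_decomposable (Pow V)" by (rule vertex_decomposable.simplex[OF shedding.prems(2)])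
    have "\<Union>(Pow V) \<inter> \<Union>(deletion \<Gamma> x) = {}" "\<Union>(Pow V) \<inter> \<Union>(link \<Gamma> {x}) = {}"
      using shedding.prems(1) by (auto simp: deletion_def link_def)
    then have "vertex_decomposable (join (deletion \<Gamma> x) (Pow V))" "vertex_decomposable (join (link \<Gamma> {x}) (Pow V))"
      using shedding.IH shedding.prems(2) by (auto simp: join_commute[of _ "Pow V"])
    then show ?case
      using join_shedding[OF shedding.hyps(1-3,6), of "Pow V"] vertex_decomposable_imp[OF V] shedding.prems(1)
      by (simp add: join_commute[of _ "Pow V"] Int_commute)
  qed
next
  case (shedding \<Delta> x)
  have "\<Union>(deletion \<Delta> x) \<inter> \<Union>\<Gamma> = {}" "\<Union>(link \<Delta> {x}) \<inter> \<Union>\<Gamma> = {}"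
    using shedding.prems(2) by (auto simp: deletion_def link_def)
  then show ?case
    using join_shedding[OF shedding.hyps(1-3,6)] vertex_decomposable_imp[OF shedding.prems(1)]
      shedding.prems shedding.IH by blast
qed

section \<open>Vertex decomposable complexes are shellable\<close>

text \<open>The shedding condition ensures that a facet of the deletion cannot be enlarged by
  \<open>x\<close>.\<close>

lemma facets_shedding:
  assumes \<Delta>: "simplicial_complex \<Delta>" "link \<Delta> {x} \<inter> facets (deletion \<Delta> x) = {}"
  shows "facets \<Delta> = facets (deletion \<Delta> x) \<union> insert x ` facets (link \<Delta> {x})"
proof
  note sc = simplicial_complexD[OF \<Delta>(1)]
  show "facets \<Delta> \<subseteq> facets (deletion \<Delta> x) \<union> insert x ` facets (link \<Delta> {x})"
  proof
    fix F assume F: "F \<in> facets \<Delta>"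
    show "F \<in> facets (deletion \<Delta> x) \<union> insert x ` facets (link \<Delta> {x})"
    proof (cases "x \<in> F")
      case True
      have "F - {x} \<in> facets (link \<Delta> {x})"
        unfolding facets_def
      proof (intro CollectI conjI ballI impI)
        show "F - {x} \<in> link \<Delta> {x}"
          using True facetsD(1)[OF F] sc(3)[OF facetsD(1)[OF F], of "F - {x}"] by (auto simp: link_vertex insert_absorb)
        fix G assume G: "G \<in> link \<Delta> {x}" "F - {x} \<subseteq> G"
        then have "insert x G = F" using facetsD(2)[OF F, of "insert x G"] by (auto simp: link_vertex)
        then show "G = F - {x}" using G by (auto simp: link_vertex)
      qed
      then show ?thesis using True by (auto intro!: image_eqI[of _ _ "F - {x}"])
    qed (use F in \<open>auto simp: facets_def deletion_def\<close>)
  qed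
  show "facets (deletion \<Delta> x) \<union> insert x ` facets (link \<Delta> {x}) \<subseteq> facets \<Delta>"
  proof safe
    fix F assume F: "F \<in> facets (deletion \<Delta> x)"
    have F\<Delta>: "F \<in> \<Delta>" "x \<notin> F" using F by (auto simp: facets_def deletion_def)
    have "G = F" if G: "G \<in> \<Delta>" "F \<subseteq> G" for G
    proof (cases "x \<in> G")
      case True
      have "G - {x} \<in> deletion \<Delta> x" using sc(3)[OF G(1), of "G - {x}"] by (auto simp: deletion_def)
      then have "G - {x} = F" using facetsD(2)[OF F] G F\<Delta> by auto
      then have "F \<in> link \<Delta> {x}" using F\<Delta> G True by (auto simp: link_vertex insert_absorb)
      then show ?thesis using \<Delta>(2) F by auto
    next
      case False
      then show ?thesis using facetsD(2)[OF F] G by (auto simp: deletion_def)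
    qed
    then show "F \<in> facets \<Delta>" using F\<Delta>(1) unfolding facets_def by blast
  next
    fix F assume F: "F \<in> facets (link \<Delta> {x})"
    have F\<Delta>: "insert x F \<in> \<Delta>" "x \<notin> F" using F by (auto simp: facets_def link_vertex)
    have "G = insert x F" if G: "G \<in> \<Delta>" "insert x F \<subseteq> G" for G
    proof -
      have "G - {x} \<in> link \<Delta> {x}" using sc(3)[OF G(1), of "G - {x}"] G by (auto simp: link_vertex insert_absorb)
      then have "G - {x} = F" using facetsD(2)[OF F] G F\<Delta> by auto
      then show ?thesis using G by auto
    qed
    then show "insert x F \<in> facets \<Delta>" using F\<Delta>(1) unfolding facets_def by blast
  qed
qed

text \<open>The facets without \<open>x\<close> come first. A facet \<open>insert x H\<close> meets
  each of them inside \<open>H\<close>, which is itself contained in one of them; against facets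
  that contain \<open>x\<close> the shelling of the link applies.\<close>

lemma vertex_decomposable_shelling:
  assumes "vertex_decomposable \<Delta>"
  shows "\<exists>Fs. distinct Fs \<and> set Fs = facets \<Delta> \<and> shelling Fs"
  using assms
proof (induction rule: vertex_decomposable.induct)
  case (simplex V)
  show ?case by (intro exI[of _ "[V]"]) (auto simp: facets_Pow shelling_def)
next
  case (shedding \<Delta> x)
  obtain Fs where Fs: "distinct Fs" "set Fs = facets (deletion \<Delta> x)" "shelling Fs" using shedding.IH(1) by blast
  obtain Gs where Gs: "distinct Gs" "set Gs = facets (link \<Delta> {x})" "shelling Gs" using shedding.IH(2) by blast
  have G: "G \<in> deletion \<Delta> x" "x \<notin> G" if "G \<in> set Gs" for G
    using that Gs(2) by (auto simp: facets_def link_vertex deletion_def)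
  have F: "x \<notin> F" if "F \<in> set Fs" for F
    using that Fs(2) by (auto simp: facets_def deletion_def)
  have dc: "simplicial_complex (deletion \<Delta> x)" by (rule deletion_complex[OF shedding.hyps(1)])
  have "shelling (Fs @ map (insert x) Hs)" if "shelling Hs" "set Hs \<subseteq> set Gs" for Hs
    using that
  proof (induction Hs rule: rev_induct)
    case (snoc H Hs)
    have HG: "H \<in> set Gs" using snoc.prems by auto
    have "\<exists>K'\<in>set (Fs @ map (insert x) Hs). \<exists>v\<in>insert x H. v \<notin> K \<and> insert x H - {v} \<subseteq> K'"
      if K: "K \<in> set (Fs @ map (insert x) Hs)" for K
    proof (cases "K \<in> set Fs")
      case True
      obtain K' where "K' \<in> set Fs" "H \<subseteq> K'" using face_in_facet[OF dc G(1)[OF HG]] Fs(2) by auto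
      then show ?thesis using F[OF True] by (intro bexI[of _ K'] bexI[of _ x]) auto
    next
      case False
      then obtain L where L: "L \<in> set Hs" "K = insert x L" using K by auto
      then obtain L' v where "L' \<in> set Hs" "v \<in> H" "v \<notin> L" "H - {v} \<subseteq> L'"
        using snoc.prems(1) unfolding shelling_snoc by blast
      then show ?thesis using L(2) G(2)[OF HG] by (intro bexI[of _ "insert x L'"] bexI[of _ v]) auto
    qed
    then have "shelling ((Fs @ map (insert x) Hs) @ [insert x H])"
      unfolding shelling_snoc using snoc by (auto simp: shelling_snoc)
    then show ?case by simp
  qed (use Fs in simp)
  from this[OF Gs(3)] have "shelling (Fs @ map (insert x) Gs)" by simp
  moreover have "distinct (Fs @ map (insert x) Gs)"
    using Fs(1) Gs(1) F G(2) by (auto simp: distinct_map inj_on_def insert_ident)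
  moreover have "set (Fs @ map (insert x) Gs) = facets \<Delta>"
    using facets_shedding[OF shedding.hyps(1,6)] Fs(2) Gs(2) by simp
  ultimately show ?case by blast
qed

lemma shelling_imp_shellable:
  assumes \<Delta>: "simplicial_complex \<Delta>" "pure_complex \<Delta>"
    and Fs: "distinct Fs" "set Fs = facets \<Delta>" "shelling Fs"
  shows "shellable \<Delta>"
proof -
  note sc = simplicial_complexD[OF \<Delta>(1)]
  have "pure_complex \<Gamma> \<and> complex_dim \<Gamma> = complex_dim \<Delta> - 1"
    if i: "0 < i" "i < length Fs" and \<Gamma>: "\<Gamma> = (\<Union>j<i. Pow (Fs ! j)) \<inter> Pow (Fs ! i)" for i \<Gamma>
  proof -
    let ?F = "Fs ! i"
    define n where "n = card ?F"
    have F: "?F \<in> facets \<Delta>" using i Fs(2) nth_mem by blast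
    have finF: "finite ?F" using sc(4) facetsD(1)[OF F] by blast
    have "card G \<le> n" if G: "G \<in> \<Delta>" for G
    proof -
      obtain H where H: "H \<in> facets \<Delta>" "G \<subseteq> H" using face_in_facet[OF \<Delta>(1) G] .
      have "card H = n" using \<Delta>(2) F H(1) unfolding pure_complex_def n_def by blast
      then show ?thesis using card_mono[OF sc(4)[OF facetsD(1)[OF H(1)]] H(2)] by simp
    qed
    then have "Max (card ` \<Delta>) = n"
      using sc(5) facetsD(1)[OF F] by (intro Max_eqI) (auto simp: n_def)
    then have dim\<Delta>: "complex_dim \<Delta> = int n - 1" by (simp add: complex_dim_def)
    \<comment> \<open>Every face of \<open>\<Gamma>\<close> lies in a face that lacks a single
      vertex of \<open>?F\<close>; purity and the dimension both follow from this.\<close>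
    have sub: "\<exists>v\<in>?F. G \<subseteq> ?F - {v} \<and> ?F - {v} \<in> \<Gamma>" if G: "G \<in> \<Gamma>" for G
    proof -
      obtain j where j: "j < i" "G \<subseteq> Fs ! j" "G \<subseteq> ?F" using G \<Gamma> by auto
      then obtain k v where "k < i" "v \<in> ?F" "v \<notin> Fs ! j" "?F - {v} \<subseteq> Fs ! k"
        using Fs(3) i(2) unfolding shelling_def by blast
      then show ?thesis using j unfolding \<Gamma> by (intro bexI[of _ v]) auto
    qed
    have finG: "finite \<Gamma>" unfolding \<Gamma> using finF by auto
    have cardF: "card (?F - {v}) = n - 1" if "v \<in> ?F" for v using that finF by (simp add: n_def)
    have "card G = n - 1" if G: "G \<in> facets \<Gamma>" for G
    proof -
      obtain v where "v \<in> ?F" "G \<subseteq> ?F - {v}" "?F - {v} \<in> \<Gamma>" using sub[OF facetsD(1)[OF G]] by blast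
      then show ?thesis using facetsD(2)[OF G] cardF by metis
    qed
    then have "pure_complex \<Gamma>" by (auto simp: pure_complex_def)
    moreover have "{} \<in> \<Gamma>" using i \<Gamma> by auto
    then obtain v where v: "v \<in> ?F" "?F - {v} \<in> \<Gamma>" using sub by blast
    have "card G \<le> n - 1" if G: "G \<in> \<Gamma>" for G
    proof -
      obtain w where "w \<in> ?F" "G \<subseteq> ?F - {w}" using sub[OF G] by blast
      then show ?thesis using card_mono[of "?F - {w}" G] cardF finF by auto
    qed
    then have "Max (card ` \<Gamma>) = n - 1"
      using finG v cardF[OF v(1)] by (intro Max_eqI) (auto intro: image_eqI[of _ _ "?F - {v}"])
    moreover have "n > 0" using v(1) finF card_gt_0_iff by (auto simp: n_def)
    ultimately show ?thesis using dim\<Delta> by (simp add: complex_dim_def[of \<Gamma>] of_nat_diff)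
  qed
  then show ?thesis unfolding shellable_def Let_def using assms by blast
qed

section \<open>Order complexes of families of sets\<close>

lemma order_complex_complex:
  assumes "finite Q" shows "simplicial_complex (order_complex Q)"
proof -
  have "\<Union>(order_complex Q) \<subseteq> Q" by (auto simp: order_complex_def)
  then show ?thesis using assms finite_subset
    unfolding simplicial_complex_def order_complex_def by fastforce
qed

lemma order_complex_facet_mem:
  assumes "M \<in> facets (order_complex Q)" "e \<in> Q" "\<And>c. c \<in> M \<Longrightarrow> c \<le> e \<or> e \<le> c"
  shows "e \<in> M"
proof -
  have "insert e M \<in> order_complex Q"
    using assms facetsD(1)[OF assms(1)] unfolding order_complex_def by blast
  then show ?thesis using facetsD(2)[OF assms(1), of "insert e M"] by blast
qed

lemma order_complex_antitone_image:
  fixes f :: "'a::order \<Rightarrow> 'b::order"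
  assumes "\<And>x y. x \<in> Q \<Longrightarrow> y \<in> Q \<Longrightarrow> f x \<le> f y \<longleftrightarrow> y \<le> x"
  shows "order_complex (f ` Q) = (`) f ` order_complex Q"
proof
  show "order_complex (f ` Q) \<subseteq> (`) f ` order_complex Q"
  proof
    fix C assume C: "C \<in> order_complex (f ` Q)"
    define D where "D = {x \<in> Q. f x \<in> C}"
    have "C = f ` D" using C by (auto simp: D_def order_complex_def)
    moreover have "x \<le> y \<or> y \<le> x" if "x \<in> D" "y \<in> D" for x y
    proof -
      have "f x \<le> f y \<or> f y \<le> f x" using C that by (auto simp: D_def order_complex_def)
      then show ?thesis using assms[of x y] assms[of y x] that by (auto simp: D_def)
    qed
    then have "D \<in> order_complex Q" by (auto simp: D_def order_complex_def)
    ultimately show "C \<in> (`) f ` order_complex Q" by blast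
  qed
  show "(`) f ` order_complex Q \<subseteq> order_complex (f ` Q)"
    using assms unfolding order_complex_def by (clarsimp simp: subset_iff)
qed

lemma order_complex_deletion: "deletion (order_complex Q) c = order_complex (Q - {c})"
  by (auto simp: deletion_def order_complex_def)

lemma order_complex_link:
  fixes c :: "'a::order"
  assumes "c \<in> Q"
  shows "link (order_complex Q) {c} = join (order_complex {x \<in> Q. x < c}) (order_complex {x \<in> Q. c < x})"
proof
  show "link (order_complex Q) {c} \<subseteq> join (order_complex {x \<in> Q. x < c}) (order_complex {x \<in> Q. c < x})"
  proof
    fix F assume "F \<in> link (order_complex Q) {c}"
    then have F: "F \<in> order_complex Q" "c \<notin> F" "insert c F \<in> order_complex Q" by (auto simp: link_vertex)
    have "x < c \<or> c < x" if "x \<in> F" for x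
    proof -
      have "x \<le> c \<or> c \<le> x" using F(3) that unfolding order_complex_def by blast
      moreover have "x \<noteq> c" using F(2) that by blast
      ultimately show ?thesis by auto
    qed
    then have "F = {x \<in> F. x < c} \<union> {x \<in> F. c < x}" by auto
    moreover have "{x \<in> F. x < c} \<in> order_complex {x \<in> Q. x < c}" "{x \<in> F. c < x} \<in> order_complex {x \<in> Q. c < x}"
      using F(1) by (auto simp: order_complex_def)
    ultimately show "F \<in> join (order_complex {x \<in> Q. x < c}) (order_complex {x \<in> Q. c < x})"
      using joinI[of "{x \<in> F. x < c}" _ "{x \<in> F. c < x}"] by simp
  qed
  show "join (order_complex {x \<in> Q. x < c}) (order_complex {x \<in> Q. c < x}) \<subseteq> link (order_complex Q) {c}"
  proof
    fix F assume "F \<in> join (order_complex {x \<in> Q. x < c}) (order_complex {x \<in> Q. c < x})"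
    then obtain A B where AB: "A \<in> order_complex {x \<in> Q. x < c}" "B \<in> order_complex {x \<in> Q. c < x}" "F = A \<union> B"
      by (auto simp: join_def)
    have A: "x \<in> Q" "x < c" if "x \<in> A" for x using AB(1) that by (auto simp: order_complex_def)
    have B: "x \<in> Q" "c < x" if "x \<in> B" for x using AB(2) that by (auto simp: order_complex_def)
    have cmp: "x \<le> y \<or> y \<le> x" if "x \<in> insert c F" "y \<in> insert c F" for x y
    proof -
      have "x \<le> y \<or> y \<le> x" if "x \<in> A" "y \<in> A" for x y using AB(1) that by (auto simp: order_complex_def)
      moreover have "x \<le> y \<or> y \<le> x" if "x \<in> B" "y \<in> B" for x y using AB(2) that by (auto simp: order_complex_def)
      moreover have "x \<le> y" if "x \<in> A" "y \<in> B" for x y using A(2)[OF that(1)] B(2)[OF that(2)] by order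
      moreover have "x \<le> c" if "x \<in> A" for x using A(2)[OF that] by simp
      moreover have "c \<le> x" if "x \<in> B" for x using B(2)[OF that] by simp
      ultimately show ?thesis using that unfolding AB(3) by auto
    qed
    moreover have "c \<notin> F" "insert c F \<subseteq> Q" using A B AB(3) assms by auto
    ultimately show "F \<in> link (order_complex Q) {c}" unfolding link_vertex order_complex_def by auto
  qed
qed

lemma order_complex_intervals_disjoint:
  fixes c :: "'a::order"
  shows "\<Union>(order_complex {x \<in> Q. x < c}) \<inter> \<Union>(order_complex {x \<in> Q. c < x}) = {}"
proof -
  have "x < c" if "x \<in> \<Union>(order_complex {x \<in> Q. x < c})" for x
    using that unfolding order_complex_def by blast
  moreover have "c < x" if "x \<in> \<Union>(order_complex {x \<in> Q. c < x})" for x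
    using that unfolding order_complex_def by blast
  ultimately show ?thesis by (meson disjoint_iff less_asym)
qed

lemma order_complex_cone:
  assumes "\<And>x. x \<in> Q \<Longrightarrow> x < u"
  shows "order_complex (insert u Q) = join (order_complex Q) (Pow {u})"
proof
  show "order_complex (insert u Q) \<subseteq> join (order_complex Q) (Pow {u})"
  proof
    fix F assume F: "F \<in> order_complex (insert u Q)"
    have "F = (F - {u}) \<union> (F \<inter> {u})" by auto
    moreover have "F - {u} \<in> order_complex Q" using F by (auto simp: order_complex_def)
    ultimately show "F \<in> join (order_complex Q) (Pow {u})"
      using joinI[of "F - {u}" "order_complex Q" "F \<inter> {u}" "Pow {u}"] by simp
  qed
  show "join (order_complex Q) (Pow {u}) \<subseteq> order_complex (insert u Q)"
  proof
    fix F assume "F \<in> join (order_complex Q) (Pow {u})"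
    then obtain A B where AB: "A \<in> order_complex Q" "B \<subseteq> {u}" "F = A \<union> B" by (auto simp: join_def)
    moreover have "x \<le> u" if "x \<in> A" for x using assms[of x] AB(1) that by (auto simp: order_complex_def)
    moreover have "x = u" if "x \<in> B" for x using AB(2) that by blast
    ultimately show "F \<in> order_complex (insert u Q)" unfolding order_complex_def by blast
  qed
qed

text \<open>If a maximal chain missed the cardinality \<open>k\<close>, consider its members just
  below and just above \<open>k\<close>: \<open>mid\<close> yields a set between them, or
  \<open>up\<close> one above the last member, that is comparable with the whole chain. So
  \<open>card\<close> is the colouring of the facets, and purity comes with it.\<close>

lemma facets_full:
  fixes Q :: "'a set set"
  assumes Q: "\<And>c. c \<in> Q \<Longrightarrow> finite c" "\<And>c. c \<in> Q \<Longrightarrow> card c < d" "{} \<in> Q"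
    and up: "\<And>c. c \<in> Q \<Longrightarrow> Suc (card c) < d \<Longrightarrow> \<exists>c'\<in>Q. c \<subset> c'"
    and mid: "\<And>c c'. c \<in> Q \<Longrightarrow> c' \<in> Q \<Longrightarrow> c \<subset> c' \<Longrightarrow> Suc (card c) < card c' \<Longrightarrow> \<exists>e\<in>Q. c \<subset> e \<and> e \<subset> c'"
    and M: "M \<in> facets (order_complex Q)"
  shows "bij_betw card M {..<d}"
proof -
  have MQ: "M \<subseteq> Q" and chain: "\<And>c e. c \<in> M \<Longrightarrow> e \<in> M \<Longrightarrow> c \<subseteq> e \<or> e \<subseteq> c"
    using facetsD(1)[OF M] by (auto simp: order_complex_def)
  have fin: "finite c" if "c \<in> M" for c using that MQ Q(1) by blast
  have mono: "c \<subseteq> e" if "c \<in> M" "e \<in> M" "card c \<le> card e" for c e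
    using chain[OF that(1,2)] card_seteq[OF fin[OF that(1)], of e] that(3) by auto
  have "inj_on card M" by (rule inj_onI) (metis mono order.refl subset_antisym)
  moreover have "card ` M = {..<d}"
  proof
    show "card ` M \<subseteq> {..<d}" using MQ Q(2) by auto
    show "{..<d} \<subseteq> card ` M"
    proof
      fix k assume k: "k \<in> {..<d}"
      show "k \<in> card ` M"
      proof (rule ccontr)
        assume no: "k \<notin> card ` M"
        have "card ` M \<subseteq> {..<d}" using MQ Q(2) by blast
        then have finC: "finite (card ` M)" by (rule finite_subset) simp
        have "{} \<in> M" by (rule order_complex_facet_mem[OF M Q(3)]) auto
        then have "0 \<in> card ` M" by (metis card.empty image_eqI)
        moreover have "0 < k" using \<open>0 \<in> card ` M\<close> no by (cases k) auto
        ultimately have ne: "{j \<in> card ` M. j < k} \<noteq> {}" by blast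
        define l where "l = Max {j \<in> card ` M. j < k}"
        have "l \<in> {j \<in> card ` M. j < k}" unfolding l_def using ne finC by (intro Max_in) auto
        then obtain c where c: "c \<in> M" "card c < k" "card c = l" by blast
        have lmax: "card e \<le> card c" if "e \<in> M" "card e < k" for e
          unfolding c(3) l_def using that finC by (intro Max_ge) auto
        show False
        proof (cases "\<exists>e\<in>M. k < card e")
          case False
          have le: "e \<subseteq> c" if "e \<in> M" for e
          proof (rule mono[OF that c(1)])
            have "card e \<noteq> k" using no that by blast
            moreover have "\<not> k < card e" using False that by blast
            ultimately show "card e \<le> card c" using lmax[OF that] by linarith
          qed
          obtain c' where c': "c' \<in> Q" "c \<subset> c'" using up[of c] c MQ k by auto
          have "c' \<in> M" by (rule order_complex_facet_mem[OF M c'(1)]) (use le c'(2) in blast)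
          then show False using le c'(2) by blast
        next
          case True
          then have ne: "{j \<in> card ` M. k < j} \<noteq> {}" by blast
          define h where "h = Min {j \<in> card ` M. k < j}"
          have "h \<in> {j \<in> card ` M. k < j}" unfolding h_def using ne finC by (intro Min_in) auto
          then obtain e where e: "e \<in> M" "k < card e" "card e = h" by blast
          have hmin: "card e \<le> card x" if "x \<in> M" "k < card x" for x
            unfolding e(3) h_def using that finC by (intro Min_le) auto
          have split: "x \<subseteq> c \<or> e \<subseteq> x" if "x \<in> M" for x
          proof -
            have "card x \<noteq> k" using no that by blast
            then consider "card x < k" | "k < card x" by linarith
            then show ?thesis using lmax[OF that] hmin[OF that] mono[OF that c(1)] mono[OF e(1) that] by cases auto
          qed
          have ce: "Suc (card c) < card e" "card c \<noteq> card e" using c(2) e(2) by linarith+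
          then have "c \<subset> e" using mono[OF c(1) e(1)] by auto
          then obtain f where f: "f \<in> Q" "c \<subset> f" "f \<subset> e"
            using mid[OF subsetD[OF MQ c(1)] subsetD[OF MQ e(1)]] ce(1) by blast
          have "f \<in> M" by (rule order_complex_facet_mem[OF M f(1)]) (use split f in blast)
          then show False using split f by blast
        qed
      qed
    qed
  qed
  ultimately show ?thesis by (simp add: bij_betw_def)
qed

lemma facets_full_pure:
  assumes "\<And>M. M \<in> facets (order_complex Q) \<Longrightarrow> bij_betw card M {..<d}"
  shows "pure_complex (order_complex Q)"
  using assms bij_betw_same_card unfolding pure_complex_def by metis

section \<open>Ideals of an ordinal sum of antichains\<close>

text \<open>An ordinal sum of antichains is described by a rank function \<open>\<rho>\<close>: \<open>x < y\<close> iff \<open>\<rho> x < \<rho> y\<close>.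
  Ranks are integers so that negating them gives the dual order.\<close>

definition rank_ideals :: "('a \<Rightarrow> int) \<Rightarrow> 'a set \<Rightarrow> 'a set set" where
  "rank_ideals \<rho> P = {c. c \<subseteq> P \<and> (\<forall>x\<in>c. \<forall>y\<in>P. \<rho> y < \<rho> x \<longrightarrow> y \<in> c)}"

definition avoiding :: "('a \<Rightarrow> int) \<Rightarrow> 'a set \<Rightarrow> 'a set \<Rightarrow> 'a set set" where
  "avoiding \<rho> P a = {c \<in> rank_ideals \<rho> P. \<not> a \<subseteq> c}"

lemma rank_idealsD:
  assumes "c \<in> rank_ideals \<rho> P"
  shows "c \<subseteq> P" "\<And>x y. x \<in> c \<Longrightarrow> y \<in> P \<Longrightarrow> \<rho> y < \<rho> x \<Longrightarrow> y \<in> c"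
  using assms by (auto simp: rank_ideals_def)

text \<open>An element of least rank in \<open>e - c\<close> has everything of smaller rank already
  in \<open>c\<close>.\<close>

lemma rank_ideals_step:
  assumes "finite P" "c \<in> rank_ideals \<rho> P" "e \<in> rank_ideals \<rho> P" "c \<subset> e"
  obtains x where "x \<in> e - c" "insert x c \<in> rank_ideals \<rho> P"
proof -
  have "finite (e - c)" using assms(1) rank_idealsD(1)[OF assms(3)] finite_subset by blast
  moreover have "e - c \<noteq> {}" using assms(4) by blast
  ultimately obtain x where x: "x \<in> e - c" "\<And>y. y \<in> e - c \<Longrightarrow> \<rho> x \<le> \<rho> y"
    using ex_min_if_finite[of "\<rho> ` (e - c)"] by (metis (no_types, lifting) arg_min_if_finite(1) arg_min_least)
  have "y \<in> c" if "y \<in> P" "\<rho> y < \<rho> x" for y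
    using rank_idealsD(2)[OF assms(3) _ that] x that by fastforce
  then have "insert x c \<in> rank_ideals \<rho> P"
    using assms(2,3) x(1) unfolding rank_ideals_def by blast
  then show ?thesis using that x(1) by blast
qed

lemma rank_ideals_sub:
  assumes "C \<in> rank_ideals \<rho> P"
  shows "rank_ideals \<rho> C = {c \<in> rank_ideals \<rho> P. c \<subseteq> C}"
  using assms unfolding rank_ideals_def by blast

locale top_rank =
  fixes \<rho> :: "'a \<Rightarrow> int" and P a :: "'a set" and t :: int
  assumes fin: "finite P" and a: "a \<in> rank_ideals \<rho> P"
    and top: "\<And>x. x \<in> a \<Longrightarrow> \<rho> x \<le> t"
begin

text \<open>When \<open>a\<close> has an element of rank \<open>t\<close>, the size of the maximal
  chains of \<open>avoiding \<rho> P a\<close>: they run from the empty ideal to some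
  \<open>u q\<close>, which has \<open>d - 1\<close> elements.\<close>

definition d :: nat where "d = card {x \<in> P. \<rho> x \<le> t}"

text \<open>For \<open>q\<close> in \<open>a\<close> of rank \<open>t\<close> this is the largest
  ideal without \<open>q\<close>, see \<open>below_u\<close>.\<close>

definition u :: "'a \<Rightarrow> 'a set" where "u q = {x \<in> P. \<rho> x \<le> t} - {q}"

lemma fin_mem: "c \<in> rank_ideals \<rho> P \<Longrightarrow> finite c"
  by (rule finite_subset[OF rank_idealsD(1) fin])

lemma aP: "a \<subseteq> P" using rank_idealsD(1)[OF a] .

lemma u_ideal: "\<rho> q = t \<Longrightarrow> u q \<in> rank_ideals \<rho> P"
  by (auto simp: u_def rank_ideals_def)

lemma card_u: "q \<in> a \<Longrightarrow> Suc (card (u q)) = d"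
  using aP top fin unfolding u_def d_def by (subst card_Suc_Diff1) auto

lemma below_u:
  assumes "c \<in> rank_ideals \<rho> P" "q \<in> a" "\<rho> q = t" "q \<notin> c"
  shows "c \<subseteq> u q"
proof
  fix x assume x: "x \<in> c"
  have "\<not> t < \<rho> x" using rank_idealsD(2)[OF assms(1) x, of q] assms aP by auto
  then show "x \<in> u q" using x assms(1,4) rank_idealsD(1) unfolding u_def by fastforce
qed

text \<open>An ideal containing one element of top rank contains everything of lower rank, so
  whatever it misses in \<open>b\<close> has top rank too.\<close>

lemma missing_top:
  assumes "c \<in> rank_ideals \<rho> P" "b \<subseteq> a" "\<not> b \<subseteq> c" "p \<in> b" "\<rho> p = t"
  obtains q where "q \<in> b" "\<rho> q = t" "q \<notin> c"
proof -
  obtain x where x: "x \<in> b" "x \<notin> c" using assms(3) by blast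
  show ?thesis
  proof (cases "p \<in> c \<and> \<rho> x \<noteq> t")
    case True
    then have "\<rho> x < \<rho> p" using x assms top by force
    then show ?thesis using rank_idealsD(2)[OF assms(1), of p x] True x assms(2) aP by blast
  qed (use that x assms in auto)
qed

lemma card_less_d: "c \<in> rank_ideals \<rho> P \<Longrightarrow> q \<in> a \<Longrightarrow> \<rho> q = t \<Longrightarrow> q \<notin> c \<Longrightarrow> card c < d"
  using card_mono[OF fin_mem[OF u_ideal] below_u] card_u by (metis less_Suc_eq_le)

lemma extend:
  assumes "c \<in> rank_ideals \<rho> P" "q \<in> a" "\<rho> q = t" "q \<notin> c" "Suc (card c) < d"
  obtains x where "x \<notin> c" "x \<noteq> q" "insert x c \<in> rank_ideals \<rho> P"
proof -
  have "c \<noteq> u q" using assms card_u by fastforce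
  then have "c \<subset> u q" using below_u assms by blast
  then obtain x where "x \<in> u q - c" "insert x c \<in> rank_ideals \<rho> P"
    using rank_ideals_step[OF fin assms(1) u_ideal[OF assms(3)]] by blast
  then show ?thesis using that by (auto simp: u_def)
qed

lemma avoiding_full:
  assumes p: "p \<in> a" "\<rho> p = t" and M: "M \<in> facets (order_complex (avoiding \<rho> P a))"
  shows "bij_betw card M {..<d}"
proof (rule facets_full[OF _ _ _ _ _ M])
  show "finite c" if "c \<in> avoiding \<rho> P a" for c using that fin_mem by (simp add: avoiding_def)
  show "card c < d" if c: "c \<in> avoiding \<rho> P a" for c
  proof -
    obtain q where "q \<in> a" "\<rho> q = t" "q \<notin> c" using missing_top[of c a p] c p by (auto simp: avoiding_def)
    then show ?thesis using card_less_d c by (auto simp: avoiding_def)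
  qed
  show "{} \<in> avoiding \<rho> P a" using p by (auto simp: avoiding_def rank_ideals_def)
  show "\<exists>c'\<in>avoiding \<rho> P a. c \<subset> c'" if c: "c \<in> avoiding \<rho> P a" "Suc (card c) < d" for c
  proof -
    obtain q where q: "q \<in> a" "\<rho> q = t" "q \<notin> c" using missing_top[of c a p] c p by (auto simp: avoiding_def)
    obtain x where "x \<notin> c" "x \<noteq> q" "insert x c \<in> rank_ideals \<rho> P"
      using extend[OF _ q c(2)] c(1) by (auto simp: avoiding_def)
    then show ?thesis using q by (intro bexI[of _ "insert x c"]) (auto simp: avoiding_def)
  qed
  show "\<exists>e\<in>avoiding \<rho> P a. c \<subset> e \<and> e \<subset> c'"
    if c: "c \<in> avoiding \<rho> P a" "c' \<in> avoiding \<rho> P a" "c \<subset> c'" "Suc (card c) < card c'" for c c'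
  proof -
    obtain x where x: "x \<in> c' - c" "insert x c \<in> rank_ideals \<rho> P"
      using rank_ideals_step[OF fin _ _ c(3)] c(1,2) by (auto simp: avoiding_def)
    have "card (insert x c) \<noteq> card c'" using c(4) x(1) fin_mem c(1) by (auto simp: avoiding_def)
    then have "insert x c \<subset> c'" using x(1) c(3) by blast
    then show ?thesis using x c(2) by (intro bexI[of _ "insert x c"]) (auto simp: avoiding_def)
  qed
qed

end

text \<open>When \<open>p\<close> is not the only element of top rank in \<open>a\<close>, the interval \<open>E\<close> from \<open>a - {p}\<close> to \<open>u p\<close>
  is what \<open>avoiding \<rho> P a\<close> has in excess of \<open>avoiding \<rho> P (a - {p})\<close>.  Its elements are shed from the
  bottom up.\<close>

locale top_rank_step = top_rank +
  fixes p p'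
  assumes p: "p \<in> a" "\<rho> p = t" and p': "p' \<in> a" "p' \<noteq> p" "\<rho> p' = t"
begin

definition E :: "'a set set" where "E = {c \<in> rank_ideals \<rho> P. a - {p} \<subseteq> c \<and> p \<notin> c}"

lemma avoiding_split: "avoiding \<rho> P a = avoiding \<rho> P (a - {p}) \<union> E"
  using p(1) by (auto simp: avoiding_def E_def)

lemma a'_ideal: "a - {p} \<in> rank_ideals \<rho> P"
  using rank_idealsD[OF a] top p(2) unfolding rank_ideals_def by force

text \<open>Purity has to hold at every stage \<open>W\<close> of the shedding. The delicate gap
  lies between some \<open>c\<close> outside \<open>W\<close> and some \<open>c'\<close> in
  \<open>W\<close>: enlarging \<open>c\<close> could lead into \<open>E\<close> outside
  \<open>W\<close>, so \<open>c'\<close> is reduced instead.\<close>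

lemma union_full:
  assumes W: "W \<subseteq> E" "\<And>c c'. c \<in> W \<Longrightarrow> c' \<in> E \<Longrightarrow> c \<subseteq> c' \<Longrightarrow> c' \<in> W"
    and M: "M \<in> facets (order_complex (avoiding \<rho> P (a - {p}) \<union> W))" (is "_ \<in> facets (order_complex ?Q)")
  shows "bij_betw card M {..<d}"
proof (rule facets_full[OF _ _ _ _ _ M])
  have QI: "c \<in> rank_ideals \<rho> P" if "c \<in> ?Q" for c using that W(1) by (auto simp: avoiding_def E_def)
  show "finite c" if "c \<in> ?Q" for c using QI[OF that] fin_mem by simp
  have miss: "\<exists>q\<in>a - {p}. \<rho> q = t \<and> q \<notin> c" if c: "c \<in> avoiding \<rho> P (a - {p})" for c
    using missing_top[of c "a - {p}" p'] c p' by (auto simp: avoiding_def)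
  show "card c < d" if c: "c \<in> ?Q" for c
  proof (cases "c \<in> W")
    case True
    then show ?thesis using card_less_d[OF QI[OF c] p] W(1) by (auto simp: E_def)
  next
    case False
    then show ?thesis using miss[of c] c card_less_d[OF QI[OF c]] by auto
  qed
  show "{} \<in> ?Q" using p' by (auto simp: avoiding_def rank_ideals_def)
  show "\<exists>c'\<in>?Q. c \<subset> c'" if c: "c \<in> ?Q" "Suc (card c) < d" for c
  proof (cases "c \<in> W")
    case True
    then have cE: "c \<in> E" using W(1) by blast
    obtain x where x: "x \<notin> c" "x \<noteq> p" "insert x c \<in> rank_ideals \<rho> P"
      using extend[OF QI[OF c(1)] p _ c(2)] cE by (auto simp: E_def)
    then have "insert x c \<in> W" using cE by (intro W(2)[OF True]) (auto simp: E_def)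
    then show ?thesis using x by (intro bexI[of _ "insert x c"]) auto
  next
    case False
    then obtain q where q: "q \<in> a - {p}" "\<rho> q = t" "q \<notin> c" using miss[of c] c by auto
    obtain x where x: "x \<notin> c" "x \<noteq> q" "insert x c \<in> rank_ideals \<rho> P"
      using extend[OF QI[OF c(1)] _ q(2,3) c(2)] q(1) by auto
    then have "insert x c \<in> avoiding \<rho> P (a - {p})" using q by (auto simp: avoiding_def)
    then show ?thesis using x by (intro bexI[of _ "insert x c"]) auto
  qed
  show "\<exists>e\<in>?Q. c \<subset> e \<and> e \<subset> c'"
    if c: "c \<in> ?Q" "c' \<in> ?Q" "c \<subset> c'" "Suc (card c) < card c'" for c c'
  proof -
    have up: "\<exists>x. insert x c \<in> rank_ideals \<rho> P \<and> c \<subset> insert x c \<and> insert x c \<subset> c'"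
    proof -
      obtain x where x: "x \<in> c' - c" "insert x c \<in> rank_ideals \<rho> P"
        using rank_ideals_step[OF fin QI[OF c(1)] QI[OF c(2)] c(3)] by blast
      have "card (insert x c) \<noteq> card c'" using c(4) x(1) fin_mem[OF QI[OF c(1)]] by auto
      then have "insert x c \<subset> c'" using x(1) c(3) by blast
      then show ?thesis using x by blast
    qed
    show ?thesis
    proof (cases "c' \<in> W")
      case False
      then have "c' \<in> avoiding \<rho> P (a - {p})" using c by auto
      then show ?thesis using up unfolding avoiding_def by blast
    next
      case True
      then have c'E: "c' \<in> E" using W(1) by blast
      show ?thesis
      proof (cases "c \<in> W")
        case True
        then have cE: "c \<in> E" using W(1) by blast
        obtain x where x: "insert x c \<in> rank_ideals \<rho> P" "c \<subset> insert x c" "insert x c \<subset> c'" using up by blast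
        then have "insert x c \<in> W" using cE c'E by (intro W(2)[OF True]) (auto simp: E_def)
        then show ?thesis using x by blast
      next
        case False
        then obtain q where q: "q \<in> a - {p}" "\<rho> q = t" "q \<notin> c" using miss[of c] c by auto
        \<comment> \<open>All ranks in \<open>c'\<close> are at most \<open>t\<close>, so removing
          the top-rank element \<open>q\<close> from \<open>c'\<close> leaves an ideal, and one that
          avoids \<open>a - {p}\<close>.\<close>
        have qc': "q \<in> c'" using c'E q by (auto simp: E_def)
        have "\<rho> x \<le> t" if "x \<in> c'" for x
          using below_u[OF QI[OF c(2)] p] c'E that by (auto simp: E_def u_def)
        then have "c' - {q} \<in> rank_ideals \<rho> P"
          using rank_idealsD[OF QI[OF c(2)]] q(2) unfolding rank_ideals_def by force
        then have "c' - {q} \<in> ?Q" using q(1) by (auto simp: avoiding_def)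
        moreover have "c \<noteq> c' - {q}" using c(4) card_Suc_Diff1[OF fin_mem[OF QI[OF c(2)]] qc'] by auto
        then have "c \<subset> c' - {q}" using c(3) q(3) by blast
        ultimately show ?thesis using qc' by blast
      qed
    qed
  qed
qed

text \<open>Complements in \<open>u p\<close> reverse inclusion and turn ideals above
  \<open>C\<close> into ideals of \<open>u p - C\<close> for the negated ranks; \<open>C\<close>
  itself corresponds to the whole set, the one ideal excluded.\<close>

lemma upper_interval:
  assumes C: "C \<in> E"
  shows "{c \<in> E. C \<subset> c} = (\<lambda>e. u p - e) ` avoiding (\<lambda>x. - \<rho> x) (u p - C) (u p - C)" (is "_ = ?R")
proof
  have CI: "C \<in> rank_ideals \<rho> P" "a - {p} \<subseteq> C" "p \<notin> C" using C by (auto simp: E_def)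
  note CD = rank_idealsD[OF CI(1)]
  show "{c \<in> E. C \<subset> c} \<subseteq> ?R"
  proof
    fix c assume "c \<in> {c \<in> E. C \<subset> c}"
    then have c: "c \<in> rank_ideals \<rho> P" "p \<notin> c" "C \<subset> c" by (auto simp: E_def)
    have cu: "c \<subseteq> u p" by (rule below_u[OF c(1) p c(2)])
    have "u p - c \<in> avoiding (\<lambda>x. - \<rho> x) (u p - C) (u p - C)"
      unfolding avoiding_def rank_ideals_def
      using c(3) cu rank_idealsD[OF c(1)] by (auto simp: u_def)
    moreover have "c = u p - (u p - c)" using cu by blast
    ultimately show "c \<in> ?R" by blast
  qed
  show "?R \<subseteq> {c \<in> E. C \<subset> c}"
  proof
    fix c assume "c \<in> ?R"
    then obtain e where e: "c = u p - e" "e \<subseteq> u p - C" "\<not> u p - C \<subseteq> e"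
      "\<And>x y. x \<in> e \<Longrightarrow> y \<in> u p - C \<Longrightarrow> \<rho> x < \<rho> y \<Longrightarrow> y \<in> e"
      by (auto simp: avoiding_def rank_ideals_def)
    have Cu: "C \<subseteq> u p" by (rule below_u[OF CI(1) p CI(3)])
    have "c \<in> rank_ideals \<rho> P" unfolding rank_ideals_def
    proof (intro CollectI conjI ballI impI)
      show "c \<subseteq> P" using e(1) by (auto simp: u_def)
      fix x y assume xy: "x \<in> c" "y \<in> P" "\<rho> y < \<rho> x"
      then have "y \<in> u p" using e(1) p(2) by (auto simp: u_def)
      moreover have "y \<notin> e"
      proof
        assume y: "y \<in> e"
        then have "x \<in> C" using e(4)[OF y, of x] xy e(1) by blast
        then show False using CD(2)[OF _ xy(2,3)] e(2) y by blast
      qed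
      ultimately show "y \<in> c" using e(1) by blast
    qed
    moreover have "C \<subset> c" using e Cu by blast
    moreover have "p \<notin> c" using e(1) by (auto simp: u_def)
    ultimately show "c \<in> {c \<in> E. C \<subset> c}" using CI(2) by (auto simp: E_def)
  qed
qed

lemma lower_interval:
  assumes "C \<in> E"
  shows "{c \<in> avoiding \<rho> P (a - {p}). c \<subset> C} = avoiding \<rho> C (a - {p})"
  using assms rank_ideals_sub[of C \<rho> P] unfolding avoiding_def E_def by auto

end

lemma finite_rank_ideals: "finite P \<Longrightarrow> finite (rank_ideals \<rho> P)"
  by (rule finite_subset[of _ "Pow P"]) (auto simp: rank_ideals_def)

lemma finite_avoiding: "finite P \<Longrightarrow> finite (avoiding \<rho> P a)"
  using finite_rank_ideals[of P \<rho>] by (simp add: avoiding_def)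

text \<open>Nested inductions on \<open>card P\<close>, on \<open>card a\<close> and on the number
  of elements of \<open>E\<close> present. The outermost one ranges over all rank functions, so that
  it covers both intervals in the link of a shed ideal \<open>C\<close>, the upper one with negated
  ranks.\<close>

theorem avoiding_vertex_decomposable:
  assumes "finite P" "a \<in> rank_ideals \<rho> P"
  shows "vertex_decomposable (order_complex (avoiding \<rho> P a))"
  using assms
proof (induction "card P" arbitrary: P a \<rho> rule: less_induct)
  case (less P)
  note outer = less.hyps and finP = less.prems(1)
  show ?case using less.prems(2)
  proof (induction "card a" arbitrary: a rule: less_induct)
    case (less a)
    show ?case
    proof (cases "a = {}")
      case True
      then have "order_complex (avoiding \<rho> P a) = Pow {}" by (auto simp: avoiding_def order_complex_def)
      then show ?thesis by (simp only: vertex_decomposable.simplex finite.emptyI)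
    next
      case False
      have fina: "finite a" using finite_subset[OF rank_idealsD(1)[OF less.prems] finP] .
      define t where "t = Max (\<rho> ` a)"
      have "t \<in> \<rho> ` a" unfolding t_def using fina False by (intro Max_in) auto
      then obtain p where p: "p \<in> a" "\<rho> p = t" by auto
      interpret top_rank \<rho> P a t
        by unfold_locales (use finP less.prems fina in \<open>auto simp: t_def\<close>)
      have up: "u p \<in> rank_ideals \<rho> P" by (rule u_ideal[OF p(2)])
      have finu: "finite (u p)" using fin_mem[OF up] .
      have "u p \<subset> P" using p aP by (auto simp: u_def)
      then have card_up: "card (u p) < card P" by (rule psubset_card_mono[OF finP])
      show ?thesis
      proof (cases "\<exists>p'\<in>a. p' \<noteq> p \<and> \<rho> p' = t")
        case False
        \<comment> \<open>With \<open>p\<close> alone at the top of \<open>a\<close>, avoiding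
          \<open>a\<close> amounts to avoiding \<open>p\<close>; then \<open>u p\<close> is the
          largest member, and the complex is a cone over one for the smaller ground set
          \<open>u p\<close>.\<close>
        have "avoiding \<rho> P a = {c \<in> rank_ideals \<rho> P. p \<notin> c}"
        proof
          show "avoiding \<rho> P a \<subseteq> {c \<in> rank_ideals \<rho> P. p \<notin> c}"
          proof
            fix c assume c: "c \<in> avoiding \<rho> P a"
            then obtain q where "q \<in> a" "\<rho> q = t" "q \<notin> c" using missing_top[of c a p] p by (auto simp: avoiding_def)
            then show "c \<in> {c \<in> rank_ideals \<rho> P. p \<notin> c}" using False c by (auto simp: avoiding_def)
          qed
        qed (use p in \<open>auto simp: avoiding_def\<close>)
        also have "\<dots> = rank_ideals \<rho> (u p)"
          unfolding rank_ideals_sub[OF up] using below_u p by (auto simp: u_def)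
        also have "\<dots> = insert (u p) (avoiding \<rho> (u p) (u p))"
          by (auto simp: avoiding_def rank_ideals_def)
        finally have eq: "avoiding \<rho> P a = insert (u p) (avoiding \<rho> (u p) (u p))" .
        have less_u: "c < u p" if "c \<in> avoiding \<rho> (u p) (u p)" for c
          using that by (auto simp: avoiding_def rank_ideals_def)
        have "vertex_decomposable (order_complex (avoiding \<rho> (u p) (u p)))"
          by (rule outer[OF card_up finu]) (auto simp: rank_ideals_def)
        moreover have "vertex_decomposable (Pow {u p})" by (rule vertex_decomposable.simplex) simp
        moreover have "\<Union>(order_complex (avoiding \<rho> (u p) (u p))) \<inter> \<Union>(Pow {u p}) = {}"
          using less_u by (auto simp: order_complex_def)
        moreover have "order_complex (insert (u p) (avoiding \<rho> (u p) (u p))) =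
            join (order_complex (avoiding \<rho> (u p) (u p))) (Pow {u p})"
          by (rule order_complex_cone) (rule less_u)
        ultimately show ?thesis unfolding eq by (simp only: vertex_decomposable_join)
      next
        case True
        then obtain p' where p': "p' \<in> a" "p' \<noteq> p" "\<rho> p' = t" by blast
        interpret top_rank_step \<rho> P a t p p' by unfold_locales (use p p' in auto)
        let ?a = "a - {p}"
        let ?T = "avoiding \<rho> P ?a"
        have "card ?a < card a" using fina p(1) by (rule card_Diff1_less)
        then have base: "vertex_decomposable (order_complex ?T)" using less.hyps a'_ideal by blast
        have finE: "finite E" unfolding E_def using finite_rank_ideals[OF finP] by auto
        have "vertex_decomposable (order_complex (?T \<union> W))"
          if "W \<subseteq> E" "\<And>c c'. c \<in> W \<Longrightarrow> c' \<in> E \<Longrightarrow> c \<subseteq> c' \<Longrightarrow> c' \<in> W" for W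
          using that
        proof (induction "card W" arbitrary: W)
          case 0
          then have "W = {}" using finite_subset[OF _ finE] by auto
          then show ?case using base by simp
        next
          case (Suc n)
          note WE = Suc.prems(1) and Wup = Suc.prems(2)
          let ?Q = "?T \<union> W"
          have finW: "finite W" using finite_subset[OF WE finE] .
          have "W \<noteq> {}" using Suc.hyps(2) by auto
          \<comment> \<open>With \<open>C\<close> minimal in \<open>W\<close> the rest of
            \<open>W\<close> is still upward closed in \<open>E\<close>, and below \<open>C\<close>
            only members of \<open>?T\<close> remain.\<close>
          then obtain C where C: "C \<in> W" and Cmin: "\<And>c. c \<in> W \<Longrightarrow> c \<subseteq> C \<Longrightarrow> c = C"
            using finite_has_minimal[OF finW] by metis
          have CE: "C \<in> E" using C WE by blast
          have CT: "C \<notin> ?T" using CE by (auto simp: E_def avoiding_def)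
          have finQ: "finite ?Q" using finite_avoiding[OF finP] finW by auto
          have up': "c' \<in> W - {C}" if "c \<in> W - {C}" "c' \<in> E" "c \<subseteq> c'" for c c'
            using that Wup[of c c'] Cmin[of c] by blast
          have Q': "?Q - {C} = ?T \<union> (W - {C})" using CT by blast
          have full: "bij_betw card M {..<d}" if "M \<in> facets (order_complex ?Q)" for M
            by (rule union_full[OF WE Wup that])
          have full': "bij_betw card M {..<d}" if "M \<in> facets (order_complex (?Q - {C}))" for M
            by (rule union_full[OF _ up' that[unfolded Q']]) (use WE in auto)
          have lower: "{c \<in> ?Q. c < C} = avoiding \<rho> C ?a"
            unfolding lower_interval[OF CE, symmetric] using Cmin by auto
          have upper: "{c \<in> ?Q. C < c} = (\<lambda>e. u p - e) ` avoiding (\<lambda>x. - \<rho> x) (u p - C) (u p - C)"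
          proof -
            have "{c \<in> ?Q. C < c} = {c \<in> E. C \<subset> c}"
              using Wup[OF C] WE CE by (auto simp: avoiding_def E_def)
            then show ?thesis using upper_interval[OF CE] by simp
          qed
          have CI: "C \<in> rank_ideals \<rho> P" "p \<notin> C" "?a \<subseteq> C" using CE by (auto simp: E_def)
          have "C \<subset> P" using rank_idealsD(1)[OF CI(1)] CI(2) p(1) aP by blast
          then have cC: "card C < card P" by (rule psubset_card_mono[OF finP])
          have "?a \<in> rank_ideals \<rho> C" using rank_ideals_sub[OF CI(1)] a'_ideal CI(3) by blast
          then have vl: "vertex_decomposable (order_complex (avoiding \<rho> C ?a))"
            by (rule outer[OF cC fin_mem[OF CI(1)]])
          have "card (u p - C) < card P" using card_up card_mono[OF finu, of "u p - C"] by auto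
          then have vX: "vertex_decomposable (order_complex (avoiding (\<lambda>x. - \<rho> x) (u p - C) (u p - C)))"
            using finu by (intro outer) (auto simp: rank_ideals_def)
          let ?X = "avoiding (\<lambda>x. - \<rho> x) (u p - C) (u p - C)"
          have sub: "e \<subseteq> u p" if "e \<in> ?X" for e using that by (auto simp: avoiding_def rank_ideals_def)
          have "order_complex ((\<lambda>e. u p - e) ` ?X) = (`) (\<lambda>e. u p - e) ` order_complex ?X"
            by (rule order_complex_antitone_image) (use sub in blast)
          moreover have "inj_on (\<lambda>e. u p - e) ?X" by (rule inj_onI) (use sub in blast)
          then have "inj_on (\<lambda>e. u p - e) (\<Union>(order_complex ?X))"
            by (rule inj_on_subset) (auto simp: order_complex_def)
          ultimately have vu: "vertex_decomposable (order_complex ((\<lambda>e. u p - e) ` ?X))"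
            using vertex_decomposable_image[OF vX] by simp
          show ?case
          proof (rule vertex_decomposable.shedding)
            show "simplicial_complex (order_complex ?Q)" by (rule order_complex_complex[OF finQ])
            show "pure_complex (order_complex ?Q)" by (rule facets_full_pure[OF full])
            show "{C} \<in> order_complex ?Q" using C by (auto simp: order_complex_def)
            have "n = card (W - {C})" "W - {C} \<subseteq> E" using Suc.hyps(2) C finW WE by auto
            from Suc.hyps(1)[OF this up'] show "vertex_decomposable (deletion (order_complex ?Q) C)"
              unfolding order_complex_deletion Q' .
            have "vertex_decomposable (join (order_complex {c \<in> ?Q. c < C}) (order_complex {c \<in> ?Q. C < c}))"
              by (rule vertex_decomposable_join[OF _ _ order_complex_intervals_disjoint])
                (simp_all only: lower upper vl vu)
            then show "vertex_decomposable (link (order_complex ?Q) {C})"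
              unfolding order_complex_link[OF UnI2[OF C]] .
            \<comment> \<open>A facet of the deletion has a member of every cardinality below
              \<open>d\<close>; one of cardinality \<open>card C\<close> that is comparable with
              \<open>C\<close> is \<open>C\<close> itself.\<close>
            have False if F: "F \<in> link (order_complex ?Q) {C}" "F \<in> facets (deletion (order_complex ?Q) C)" for F
            proof -
              have "card ` F = {..<d}"
                using full' F(2) unfolding order_complex_deletion by (simp add: bij_betw_def)
              moreover have "card C < d" by (rule card_less_d[OF CI(1) p CI(2)])
              ultimately obtain c where c: "c \<in> F" "card c = card C" by (metis imageE lessThan_iff)
              have iC: "insert C F \<in> order_complex ?Q" "C \<notin> F" using F(1) by (auto simp: link_vertex)
              then have "c \<subseteq> C \<or> C \<subseteq> c" "c \<in> ?Q" using c(1) unfolding order_complex_def by blast+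
              moreover have "finite e" if "e \<in> ?Q" for e
                using that fin_mem WE unfolding avoiding_def E_def by blast
              ultimately have "c \<subseteq> C \<or> C \<subseteq> c" "finite c" by blast+
              then have "c = C" using c(2) fin_mem[OF CI(1)] card_subset_eq by metis
              then show False using c(1) iC(2) by blast
            qed
            then show "link (order_complex ?Q) {C} \<inter> facets (deletion (order_complex ?Q) C) = {}" by blast
          qed
        qed
        from this[of E] show ?thesis unfolding avoiding_split by blast
      qed
    qed
  qed
qed

section \<open>The equivalence\<close>

lemma sum_of_antichains_rank:
  assumes "sum_of_antichains P"
  obtains \<rho> :: "'a::order \<Rightarrow> int" where "\<And>x y. x \<in> P \<Longrightarrow> y \<in> P \<Longrightarrow> x < y \<longleftrightarrow> \<rho> x < \<rho> y"
proof -
  obtain r :: nat and A where "P = (\<Union>i\<le>r. A i) \<and> disjoint_family_on A {..r} \<and> (\<forall>i\<le>r. antichain (A i)) \<and>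
      (\<forall>i j. i < j \<and> j \<le> r \<longrightarrow> (\<forall>x\<in>A i. \<forall>y\<in>A j. x < y))"
    using assms unfolding sum_of_antichains_def by (elim exE)
  then have A: "P = (\<Union>i\<le>r. A i)" "\<forall>i\<le>r. antichain (A i)"
    "\<And>i j x y. i < j \<Longrightarrow> j \<le> r \<Longrightarrow> x \<in> A i \<Longrightarrow> y \<in> A j \<Longrightarrow> x < y"
    by simp_all
  have "\<forall>x. \<exists>i. x \<in> P \<longrightarrow> i \<le> r \<and> x \<in> A i" using A(1) by blast
  then obtain k where k: "\<And>x. x \<in> P \<Longrightarrow> k x \<le> r \<and> x \<in> A (k x)" by metis
  have "x < y \<longleftrightarrow> k x < k y" if xy: "x \<in> P" "y \<in> P" for x y
  proof
    assume "k x < k y" then show "x < y" using A(3)[of "k x" "k y" x y] k xy by blast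
  next
    assume less: "x < y"
    have "k x \<noteq> k y" using A(2) k[OF xy(1)] k[OF xy(2)] less unfolding antichain_def by (metis less_le)
    moreover have "\<not> k y < k x" using A(3)[of "k y" "k x" y x] k xy less by (meson less_asym)
    ultimately show "k x < k y" by linarith
  qed
  then show ?thesis using that[of "\<lambda>x. int (k x)"] by simp
qed

lemma not_above_poset_ideals:
  assumes "\<And>x y. x \<in> P \<Longrightarrow> y \<in> P \<Longrightarrow> x < y \<longleftrightarrow> \<rho> x < \<rho> y"
  shows "poset_ideals P = rank_ideals \<rho> P" "not_above (poset_ideals P) a = avoiding \<rho> P a"
proof -
  show eq: "poset_ideals P = rank_ideals \<rho> P"
    unfolding poset_ideals_def rank_ideals_def using assms by (auto simp: subset_iff order.order_iff_strict)
  show "not_above (poset_ideals P) a = avoiding \<rho> P a"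
    unfolding not_above_def avoiding_def eq by simp
qed

lemma avoiding_balanced:
  assumes "finite P" "a \<in> rank_ideals \<rho> P"
  obtains d where "\<And>M. M \<in> facets (order_complex (avoiding \<rho> P a)) \<Longrightarrow> bij_betw card M {..<d}"
proof (cases "a = {}")
  case True
  \<comment> \<open>No ideal avoids the empty set; the only facet is empty and
    \<open>d = 0\<close>.\<close>
  then have "order_complex (avoiding \<rho> P a) = {{}}" by (auto simp: avoiding_def order_complex_def)
  then have "M = {}" if "M \<in> facets (order_complex (avoiding \<rho> P a))" for M
    using facetsD(1)[OF that] by simp
  then show ?thesis using that[of 0] by (auto simp: bij_betw_def)
next
  case False
  have fina: "finite a" using finite_subset[OF rank_idealsD(1)[OF assms(2)] assms(1)] .
  define t where "t = Max (\<rho> ` a)"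
  have "t \<in> \<rho> ` a" unfolding t_def using fina False by (intro Max_in) auto
  then obtain p where p: "p \<in> a" "\<rho> p = t" by auto
  interpret top_rank \<rho> P a t
    by unfold_locales (use assms fina in \<open>auto simp: t_def\<close>)
  show ?thesis using that avoiding_full[OF p] by blast
qed

section \<open>From facet sizes to a sum of antichains\<close>

lemma ideal_chain:
  fixes u :: "'a::order set"
  assumes "finite P" "u \<in> poset_ideals P"
  shows "\<exists>M. M \<subseteq> {c \<in> poset_ideals P. c \<subseteq> u} \<and> M \<in> order_complex (poset_ideals P) \<and> card M = Suc (card u)"
  using assms(2)
proof (induction "card u" arbitrary: u)
  case 0
  then have "u = {}" using finite_subset[OF _ assms(1)] by (auto simp: poset_ideals_def)
  then show ?case using 0 by (intro exI[of _ "{{}}"]) (auto simp: order_complex_def)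
next
  case (Suc n)
  have finu: "finite u" using Suc.prems finite_subset[OF _ assms(1)] by (auto simp: poset_ideals_def)
  have "u \<noteq> {}" using Suc.hyps(2) by auto
  then obtain x where x: "x \<in> u" "\<And>y. y \<in> u \<Longrightarrow> x \<le> y \<Longrightarrow> y = x" using finite_has_maximal[OF finu] by metis
  have I: "u - {x} \<in> poset_ideals P" using Suc.prems x unfolding poset_ideals_def by blast
  have n: "n = card (u - {x})" using Suc.hyps(2) x(1) finu by simp
  obtain M where M: "M \<subseteq> {c \<in> poset_ideals P. c \<subseteq> u - {x}}" "M \<in> order_complex (poset_ideals P)"
    "card M = Suc (card (u - {x}))"
    using Suc.hyps(1)[OF n I] by blast
  have "u \<notin> M" using M(1) x(1) by blast
  moreover have "finite M" using M(3) by (intro card_ge_0_finite) simp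
  ultimately have "card (insert u M) = Suc (card u)" using M(3) Suc.hyps(2) x(1) finu by simp
  moreover have "insert u M \<in> order_complex (poset_ideals P)"
    using M(1,2) Suc.prems unfolding order_complex_def by blast
  ultimately show ?case using M(1) Suc.prems by (intro exI[of _ "insert u M"]) blast
qed

lemma incomparable_card_upper_le:
  fixes P :: "'a::order set"
  assumes P: "finite P" and pq: "p \<in> P" "q \<in> P" "\<not> p \<le> q" "\<not> q \<le> p"
    and bound: "\<And>a F G. a \<in> poset_ideals P \<Longrightarrow> F \<in> facets (order_complex (not_above (poset_ideals P) a)) \<Longrightarrow>
      G \<in> order_complex (not_above (poset_ideals P) a) \<Longrightarrow> card G \<le> card F"
  shows "card {x \<in> P. p \<le> x} \<le> card {x \<in> P. q \<le> x}"
proof -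
  let ?L = "poset_ideals P"
  define a where "a = {x \<in> P. x \<le> p \<or> x \<le> q}"
  define u where "u y = {x \<in> P. \<not> y \<le> x}" for y
  let ?Q = "not_above ?L a"
  have aL: "a \<in> ?L" unfolding a_def poset_ideals_def by (auto intro: order.trans)
  have uL: "u y \<in> ?L" for y unfolding u_def poset_ideals_def by (auto intro: order.trans)
  have cu: "c \<subseteq> u y" if "c \<in> ?L" "y \<in> P" "y \<notin> c" for c y
    using that unfolding u_def poset_ideals_def by blast
  have Q: "c \<in> ?Q \<longleftrightarrow> c \<in> ?L \<and> \<not> (p \<in> c \<and> q \<in> c)" for c
    using pq unfolding not_above_def a_def poset_ideals_def by blast
  have finQ: "finite ?Q"
    by (rule finite_subset[of _ "Pow P"]) (auto simp: not_above_def poset_ideals_def P)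
  have card_u: "card (u y) + card {x \<in> P. y \<le> x} = card P" for y
  proof -
    have "u y \<union> {x \<in> P. y \<le> x} = P" "u y \<inter> {x \<in> P. y \<le> x} = {}" by (auto simp: u_def)
    then show ?thesis using card_Un_disjoint[of "u y" "{x \<in> P. y \<le> x}"] P finite_subset[of _ P] by (auto simp: u_def)
  qed
  have "u p \<in> ?Q" unfolding Q using uL by (auto simp: u_def)
  then have "{u p} \<in> order_complex ?Q" by (auto simp: order_complex_def)
  then obtain F where F: "F \<in> facets (order_complex ?Q)" "u p \<in> F"
    using face_in_facet[OF order_complex_complex[OF finQ]] by (metis insert_subset)
  have FQ: "F \<subseteq> ?Q" and chain: "\<And>c e. c \<in> F \<Longrightarrow> e \<in> F \<Longrightarrow> c \<subseteq> e \<or> e \<subseteq> c"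
    using facetsD(1)[OF F(1)] by (auto simp: order_complex_def)
  \<comment> \<open>An ideal above \<open>u p\<close> contains \<open>q\<close>, hence as a member
    of \<open>?Q\<close> lacks \<open>p\<close>, hence lies below \<open>u p\<close>: the facet
    \<open>F\<close> ends at \<open>u p\<close>, which bounds its size.\<close>
  have sub: "c \<subseteq> u p" if c: "c \<in> F" for c
  proof (cases "u p \<subseteq> c")
    case True
    have cQ: "c \<in> ?L" "\<not> (p \<in> c \<and> q \<in> c)" using FQ c Q by auto
    have "q \<in> u p" using pq by (simp add: u_def)
    then have "p \<notin> c" using True cQ by blast
    then show ?thesis using cu cQ pq by blast
  qed (use chain[OF c F(2)] in blast)
  have finu: "finite (u p)" using P by (simp add: u_def)
  have "inj_on card F"
  proof (rule inj_onI)
    fix c e assume ce: "c \<in> F" "e \<in> F" "card c = card e"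
    then show "c = e" using chain[OF ce(1,2)] sub finite_subset[OF _ finu] card_subset_eq by metis
  qed
  moreover have "card ` F \<subseteq> {..card (u p)}" using sub card_mono[OF finu] by auto
  ultimately have "card F \<le> Suc (card (u p))" using card_inj_on_le[of card F "{..card (u p)}"] by simp
  \<comment> \<open>A full chain of ideals inside \<open>u q\<close> stays in \<open>?Q\<close>
    because its members lack \<open>q\<close>; comparing it with \<open>F\<close> gives
    \<open>card (u q) \<le> card (u p)\<close>.\<close>
  moreover obtain G where G: "G \<subseteq> {c \<in> ?L. c \<subseteq> u q}" "G \<in> order_complex ?L" "card G = Suc (card (u q))"
    using ideal_chain[OF P uL] by blast
  have "G \<subseteq> ?Q"
  proof
    fix c assume "c \<in> G"
    then show "c \<in> ?Q" using G(1) unfolding Q by (auto simp: u_def)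
  qed
  then have "G \<in> order_complex ?Q" using G(2) by (auto simp: order_complex_def)
  then have "card G \<le> card F" by (rule bound[OF aL F(1)])
  ultimately show ?thesis using G(3) card_u[of p] card_u[of q] by linarith
qed

lemma sum_of_antichainsI:
  fixes P :: "'a::order set"
  assumes P: "finite P"
    and bound: "\<And>a F G. a \<in> poset_ideals P \<Longrightarrow> F \<in> facets (order_complex (not_above (poset_ideals P) a)) \<Longrightarrow>
      G \<in> order_complex (not_above (poset_ideals P) a) \<Longrightarrow> card G \<le> card F"
  shows "sum_of_antichains P"
proof -
  define f where "f x = card {y \<in> P. x \<le> y}" for x
  define N where "N = card P"
  have fN: "f x \<le> N" for x unfolding f_def N_def using P by (intro card_mono) auto
  have "f x \<le> f y" if "x \<in> P" "y \<in> P" "\<not> x \<le> y" "\<not> y \<le> x" for x y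
    unfolding f_def by (rule incomparable_card_upper_le[OF P that bound])
  then have incomp: "f x = f y" if "x \<in> P" "y \<in> P" "\<not> x \<le> y" "\<not> y \<le> x" for x y
    using that by (meson order.antisym)
  have anti: "f y \<le> f x" if "x \<le> y" for x y
    unfolding f_def using P that by (intro card_mono) (auto intro: order.trans)
  have strict: "f y < f x" if "x < y" "x \<in> P" for x y
    unfolding f_def
  proof (rule psubset_card_mono)
    have "x \<in> {z \<in> P. x \<le> z}" "x \<notin> {z \<in> P. y \<le> z}" using that by auto
    moreover have "{z \<in> P. y \<le> z} \<subseteq> {z \<in> P. x \<le> z}" using that(1) by auto
    ultimately show "{z \<in> P. y \<le> z} \<subset> {z \<in> P. x \<le> z}" by blast
  qed (use P in simp)
  \<comment> \<open>Small elements have many elements above them, so the index runs against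
    \<open>f\<close>; by \<open>fN\<close> the subtraction does not truncate, and
    \<open>N - f x\<close> is the level of \<open>x\<close>.\<close>
  define A where "A i = {x \<in> P. f x = N - i}" for i
  have "P = (\<Union>i\<le>N. A i)"
  proof
    show "P \<subseteq> (\<Union>i\<le>N. A i)"
    proof
      fix x assume "x \<in> P"
      then have "x \<in> A (N - f x)" using fN[of x] by (simp add: A_def)
      then show "x \<in> (\<Union>i\<le>N. A i)" by (intro UN_I[of "N - f x"]) auto
    qed
  qed (auto simp: A_def)
  moreover have "disjoint_family_on A {..N}" by (auto simp: disjoint_family_on_def A_def)
  moreover have "antichain (A i)" for i
    unfolding antichain_def A_def using strict by (fastforce simp: order.order_iff_strict)
  \<comment> \<open>Elements with different values of \<open>f\<close> are comparable by
    \<open>incomp\<close>, and \<open>anti\<close> fixes the direction.\<close>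
  moreover have "x < y" if ij: "i < j" "j \<le> N" "x \<in> A i" "y \<in> A j" for i j x y
  proof -
    have xy: "x \<in> P" "y \<in> P" "f y < f x" using ij by (auto simp: A_def)
    then show ?thesis using incomp[of x y] anti[of y x] by (metis leD nless_le order.irrefl)
  qed
  ultimately show ?thesis unfolding sum_of_antichains_def by blast
qed

lemma pure_complex_card_le:
  assumes "simplicial_complex \<Delta>" "pure_complex \<Delta>" "F \<in> facets \<Delta>" "G \<in> \<Delta>"
  shows "card G \<le> card F"
proof -
  obtain H where H: "H \<in> facets \<Delta>" "G \<subseteq> H" using face_in_facet[OF assms(1,4)] .
  then have "card H = card F" using assms(2,3) unfolding pure_complex_def by blast
  then show ?thesis using card_mono[OF simplicial_complexD(4)[OF assms(1) facetsD(1)[OF H(1)]] H(2)] by simp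
qed

theorem theorem3p7:
  fixes P :: "'a::order set" and L :: "'a set set"
  assumes "finite P"
    and "L = poset_ideals P"
  shows "(sum_of_antichains P \<longleftrightarrow>
            (\<forall>a\<in>L. vertex_decomposable (order_complex (not_above L a)))) \<and>
         (sum_of_antichains P \<longleftrightarrow>
            (\<forall>a\<in>L. shellable (order_complex (not_above L a)))) \<and>
         (sum_of_antichains P \<longleftrightarrow>
            (\<forall>a\<in>L. cohen_macaulay TYPE('k::field) (order_complex (not_above L a))))"
proof -
  have fin: "finite (not_above L a)" for a
    by (rule finite_subset[of _ "Pow P"]) (auto simp: not_above_def assms poset_ideals_def)
  note sc = order_complex_complex[OF fin]
  have antichains: "sum_of_antichains P"
    if "\<And>a. a \<in> L \<Longrightarrow> pure_complex (order_complex (not_above L a))"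
    by (rule sum_of_antichainsI[OF assms(1)])
      (rule pure_complex_card_le[OF sc[unfolded assms(2)] that[unfolded assms(2)]])
  have all: "vertex_decomposable (order_complex (not_above L a)) \<and> shellable (order_complex (not_above L a)) \<and>
      cohen_macaulay TYPE('k) (order_complex (not_above L a))"
    if s: "sum_of_antichains P" and a: "a \<in> L" for a
  proof -
    obtain \<rho> where \<rho>: "\<And>x y. x \<in> P \<Longrightarrow> y \<in> P \<Longrightarrow> x < y \<longleftrightarrow> \<rho> x < (\<rho> y :: int)"
      using sum_of_antichains_rank[OF s] by blast
    have aR: "a \<in> rank_ideals \<rho> P" using a not_above_poset_ideals(1)[OF \<rho>] assms(2) by simp
    have eq: "not_above L a = avoiding \<rho> P a" using not_above_poset_ideals(2)[OF \<rho>] assms(2) by simp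
    let ?\<Delta> = "order_complex (not_above L a)"
    have vd: "vertex_decomposable ?\<Delta>"
      unfolding eq by (rule avoiding_vertex_decomposable[OF assms(1) aR])
    then obtain Fs where Fs: "distinct Fs" "set Fs = facets ?\<Delta>" "shelling Fs"
      using vertex_decomposable_shelling by blast
    have shellable: "shellable ?\<Delta>"
      using shelling_imp_shellable[OF _ _ Fs] vertex_decomposable_imp[OF vd] by blast
    obtain d where d: "\<And>M. M \<in> facets ?\<Delta> \<Longrightarrow> bij_betw card M {..<d}"
      using avoiding_balanced[OF assms(1) aR] unfolding eq by blast
    have "?\<Delta> = (\<Union>F\<in>set Fs. Pow F)"
    proof
      show "?\<Delta> \<subseteq> (\<Union>F\<in>set Fs. Pow F)"
      proof
        fix G assume "G \<in> ?\<Delta>"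
        then obtain F where "F \<in> facets ?\<Delta>" "G \<subseteq> F" using face_in_facet[OF sc] by metis
        then show "G \<in> (\<Union>F\<in>set Fs. Pow F)" unfolding Fs(2) by blast
      qed
      show "(\<Union>F\<in>set Fs. Pow F) \<subseteq> ?\<Delta>"
      proof
        fix G assume "G \<in> (\<Union>F\<in>set Fs. Pow F)"
        then obtain F where "F \<in> facets ?\<Delta>" "G \<subseteq> F" unfolding Fs(2) by blast
        then show "G \<in> ?\<Delta>" by (rule simplicial_complexD(3)[OF sc facetsD(1)])
      qed
    qed
    then have "cohen_macaulay TYPE('k) ?\<Delta>"
      by (rule balanced_shelling_cohen_macaulay[OF sc Fs(3) _ d[unfolded Fs(2)[symmetric]]])
    then show ?thesis using vd shellable by blast
  qed
  have "sum_of_antichains P" if cm: "\<forall>a\<in>L. cohen_macaulay TYPE('k) (order_complex (not_above L a))"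
    by (rule sum_of_antichainsI[OF assms(1)])
      (rule cohen_macaulay_facet_card[OF cm[unfolded assms(2), rule_format]])
  moreover have "sum_of_antichains P" if "\<forall>a\<in>L. vertex_decomposable (order_complex (not_above L a))"
    using antichains vertex_decomposable_imp that by blast
  moreover have "sum_of_antichains P" if "\<forall>a\<in>L. shellable (order_complex (not_above L a))"
    using antichains that unfolding shellable_def by blast
  ultimately show ?thesis using all by blast
qed

end
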